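(* Let $\mu$ be a Borel probability measure on $\mathbb{C}$ and let $(Z_j)_{j\ge 1}$ be i.i.d. complex random variables with distribution $\mu$, defined on a common probability space. Let $P_n(z)=(z-Z_1)\cdots(z-Z_n)$, and for $k\in\mathbb{N}$ and $n>k$ let $\nu_n^{(k)}$ be the empirical measure of the zeros of the $k$-th derivative $P_n^{(k)}$. Then almost surely, for each fixed $k\in\mathbb{N}$, the sequence of measures $\nu_n^{(k)}$ converges weakly to $\mu$ as $n\to\infty$.
   Context: $\mathbb{N}=\{1,2,\dots\}$. For $n>k$, the empirical measure of the zeros of $P_n^{(k)}$ is the random probability measure $\nu_n^{(k)}=\frac{1}{n-k}\sum_{z\in\mathbb{C}:\,P_n^{(k)}(z)=0}\delta_z$, where zeros are counted with multiplicity and $\delta_y$ is the point mass at $y$. *)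

theory Defs
  imports
    "HOL-Probability.Probability"
    "HOL-Computational_Algebra.Computational_Algebra"
begin

definition random_poly :: "(nat \<Rightarrow> complex) \<Rightarrow> nat \<Rightarrow> complex poly" where
  "random_poly z n = (\<Prod>j = 1..n. [:- z j, 1:])"

text \<open>
  The \<open>k\<close>-th derivative of the degree-\<open>n\<close> polynomial has \<open>n - k\<close> zeros with multiplicity; the
  multiset \<^const>\<open>proots\<close> carries the multiplicities, and \<open>indicator A w\<close> is the mass that the
  point measure at \<open>w\<close> gives to \<open>A\<close>. Only \<open>k < n\<close> is meaningful (for \<open>n \<le> k\<close> the subtraction
  truncates to \<open>0\<close> and there are no zeros, so the result is the null measure).
\<close>

definition deriv_zeros_measure :: "(nat \<Rightarrow> complex) \<Rightarrow> nat \<Rightarrow> nat \<Rightarrow> complex measure" where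
  "deriv_zeros_measure z k n =
     measure_of UNIV (sets borel)
       (\<lambda>A. (\<Sum>w\<in>#proots ((pderiv ^^ k) (random_poly z n)). indicator A w) / of_nat (n - k))"

text \<open>
  Weak convergence of finite Borel measures, tested against bounded continuous real functions;
  the library's \<^const>\<open>weak_conv_m\<close> covers only measures on the real line.
\<close>

definition weakly_converges ::
    "(nat \<Rightarrow> 'a::topological_space measure) \<Rightarrow> 'a measure \<Rightarrow> bool" where
  "weakly_converges N \<mu> \<longleftrightarrow>
     (\<forall>f :: 'a \<Rightarrow> real. continuous_on UNIV f \<and> bounded (range f) \<longrightarrow>
        (\<lambda>n. integral\<^sup>L (N n) f) \<longlonglongrightarrow> integral\<^sup>L \<mu> f)"

lemma space_deriv_zeros_measure [simp]: "space (deriv_zeros_measure z k n) = UNIV"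
  unfolding deriv_zeros_measure_def by (rule space_measure_of) auto

lemma sets_deriv_zeros_measure [simp, measurable_cong]:
  "sets (deriv_zeros_measure z k n) = sets borel"
  unfolding deriv_zeros_measure_def
  using sets.sets_measure_of_eq[of "borel :: complex measure"] by simp

lemma suminf_sum_mset_indicator:
  fixes A :: "nat \<Rightarrow> 'a set"
  assumes "disjoint_family A"
  shows "(\<Sum>i. \<Sum>w\<in>#X. indicator (A i) w) = (\<Sum>w\<in>#X. indicator (\<Union>i. A i) w :: ennreal)"
proof (induction X)
  case (add x X)
  have "(\<Sum>i. \<Sum>w\<in>#add_mset x X. indicator (A i) w :: ennreal)
      = (\<Sum>i. indicator (A i) x + (\<Sum>w\<in>#X. indicator (A i) w))" by simp
  also have "\<dots> = (\<Sum>i. indicator (A i) x) + (\<Sum>i. \<Sum>w\<in>#X. indicator (A i) w)"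
    by (rule suminf_add[symmetric]) auto
  finally show ?case
    using add suminf_indicator[OF assms, of x] by simp
qed simp

lemma emeasure_deriv_zeros_measure:
  assumes "A \<in> sets borel"
  shows "emeasure (deriv_zeros_measure z k n) A =
    (\<Sum>w\<in>#proots ((pderiv ^^ k) (random_poly z n)). indicator A w) / of_nat (n - k)"
proof (rule emeasure_measure_of[OF deriv_zeros_measure_def])
  show "countably_additive (sets (deriv_zeros_measure z k n))
    (\<lambda>A. (\<Sum>w\<in>#proots ((pderiv ^^ k) (random_poly z n)). indicator A w) / of_nat (n - k))"
    by (auto simp: countably_additive_def suminf_sum_mset_indicator divide_ennreal_def)
qed (use assms in \<open>auto simp: positive_def\<close>)

lemma degree_funpow_pderiv:
  fixes p :: "complex poly"
  shows "degree ((pderiv ^^ k) p) = degree p - k"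
  by (induction k) (auto simp: degree_pderiv)

lemma degree_random_poly: "degree (random_poly z n) = n"
  unfolding random_poly_def by (subst degree_prod_sum_eq) auto

lemma prob_space_deriv_zeros_measure:
  assumes "k < n"
  shows "prob_space (deriv_zeros_measure z k n)"
proof
  have "size (proots ((pderiv ^^ k) (random_poly z n))) = n - k"
    by (simp add: size_proots_complex degree_funpow_pderiv degree_random_poly)
  then show "emeasure (deriv_zeros_measure z k n) (space (deriv_zeros_measure z k n)) = 1"
    using assms
    by (simp add: emeasure_deriv_zeros_measure)
       (rule ennreal_divide_self, auto simp: of_nat_less_top)
qed

end

(*
Let nu be the zero measure of the k-th derivative of P_n and mu_n the empirical measure of
Z_1, ..., Z_n. Their logarithmic potentials differ, up to o(1), by w_n = (1/n) log |P_n^(k) / P_n|,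
and nu - mu_n tends weakly to 0 once w_n tends to 0 almost everywhere. The upper bound for w_n is
elementary. For the lower bound, let each Z_j with j <= n be exchanged for Z_(n+j) according to a
fair coin, which does not change the law, and let all but few coins be frozen. If k + 1 coin
patterns all make |P_n^(k)(b) / P_n(b)| exponentially small, then the Wronskian at b of the k + 1
low-degree polynomials carrying the free coins is exponentially small, which fails off a tiny set of
points b unless, for each of d small discs, two patterns place equally many roots in it. Hence the
number of roots in each disc takes at most k values on the bad patterns; the probability of this is
a large negative power of n, so a Borel-Cantelli argument applies. If mu has finite support, the
multiplicities of the zeros of P_n drop by at most k and the claim is immediate.
*)
theory Submission
  imports Defs "Jordan_Normal_Form.Determinant"
begin

section \<open>Logarithmic potentials\<close>

text \<open>By Leibniz' rule the \<open>k\<close>-th Taylor coefficient of \<open>pat * F\<close> at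
  \<open>b\<close> is linear in the ratios \<open>taylor_coeff F b (k - i) / poly F b\<close>, whose
  entry at \<open>i = k\<close> is 1. Thus \<open>k + 1\<close> patterns give a square system, and
  Cramer's rule turns small right-hand sides into a small determinant free of \<open>F\<close>. That
  determinant is bounded below at one point near a disc: after scaling, its matrix is there close to
  the integer matrix of binomials of the root counts, regular because the counts are distinct. As a
  polynomial of low degree in \<open>b\<close> it can then be tiny only near its few zeros. One disc
  gains only a factor of order \<open>1 / sqrt m\<close>, where \<open>m\<close> is a small power of
  \<open>n\<close>, hence the need for many discs. Bad points are measured by area, because they
  move with the sample. Nothing is known about the tails of \<open>\<mu>\<close>, so potentials are
  only compared with each other: circle means of \<open>ln\<close> are Lipschitz, and the difference
  of two such means is a compactly supported bump.\<close>

definition log_max :: "real \<Rightarrow> complex \<Rightarrow> real" where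
  "log_max r x = ln (max r (norm x))"

lemma ln_diff_le_of_ge:
  fixes a b r :: real
  assumes "r > 0" "r \<le> a" "r \<le> b"
  shows "\<bar>ln a - ln b\<bar> \<le> \<bar>a - b\<bar> / r"
proof -
  have *: "ln a - ln b \<le> \<bar>a - b\<bar> / r" if "r \<le> a" "r \<le> b" for a b :: real
  proof -
    have "ln a - ln b = ln (a / b)" using assms that by (simp add: ln_div)
    also have "\<dots> \<le> a / b - 1" using assms that by (intro ln_le_minus_one) auto
    also have "\<dots> = (a - b) / b" using assms that by (simp add: field_simps)
    also have "\<dots> \<le> \<bar>a - b\<bar> / b" using assms that by (intro divide_right_mono) auto
    also have "\<dots> \<le> \<bar>a - b\<bar> / r" using assms that by (intro divide_left_mono) auto
    finally show ?thesis .
  qed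
  have "ln b - ln a \<le> \<bar>a - b\<bar> / r" using *[of b a] assms by (simp add: abs_minus_commute)
  with *[of a b] assms show ?thesis by linarith
qed

text \<open>This is what truncation buys: \<open>log_max r\<close> is the mean of
  \<open>ln (norm (x - \<zeta>))\<close> over the circle \<open>norm \<zeta> = r\<close>, and unlike
  \<open>ln (norm x)\<close> it has slope at most \<open>1 / r\<close>.\<close>

lemma log_max_lipschitz:
  assumes "r > 0"
  shows "\<bar>log_max r x - log_max r y\<bar> \<le> norm (x - y) / r"
proof -
  have "\<bar>log_max r x - log_max r y\<bar> \<le> \<bar>max r (norm x) - max r (norm y)\<bar> / r"
    unfolding log_max_def using assms by (intro ln_diff_le_of_ge) auto
  also have "\<bar>max r (norm x) - max r (norm y)\<bar> \<le> norm (x - y)"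
    using norm_triangle_ineq3[of x y] by (auto simp: max_def)
  finally show ?thesis using assms by (simp add: divide_right_mono)
qed

lemma log_max_measurable [measurable]: "log_max r \<in> borel_measurable borel"
  unfolding log_max_def by measurable

text \<open>The truncation error of the potential kernel, \<open>ennreal\<close>-valued so that it
  can be summed and integrated without integrability side conditions. The value at 0, where
  \<open>ln 0 = 0\<close>, is harmless for Lebesgue measure.\<close>

definition log_defect :: "real \<Rightarrow> complex \<Rightarrow> ennreal" where
  "log_defect s z = ennreal \<bar>log_max s z - ln (norm z)\<bar>"

lemma log_defect_measurable [measurable]: "log_defect s \<in> borel_measurable borel"
  unfolding log_defect_def by measurable

text \<open>Layer-cake bound: with \<open>t = ln (s / norm z)\<close> the point lies in the disc of
  radius \<open>s * exp (- j)\<close> exactly for \<open>j \<le> t\<close>, which happens for more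
  than \<open>t\<close> values of \<open>j\<close> when \<open>t\<close> is positive.\<close>

lemma log_defect_le:
  assumes "s > 0" "z \<noteq> 0"
  shows "log_defect s z \<le> (\<Sum>j. indicator (cball 0 (s * exp (- real j))) z)"
proof (cases "norm z \<ge> s")
  case True
  then show ?thesis by (simp add: log_defect_def log_max_def max_def)
next
  case False
  define t where "t = ln (s / norm z)"
  have t: "t > 0" unfolding t_def using assms False by (intro ln_gt_zero) auto
  define J where "J = nat \<lfloor>t\<rfloor>"
  have in_ball: "z \<in> cball 0 (s * exp (- real j))" if "j \<le> J" for j
  proof -
    have "real j \<le> t" using that t unfolding J_def by linarith
    then have "exp (real j) \<le> s / norm z"
      unfolding t_def using assms by (subst ln_ge_iff [symmetric]) (auto simp: ln_ge_iff)
    then show ?thesis using assms by (simp add: exp_minus field_simps)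
  qed
  have "log_defect s z = ennreal t"
    using assms False t by (simp add: log_defect_def log_max_def max_def t_def ln_div)
  also have "t \<le> real (Suc J)" using t unfolding J_def by linarith
  then have "ennreal t \<le> ennreal (real (Suc J))" by (intro ennreal_leI)
  also have "\<dots> = (\<Sum>j<Suc J. 1)" by (simp only: ennreal_of_nat_eq_real_of_nat sum_constant card_lessThan mult_1_right)
  also have "\<dots> = (\<Sum>j<Suc J. indicator (cball 0 (s * exp (- real j))) z)"
    using in_ball by (intro sum.cong refl) (simp only: indicator_simps lessThan_iff less_Suc_eq_le)
  also have "\<dots> \<le> (\<Sum>j. indicator (cball 0 (s * exp (- real j))) z)"
    by (intro sum_le_suminf) auto
  finally show ?thesis .
qed

lemma emeasure_cball_complex:
  "r \<ge> 0 \<Longrightarrow> emeasure lborel (cball (c::complex) r) = ennreal (pi * r\<^sup>2)"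
  by (subst emeasure_cball) (auto simp: DIM_complex unit_ball_vol_2)

lemma AE_lborel_neq: "AE z in lborel. z \<noteq> (c::complex)"
  by (rule AE_I[of _ _ "{c}"]) auto

text \<open>Only the order \<open>s ^ 2\<close> matters: the defect becomes small in L1 as the
  truncation radius shrinks. The factor 2 estimates the geometric sum
  \<open>1 / (1 - exp (-2))\<close>.\<close>

lemma nn_integral_log_defect:
  assumes "s > 0"
  shows "(\<integral>\<^sup>+z. log_defect s z \<partial>lborel) \<le> ennreal (2 * pi * s\<^sup>2)"
proof -
  have "(\<integral>\<^sup>+z. log_defect s z \<partial>lborel)
      \<le> (\<integral>\<^sup>+z. (\<Sum>j. indicator (cball (0::complex) (s * exp (- real j))) z) \<partial>lborel)"
  proof (rule nn_integral_mono_AE)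
    show "AE z in lborel. log_defect s z \<le> (\<Sum>j. indicator (cball 0 (s * exp (- real j))) z)"
      using AE_lborel_neq[of 0] by eventually_elim (rule log_defect_le[OF assms])
  qed
  also have "\<dots> = (\<Sum>j. \<integral>\<^sup>+z. indicator (cball (0::complex) (s * exp (- real j))) z \<partial>lborel)"
    by (intro nn_integral_suminf borel_measurable_indicator) simp
  also have "\<dots> = (\<Sum>j. ennreal (pi * s\<^sup>2 * (exp (-2)) ^ j))"
  proof (intro suminf_cong)
    fix j :: nat
    have "(\<integral>\<^sup>+z. indicator (cball (0::complex) (s * exp (- real j))) z \<partial>lborel)
      = ennreal (pi * (s * exp (- real j))\<^sup>2)" using assms
      by (simp add: emeasure_cball_complex)
    also have "(s * exp (- real j))\<^sup>2 = s\<^sup>2 * exp (-2) ^ j"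
      by (simp add: power_mult_distrib exp_of_nat_mult [symmetric] power2_eq_square mult_exp_exp)
    finally show "(\<integral>\<^sup>+z. indicator (cball (0::complex) (s * exp (- real j))) z \<partial>lborel)
      = ennreal (pi * s\<^sup>2 * exp (-2) ^ j)" by (simp add: mult.assoc)
  qed
  also have "\<dots> = ennreal (pi * s\<^sup>2 * (1 / (1 - exp (-2))))"
    by (intro suminf_ennreal_eq sums_mult geometric_sums) auto
  also have "\<dots> \<le> ennreal (2 * pi * s\<^sup>2)"
  proof (rule ennreal_leI)
    have "(2::real) \<le> exp 2" using exp_ge_add_one_self[of 2] by simp
    then have "exp (-2) \<le> (1/2::real)" by (simp add: exp_minus field_simps)
    then have "1 / (1 - exp (-2)) \<le> (2::real)" by (simp add: field_simps)
    then have "pi * s\<^sup>2 * (1 / (1 - exp (-2))) \<le> pi * s\<^sup>2 * 2" by (intro mult_left_mono) auto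
    then show "pi * s\<^sup>2 * (1 / (1 - exp (-2))) \<le> 2 * pi * s\<^sup>2" by simp
  qed
  finally show ?thesis .
qed

lemma nn_integral_lborel_shift:
  fixes c :: complex
  assumes [measurable]: "f \<in> borel_measurable borel"
  shows "(\<integral>\<^sup>+z. f (c + z) \<partial>lborel) = (\<integral>\<^sup>+z. f z \<partial>lborel)"
  by (subst (2) lborel_distr_plus[symmetric, of c]) (simp add: nn_integral_distr)

lemma nn_integral_sum_mset:
  assumes [measurable]: "\<And>x. f x \<in> borel_measurable M"
  shows "(\<integral>\<^sup>+z. (\<Sum>x\<in>#X. f x z) \<partial>M) = (\<Sum>x\<in>#X. \<integral>\<^sup>+z. f x z \<partial>M)"
    and "(\<lambda>z. \<Sum>x\<in>#X. f x z) \<in> borel_measurable M"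
proof -
  have meas: "(\<lambda>z. \<Sum>x\<in>#X. f x z) \<in> borel_measurable M" for X
    by (induction X) auto
  show "(\<lambda>z. \<Sum>x\<in>#X. f x z) \<in> borel_measurable M" by (rule meas)
  show "(\<integral>\<^sup>+z. (\<Sum>x\<in>#X. f x z) \<partial>M) = (\<Sum>x\<in>#X. \<integral>\<^sup>+z. f x z \<partial>M)"
    by (induction X) (auto simp: nn_integral_add meas)
qed

lemma borel_measurable_sum_mset [measurable (raw)]:
  fixes f :: "'b \<Rightarrow> 'a \<Rightarrow> real"
  assumes [measurable]: "\<And>x. f x \<in> borel_measurable M"
  shows "(\<lambda>z. \<Sum>x\<in>#X. f x z) \<in> borel_measurable M"
  by (induction X) auto

lemma sum_mset_abs_diff_le:
  fixes f g h :: "'a \<Rightarrow> real"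
  assumes "\<And>x. \<bar>f x - g x\<bar> \<le> c"
  shows "\<bar>(\<Sum>x\<in>#X. f x) - (\<Sum>x\<in>#X. g x)\<bar> \<le> real (size X) * c"
proof (induction X)
  case (add x X)
  then show ?case using assms[of x] by (simp add: algebra_simps)
qed auto

lemma ennreal_sum_mset_abs_diff_le:
  fixes f g :: "'a \<Rightarrow> real"
  shows "ennreal \<bar>(\<Sum>x\<in>#X. f x) - (\<Sum>x\<in>#X. g x)\<bar> \<le> (\<Sum>x\<in>#X. ennreal \<bar>f x - g x\<bar>)"
proof (induction X)
  case (add x X)
  have "ennreal \<bar>(\<Sum>x\<in>#add_mset x X. f x) - (\<Sum>x\<in>#add_mset x X. g x)\<bar>
    \<le> ennreal (\<bar>f x - g x\<bar> + \<bar>(\<Sum>x\<in>#X. f x) - (\<Sum>x\<in>#X. g x)\<bar>)"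
    by (intro ennreal_leI) simp
  also have "\<dots> = ennreal \<bar>f x - g x\<bar> + ennreal \<bar>(\<Sum>x\<in>#X. f x) - (\<Sum>x\<in>#X. g x)\<bar>"
    by (rule ennreal_plus) auto
  also have "\<dots> \<le> ennreal \<bar>f x - g x\<bar> + (\<Sum>x\<in>#X. ennreal \<bar>f x - g x\<bar>)"
    using add by (intro add_left_mono) simp
  finally show ?case by simp
qed auto

text \<open>Difference of the logarithmic potentials of two multisets, not yet divided by
  \<open>n\<close>. At a point of the multisets \<open>ln 0 = 0\<close> gives a junk value, on a
  null set only.\<close>

definition pot_diff :: "complex multiset \<Rightarrow> complex multiset \<Rightarrow> complex \<Rightarrow> real" where
  "pot_diff X Y z = (\<Sum>x\<in>#X. ln (norm (z - x))) - (\<Sum>y\<in>#Y. ln (norm (z - y)))"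

definition pot_diff_max :: "real \<Rightarrow> complex multiset \<Rightarrow> complex multiset \<Rightarrow> complex \<Rightarrow> real" where
  "pot_diff_max r X Y z = (\<Sum>x\<in>#X. log_max r (z - x)) - (\<Sum>y\<in>#Y. log_max r (z - y))"

lemma pot_diff_measurable [measurable]: "pot_diff X Y \<in> borel_measurable borel"
  unfolding pot_diff_def by measurable

lemma pot_diff_max_measurable [measurable]: "pot_diff_max r X Y \<in> borel_measurable borel"
  unfolding pot_diff_max_def by measurable

lemma pot_diff_max_lipschitz:
  assumes "r > 0"
  shows "\<bar>pot_diff_max r X Y z - pot_diff_max r X Y w\<bar> \<le> real (size X + size Y) * (dist z w / r)"
proof -
  have *: "\<bar>log_max r (z - x) - log_max r (w - x)\<bar> \<le> dist z w / r" for x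
    using log_max_lipschitz[OF assms, of "z - x" "w - x"] by (simp add: dist_norm)
  show ?thesis
    unfolding pot_diff_max_def
    using sum_mset_abs_diff_le[of "\<lambda>x. log_max r (z - x)" "\<lambda>x. log_max r (w - x)", OF *, of X]
      sum_mset_abs_diff_le[of "\<lambda>x. log_max r (z - x)" "\<lambda>x. log_max r (w - x)", OF *, of Y]
    unfolding of_nat_add distrib_right by linarith
qed

lemma pot_diff_approx:
  "ennreal \<bar>pot_diff X Y z - pot_diff_max s X Y z\<bar> \<le> (\<Sum>x\<in>#X + Y. log_defect s (z - x))"
proof -
  have "ennreal \<bar>pot_diff X Y z - pot_diff_max s X Y z\<bar>
    \<le> ennreal (\<bar>(\<Sum>x\<in>#X. log_max s (z - x)) - (\<Sum>x\<in>#X. ln (norm (z - x)))\<bar>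
       + \<bar>(\<Sum>x\<in>#Y. log_max s (z - x)) - (\<Sum>x\<in>#Y. ln (norm (z - x)))\<bar>)"
    unfolding pot_diff_def pot_diff_max_def by (intro ennreal_leI) linarith
  also have "\<dots> = ennreal \<bar>(\<Sum>x\<in>#X. log_max s (z - x)) - (\<Sum>x\<in>#X. ln (norm (z - x)))\<bar>
       + ennreal \<bar>(\<Sum>x\<in>#Y. log_max s (z - x)) - (\<Sum>x\<in>#Y. ln (norm (z - x)))\<bar>"
    by (rule ennreal_plus) auto
  also have "\<dots> \<le> (\<Sum>x\<in>#X. log_defect s (z - x)) + (\<Sum>x\<in>#Y. log_defect s (z - x))"
    unfolding log_defect_def by (intro add_mono ennreal_sum_mset_abs_diff_le)
  finally show ?thesis by simp
qed

lemma nn_integral_sum_log_defect: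
  assumes "s > 0"
  shows "(\<integral>\<^sup>+z. (\<Sum>x\<in>#X. log_defect s (z - x)) \<partial>lborel) \<le> ennreal (real (size X) * (2 * pi * s\<^sup>2))"
proof -
  have "(\<integral>\<^sup>+z. (\<Sum>x\<in>#X. log_defect s (z - x)) \<partial>lborel) = (\<Sum>x\<in>#X. \<integral>\<^sup>+z. log_defect s (z - x) \<partial>lborel)"
    by (rule nn_integral_sum_mset) measurable
  also have "\<dots> = (\<Sum>x\<in>#X. \<integral>\<^sup>+z. log_defect s z \<partial>lborel)"
  proof (intro arg_cong[of _ _ sum_mset] image_mset_cong)
    fix x show "(\<integral>\<^sup>+z. log_defect s (z - x) \<partial>lborel) = (\<integral>\<^sup>+z. log_defect s z \<partial>lborel)"
      using nn_integral_lborel_shift[of "log_defect s" "- x"] by simp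
  qed
  also have "\<dots> = of_nat (size X) * (\<integral>\<^sup>+z. log_defect s z \<partial>lborel)"
    by simp
  also have "\<dots> \<le> of_nat (size X) * ennreal (2 * pi * s\<^sup>2)"
    by (intro mult_left_mono nn_integral_log_defect assms) auto
  also have "\<dots> = ennreal (real (size X) * (2 * pi * s\<^sup>2))"
    by (simp add: ennreal_of_nat_eq_real_of_nat ennreal_mult)
  finally show ?thesis .
qed

section \<open>From almost everywhere convergence to local L1 convergence\<close>

context
  fixes X Y :: "nat \<Rightarrow> complex multiset"
  assumes size_le: "\<And>n. size (X n) \<le> n" "\<And>n. size (Y n) \<le> n"
begin

lemma pot_diff_max_mean_lipschitz:
  assumes "r > 0"
  shows "\<bar>pot_diff_max r (X n) (Y n) z / n - pot_diff_max r (X n) (Y n) w / n\<bar> \<le> 2 * dist z w / r"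
proof (cases "n = 0")
  case False
  have "\<bar>pot_diff_max r (X n) (Y n) z - pot_diff_max r (X n) (Y n) w\<bar> \<le> real (size (X n) + size (Y n)) * (dist z w / r)"
    by (rule pot_diff_max_lipschitz[OF assms])
  also have "\<dots> \<le> real (2 * n) * (dist z w / r)"
    using size_le[of n] assms by (intro mult_right_mono) auto
  finally have "\<bar>pot_diff_max r (X n) (Y n) z - pot_diff_max r (X n) (Y n) w\<bar> / n \<le> (real (2 * n) * (dist z w / r)) / n"
    by (intro divide_right_mono) auto
  then show ?thesis using False by (simp add: abs_divide diff_divide_distrib[symmetric])
qed (use assms in auto)

text \<open>Each normalised potential difference is L1-close to a Lipschitz function, with error and
  Lipschitz constant independent of \<open>n\<close>. The majorant \<open>G\<close> is made explicit
  so that its pointwise and its integrated bound can be used together.\<close>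

lemma pot_diff_mean_approx:
  assumes "s > 0"
  obtains G where "\<And>n. G n \<in> borel_measurable borel"
    "\<And>n z. ennreal \<bar>pot_diff (X n) (Y n) z / n - pot_diff_max s (X n) (Y n) z / n\<bar> \<le> G n z"
    "\<And>n. (\<integral>\<^sup>+z. G n z \<partial>lborel) \<le> ennreal (4 * pi * s\<^sup>2)"
proof
  define G where "G = (\<lambda>n z. ennreal (1 / real n) * (\<Sum>x\<in>#X n + Y n. log_defect s (z - x)))"
  have meas [measurable]: "(\<lambda>z. \<Sum>x\<in>#Z. log_defect s (z - x)) \<in> borel_measurable borel" for Z
    by (rule nn_integral_sum_mset(2)) measurable
  show "G n \<in> borel_measurable borel" for n
    unfolding G_def by measurable
  show "ennreal \<bar>pot_diff (X n) (Y n) z / n - pot_diff_max s (X n) (Y n) z / n\<bar> \<le> G n z" for n z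
  proof -
    have "ennreal \<bar>pot_diff (X n) (Y n) z / n - pot_diff_max s (X n) (Y n) z / n\<bar>
      = ennreal (1 / real n) * ennreal \<bar>pot_diff (X n) (Y n) z - pot_diff_max s (X n) (Y n) z\<bar>"
      by (simp add: ennreal_mult[symmetric] diff_divide_distrib[symmetric])
    also have "\<dots> \<le> G n z"
      unfolding G_def by (intro mult_left_mono pot_diff_approx) auto
    finally show ?thesis .
  qed
  show "(\<integral>\<^sup>+z. G n z \<partial>lborel) \<le> ennreal (4 * pi * s\<^sup>2)" for n
  proof -
    have "(\<integral>\<^sup>+z. G n z \<partial>lborel)
      = ennreal (1 / real n) * (\<integral>\<^sup>+z. (\<Sum>x\<in>#X n + Y n. log_defect s (z - x)) \<partial>lborel)"
      unfolding G_def using meas[of "X n + Y n"] by (intro nn_integral_cmult) simp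
    also have "\<dots> \<le> ennreal (1 / real n) * ennreal (real (size (X n + Y n)) * (2 * pi * s\<^sup>2))"
      by (intro mult_left_mono nn_integral_sum_log_defect assms) auto
    also have "\<dots> = ennreal ((real (size (X n + Y n)) / n) * (2 * pi * s\<^sup>2))"
      by (simp add: ennreal_mult[symmetric])
    also have "\<dots> \<le> ennreal (2 * (2 * pi * s\<^sup>2))"
    proof (intro ennreal_leI mult_right_mono)
      show "real (size (X n + Y n)) / n \<le> 2"
        using size_le[of n] by (cases "n = 0") (auto simp: field_simps)
    qed auto
    also have "2 * (2 * pi * s\<^sup>2) = 4 * pi * s\<^sup>2" by simp
    finally show ?thesis .
  qed
qed

context
  assumes lim: "AE z in lborel. (\<lambda>n. pot_diff (X n) (Y n) z / n) \<longlonglongrightarrow> 0"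
begin

lemma pot_diff_truncated_L1:
  assumes "K \<ge> 0" "e > 0"
  shows "\<forall>\<^sub>F n in sequentially. (\<integral>\<^sup>+z\<in>ball c R. ennreal (min \<bar>pot_diff (X n) (Y n) z / n\<bar> K) \<partial>lborel) < ennreal e"
proof -
  have [measurable]: "ball c R \<in> sets borel" by simp
  have "(\<lambda>n. \<integral>\<^sup>+z. ennreal (min \<bar>pot_diff (X n) (Y n) z / n\<bar> K) * indicator (ball c R) z \<partial>lborel)
    \<longlonglongrightarrow> (\<integral>\<^sup>+z. (0::ennreal) \<partial>(lborel :: complex measure))"
  proof (rule nn_integral_dominated_convergence[where w = "\<lambda>z. ennreal K * indicator (ball c R) z"])
    show "(\<integral>\<^sup>+z. ennreal K * indicator (ball c R) z \<partial>lborel) < \<infinity>"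
      using emeasure_lborel_ball_finite[of c R]
      by (simp add: nn_integral_cmult_indicator ennreal_mult_less_top)
    show "AE z in lborel. (\<lambda>n. ennreal (min \<bar>pot_diff (X n) (Y n) z / n\<bar> K) * indicator (ball c R) z) \<longlonglongrightarrow> 0"
      using lim
    proof eventually_elim
      case (elim z)
      have "(\<lambda>n. min \<bar>pot_diff (X n) (Y n) z / n\<bar> K) \<longlonglongrightarrow> min \<bar>0\<bar> K"
        by (intro tendsto_intros elim)
      then have "(\<lambda>n. ennreal (min \<bar>pot_diff (X n) (Y n) z / n\<bar> K)) \<longlonglongrightarrow> ennreal 0"
        using assms by (intro tendsto_ennrealI) simp
      then show ?case by (cases "z \<in> ball c R") auto
    qed
    show "AE z in lborel. ennreal (min \<bar>pot_diff (X n) (Y n) z / n\<bar> K) * indicator (ball c R) z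
      \<le> ennreal K * indicator (ball c R) z" for n
      by (intro AE_I2 mult_right_mono ennreal_leI) auto
  qed measurable
  then have "(\<lambda>n. \<integral>\<^sup>+z. ennreal (min \<bar>pot_diff (X n) (Y n) z / n\<bar> K) * indicator (ball c R) z \<partial>lborel) \<longlonglongrightarrow> 0"
    by simp
  from order_tendstoD(2)[OF this, of "ennreal e"] assms show ?thesis by simp
qed

text \<open>The roots are not confined to a bounded region, so nothing bounds the potentials a
  priori. Almost everywhere convergence yields one point of the ball at which the Lipschitz
  approximant is bounded, hence it is bounded by \<open>K\<close> on the whole ball; whatever the
  potential difference has above the level \<open>K\<close> is then paid for by \<open>G\<close>,
  whose integral is small.\<close>

lemma pot_diff_L1:
  assumes "e > 0"
  shows "\<forall>\<^sub>F n in sequentially. (\<integral>\<^sup>+z\<in>ball c R. ennreal \<bar>pot_diff (X n) (Y n) z / n\<bar> \<partial>lborel) \<le> ennreal e"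
proof (cases "R > 0")
  case False
  then have empty: "ball c R = {}" by auto
  have "(\<integral>\<^sup>+z\<in>ball c R. ennreal \<bar>pot_diff (X n) (Y n) z / n\<bar> \<partial>lborel) = (\<integral>\<^sup>+z. 0 \<partial>(lborel :: complex measure))" for n
    by (intro nn_integral_cong) (simp only: empty indicator_simps empty_iff not_False_eq_True mult_zero_right)
  also have "(\<integral>\<^sup>+z. 0 \<partial>(lborel :: complex measure)) = 0" by simp
  finally show ?thesis by (intro always_eventually allI) (simp only: zero_le)
next
  case True
  have [measurable]: "ball c R \<in> sets borel" by simp
  \<comment> \<open>The two bounds on \<open>4 * pi * s ^ 2\<close> serve the error
    \<open>e / 2\<close> and the search for a good point, where \<open>G n \<ge> 1\<close> may hold
    on at most a quarter of the disc.\<close>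
  define s where "s = sqrt (min (e / 2) (pi * R\<^sup>2 / 4) / (4 * pi))"
  have "min (e / 2) (pi * R\<^sup>2 / 4) > 0" using assms True by simp
  then have s: "s > 0" and s2: "4 * pi * s\<^sup>2 = min (e / 2) (pi * R\<^sup>2 / 4)" unfolding s_def by auto
  \<comment> \<open>\<open>2\<close> bounds the approximant at the good point, and
    \<open>4 * R / s\<close> is the Lipschitz constant \<open>2 / s\<close> times the diameter
    \<open>2 * R\<close>.\<close>
  define K where "K = 2 + 4 * R / s"
  have K: "K \<ge> 0" unfolding K_def using s True by auto
  obtain G where G_meas [measurable]: "\<And>n. G n \<in> borel_measurable borel" and
    G: "\<And>n z. ennreal \<bar>pot_diff (X n) (Y n) z / n - pot_diff_max s (X n) (Y n) z / n\<bar> \<le> G n z" and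
    G_int: "\<And>n. (\<integral>\<^sup>+z. G n z \<partial>lborel) \<le> ennreal (4 * pi * s\<^sup>2)"
    using pot_diff_mean_approx[OF s] by blast
  have "\<forall>\<^sub>F n in sequentially. (\<integral>\<^sup>+z\<in>ball c R. ennreal (min \<bar>pot_diff (X n) (Y n) z / n\<bar> 1) \<partial>lborel) < ennreal (pi * R\<^sup>2 / 4)"
    using True by (intro pot_diff_truncated_L1) auto
  moreover have "\<forall>\<^sub>F n in sequentially. (\<integral>\<^sup>+z\<in>ball c R. ennreal (min \<bar>pot_diff (X n) (Y n) z / n\<bar> K) \<partial>lborel) < ennreal (e / 2)"
    using assms K by (intro pot_diff_truncated_L1) auto
  ultimately show ?thesis
  proof eventually_elim
    case (elim n)
    define W where "W = (\<lambda>z. pot_diff (X n) (Y n) z / n)"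
    have W_meas [measurable]: "W \<in> borel_measurable borel" unfolding W_def by measurable
    define D where "D = (\<lambda>z. pot_diff_max s (X n) (Y n) z / n)"
    \<comment> \<open>By Markov's inequality the sets where \<open>\<bar>W z\<bar> \<ge> 1\<close>
      and where \<open>G n z \<ge> 1\<close> each have at most a quarter of the area of the disc, so
      they cannot cover it.\<close>
    have "\<exists>z\<in>ball c R. \<bar>W z\<bar> < 1 \<and> G n z < 1"
    proof (rule ccontr)
      assume "\<not> ?thesis"
      then have *: "1 \<le> \<bar>W z\<bar> \<or> 1 \<le> G n z" if "z \<in> ball c R" for z
        using that by (meson not_le)
      have "ennreal (pi * R\<^sup>2) = emeasure lborel (ball c R)"
        using True by (subst emeasure_ball) (auto simp: unit_ball_vol_2)
      also have "\<dots> = (\<integral>\<^sup>+z. indicator (ball c R) z \<partial>lborel)" by simp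
      also have "\<dots> \<le> (\<integral>\<^sup>+z. ennreal (min \<bar>W z\<bar> 1) * indicator (ball c R) z + G n z \<partial>lborel)"
      proof (rule nn_integral_mono)
        fix z
        show "indicator (ball c R) z \<le> ennreal (min \<bar>W z\<bar> 1) * indicator (ball c R) z + G n z"
        proof (cases "z \<in> ball c R")
          case True
          with *[OF True] show ?thesis
            by (auto simp: min_absorb2 intro: add_increasing add_increasing2)
        qed auto
      qed
      also have "\<dots> = (\<integral>\<^sup>+z\<in>ball c R. ennreal (min \<bar>W z\<bar> 1) \<partial>lborel) + (\<integral>\<^sup>+z. G n z \<partial>lborel)"
        by (rule nn_integral_add) measurable
      also have "\<dots> \<le> ennreal (pi * R\<^sup>2 / 4) + ennreal (pi * R\<^sup>2 / 4)"
        using elim(1) G_int[of n] s2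
        by (intro add_mono) (auto simp: W_def intro: order.trans[OF _ ennreal_leI])
      also have "\<dots> = ennreal (pi * R\<^sup>2 / 2)"
        using True by (subst ennreal_plus[symmetric]) auto
      finally have "pi * R\<^sup>2 \<le> pi * R\<^sup>2 / 2" by (subst (asm) ennreal_le_iff) auto
      then show False using True by simp
    qed
    then obtain z0 where z0: "z0 \<in> ball c R" "\<bar>W z0\<bar> < 1" "G n z0 < 1" by auto
    have "ennreal \<bar>W z0 - D z0\<bar> < 1"
      using G[of n z0] z0(3) unfolding W_def D_def by (rule order.strict_trans1)
    then have "\<bar>W z0 - D z0\<bar> < 1" by (simp add: ennreal_less_one_iff)
    then have Dz0: "\<bar>D z0\<bar> \<le> 2" using z0(2) by linarith
    have D: "\<bar>D w\<bar> \<le> K" if "w \<in> ball c R" for w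
    proof -
      have "dist z0 w \<le> 2 * R" using that z0(1) dist_triangle[of z0 w c] by (simp add: dist_commute)
      then have "2 * dist z0 w / s \<le> 2 * (2 * R) / s" using s by (intro divide_right_mono mult_left_mono) auto
      moreover have "\<bar>D z0 - D w\<bar> \<le> 2 * dist z0 w / s"
        unfolding D_def by (rule pot_diff_max_mean_lipschitz[OF s])
      ultimately show ?thesis using Dz0 unfolding K_def by linarith
    qed
    have "(\<integral>\<^sup>+z\<in>ball c R. ennreal \<bar>W z\<bar> \<partial>lborel)
      \<le> (\<integral>\<^sup>+z. ennreal (min \<bar>W z\<bar> K) * indicator (ball c R) z + G n z \<partial>lborel)"
    proof (rule nn_integral_mono)
      fix z
      show "ennreal \<bar>W z\<bar> * indicator (ball c R) z \<le> ennreal (min \<bar>W z\<bar> K) * indicator (ball c R) z + G n z"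
      proof (cases "z \<in> ball c R")
        case True
        have "\<bar>W z\<bar> \<le> min \<bar>W z\<bar> K + \<bar>W z - D z\<bar>" using D[OF True] by linarith
        then have "ennreal \<bar>W z\<bar> \<le> ennreal (min \<bar>W z\<bar> K + \<bar>W z - D z\<bar>)" by (rule ennreal_leI)
        also have "\<dots> = ennreal (min \<bar>W z\<bar> K) + ennreal \<bar>W z - D z\<bar>" using K by (intro ennreal_plus) auto
        also have "\<dots> \<le> ennreal (min \<bar>W z\<bar> K) + G n z"
          using G[of n z] unfolding W_def D_def by (intro add_left_mono)
        finally show ?thesis using True by simp
      qed auto
    qed
    also have "\<dots> = (\<integral>\<^sup>+z\<in>ball c R. ennreal (min \<bar>W z\<bar> K) \<partial>lborel) + (\<integral>\<^sup>+z. G n z \<partial>lborel)"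
      by (rule nn_integral_add) measurable
    also have "\<dots> \<le> ennreal (e / 2) + ennreal (e / 2)"
      using elim(2) G_int[of n] s2
      by (intro add_mono) (auto simp: W_def intro: order.trans[OF _ ennreal_leI])
    also have "\<dots> = ennreal e" using assms by (subst ennreal_plus[symmetric]) auto
    finally show ?case by (simp add: W_def)
  qed
qed


end

end

section \<open>Circle means through the solutions of \<open>\<zeta> ^ N = r ^ N\<close>\<close>

lemma rsquarefree_X_power_minus:
  assumes "N > 0" "c \<noteq> (0::complex)"
  shows "rsquarefree (monom 1 N - [:c:])"
proof -
  have "N = 0" if "a ^ N = c" "a ^ (N - Suc 0) = 0" for a
    using that assms by (auto simp: power_0_left split: if_splits)
  then show ?thesis using assms
    by (auto simp: rsquarefree_roots pderiv_diff pderiv_monom poly_monom pderiv_pCons)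
qed

lemma prod_roots_of_power:
  assumes "N > 0" "c \<noteq> (0::complex)"
  shows "(\<Prod>\<zeta> | \<zeta> ^ N = c. u - \<zeta>) = u ^ N - c"
proof -
  define p where "p = monom 1 N - [:c:]"
  have deg: "degree p = N" and lead: "lead_coeff p = 1"
  proof -
    have d: "degree [:c:] < degree (monom (1::complex) N)" using assms by (simp add: degree_monom_eq)
    then show "degree p = N" unfolding p_def
      by (metis (no_types) degree_add_eq_left degree_minus degree_monom_eq diff_conv_add_uminus one_neq_zero)
    then show "lead_coeff p = 1" using assms by (simp add: p_def coeff_pCons split: nat.splits)
  qed
  have "p = (\<Prod>\<zeta> | poly p \<zeta> = 0. [:- \<zeta>, 1:])"
    using complex_poly_decompose_rsquarefree[of p] rsquarefree_X_power_minus[OF assms] lead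
    by (simp add: p_def)
  then have "poly p u = poly (\<Prod>\<zeta> | poly p \<zeta> = 0. [:- \<zeta>, 1:]) u" by simp
  then show ?thesis by (simp add: p_def poly_monom poly_prod)
qed

lemma finite_roots_of_power:
  assumes "N > 0"
  shows "finite {\<zeta>::complex. \<zeta> ^ N = c}" "card {\<zeta>::complex. \<zeta> ^ N = c} \<le> N"
proof -
  have "degree (monom (1::complex) N - [:c:]) = N"
    using assms by (metis (no_types) degree_add_eq_left degree_minus degree_monom_eq degree_pCons_0
        diff_conv_add_uminus one_neq_zero)
  moreover from this have "monom 1 N - [:c:] \<noteq> 0" using assms by auto
  ultimately show "finite {\<zeta>::complex. \<zeta> ^ N = c}" "card {\<zeta>::complex. \<zeta> ^ N = c} \<le> N"
    using poly_roots_finite[of "monom 1 N - [:c:]"] card_poly_roots_bound[of "monom 1 N - [:c:]"]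
    by (auto simp: poly_monom)
qed

text \<open>Averaging over the \<open>N\<close>-th roots of \<open>r ^ N\<close> replaces the mean over the circle of radius \<open>r\<close>;
  it needs nothing but the factorisation of \<open>u ^ N - r ^ N\<close>.\<close>

lemma ln_norm_one_minus_power_tendsto:
  fixes q :: complex
  assumes "norm q < 1"
  shows "(\<lambda>N. ln (norm (1 - q ^ N)) / real N) \<longlonglongrightarrow> 0"
proof -
  have "(\<lambda>N. q ^ N) \<longlonglongrightarrow> 0" using assms by (rule LIMSEQ_power_zero)
  then have "(\<lambda>N. norm (1 - q ^ N)) \<longlonglongrightarrow> norm (1 - 0::complex)"
    by (intro tendsto_norm tendsto_diff tendsto_const)
  then have "(\<lambda>N. ln (norm (1 - q ^ N))) \<longlonglongrightarrow> ln (norm (1 - 0::complex))"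
    by (rule tendsto_ln) simp
  then have "(\<lambda>N. ln (norm (1 - q ^ N)) * inverse (real N)) \<longlonglongrightarrow> ln (norm (1 - 0::complex)) * 0"
    by (intro tendsto_mult lim_inverse_n)
  then show ?thesis by (simp add: divide_inverse)
qed

text \<open>The sum is \<open>ln (norm (u ^ N - r ^ N))\<close>, and in it the larger of the two
  powers dominates geometrically. On the circle itself neither power dominates, hence the
  hypothesis.\<close>

lemma roots_mean_ln_norm:
  assumes "r > 0" "norm u \<noteq> r"
  shows "(\<lambda>N. (\<Sum>\<zeta> | \<zeta> ^ N = of_real r ^ N. ln (norm (u - \<zeta>))) / real N) \<longlonglongrightarrow> log_max r u"
proof -
  define c :: complex where "c = of_real r"
  have c: "c \<noteq> 0" "norm c = r" using assms by (auto simp: c_def)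
  have eq: "(\<Sum>\<zeta> | \<zeta> ^ N = c ^ N. ln (norm (u - \<zeta>))) = ln (norm (u ^ N - c ^ N))" if "N > 0" for N
  proof -
    have nz: "u - \<zeta> \<noteq> 0" if "\<zeta> ^ N = c ^ N" for \<zeta>
    proof
      assume "u - \<zeta> = 0"
      then have "norm (u ^ N) = norm (c ^ N)" using that by simp
      then have "norm u ^ N = norm c ^ N" by (simp add: norm_power)
      then have "norm u = norm c" using \<open>N > 0\<close> by (simp add: power_eq_iff_eq_base)
      then show False using c assms by simp
    qed
    have "ln (norm (u ^ N - c ^ N)) = ln (norm (\<Prod>\<zeta> | \<zeta> ^ N = c ^ N. u - \<zeta>))"
      using prod_roots_of_power[OF that, of "c ^ N" u] c by simp
    also have "\<dots> = ln (\<Prod>\<zeta> | \<zeta> ^ N = c ^ N. norm (u - \<zeta>))" by (simp add: prod_norm)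
    also have "\<dots> = (\<Sum>\<zeta> | \<zeta> ^ N = c ^ N. ln (norm (u - \<zeta>)))"
      using nz finite_roots_of_power[OF that, of "c ^ N"] by (intro ln_prod) auto
    finally show ?thesis by simp
  qed
  show ?thesis
  proof (cases "norm u < r")
    case True
    have "norm (u / c) < 1" using True assms c by (simp add: norm_divide)
    then have nz: "1 - (u / c) ^ N \<noteq> 0" if "N > 0" for N
      using that by (metis eq_iff_diff_eq_0 norm_one norm_power power_less_one_iff order_less_irrefl norm_ge_zero)
    have "(\<lambda>N. ln r + ln (norm (1 - (u / c) ^ N)) / real N) \<longlonglongrightarrow> ln r + 0"
      by (intro tendsto_intros ln_norm_one_minus_power_tendsto) fact
    moreover have "\<forall>\<^sub>F N in sequentially. ln r + ln (norm (1 - (u / c) ^ N)) / real N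
      = (\<Sum>\<zeta> | \<zeta> ^ N = c ^ N. ln (norm (u - \<zeta>))) / real N"
      using eventually_gt_at_top[of 0]
    proof eventually_elim
      case (elim N)
      have "u ^ N - c ^ N = - (c ^ N * (1 - (u / c) ^ N))" using c by (simp add: power_divide field_simps)
      then have "norm (u ^ N - c ^ N) = r ^ N * norm (1 - (u / c) ^ N)"
        using c by (simp add: norm_mult norm_power)
      then have "ln (norm (u ^ N - c ^ N)) = real N * ln r + ln (norm (1 - (u / c) ^ N))"
        using assms nz[OF elim] by (simp add: ln_mult ln_realpow)
      then show ?case using eq[OF elim] elim by (simp add: field_simps)
    qed
    ultimately have "(\<lambda>N. (\<Sum>\<zeta> | \<zeta> ^ N = c ^ N. ln (norm (u - \<zeta>))) / real N) \<longlonglongrightarrow> ln r + 0"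
      by (rule Lim_transform_eventually)
    then show ?thesis using True by (simp add: log_max_def c_def max_def)
  next
    case False
    then have u: "norm u > r" "u \<noteq> 0" using assms by auto
    have "norm (c / u) < 1" using u assms c by (simp add: norm_divide)
    then have nz: "1 - (c / u) ^ N \<noteq> 0" if "N > 0" for N
      using that by (metis eq_iff_diff_eq_0 norm_one norm_power power_less_one_iff order_less_irrefl norm_ge_zero)
    have "(\<lambda>N. ln (norm u) + ln (norm (1 - (c / u) ^ N)) / real N) \<longlonglongrightarrow> ln (norm u) + 0"
      by (intro tendsto_intros ln_norm_one_minus_power_tendsto) fact
    moreover have "\<forall>\<^sub>F N in sequentially. ln (norm u) + ln (norm (1 - (c / u) ^ N)) / real N
      = (\<Sum>\<zeta> | \<zeta> ^ N = c ^ N. ln (norm (u - \<zeta>))) / real N"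
      using eventually_gt_at_top[of 0]
    proof eventually_elim
      case (elim N)
      have "u ^ N - c ^ N = u ^ N * (1 - (c / u) ^ N)" using u by (simp add: power_divide field_simps)
      then have "norm (u ^ N - c ^ N) = norm u ^ N * norm (1 - (c / u) ^ N)"
        by (simp add: norm_mult norm_power)
      then have "ln (norm (u ^ N - c ^ N)) = real N * ln (norm u) + ln (norm (1 - (c / u) ^ N))"
        using u nz[OF elim] by (simp add: ln_mult ln_realpow)
      then show ?case using eq[OF elim] elim by (simp add: field_simps)
    qed
    ultimately have "(\<lambda>N. (\<Sum>\<zeta> | \<zeta> ^ N = c ^ N. ln (norm (u - \<zeta>))) / real N) \<longlonglongrightarrow> ln (norm u) + 0"
      by (rule Lim_transform_eventually)
    then show ?thesis using u by (simp add: log_max_def c_def max_def)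
  qed
qed

lemma AE_lborel_norm_neq:
  assumes "r > 0"
  shows "AE z in lborel. norm (z - x :: complex) \<noteq> r"
proof (rule AE_I[of _ _ "sphere x r"])
  show "{z \<in> space lborel. \<not> norm (z - x) \<noteq> r} \<subseteq> sphere x r" by (auto simp: dist_norm norm_minus_commute)
  have "sphere x r \<in> null_sets lborel"
    using negligible_sphere[of x r] by (simp add: negligible_iff_null_sets null_sets_completion_iff)
  then show "emeasure lborel (sphere x r) = 0" "sphere x r \<in> sets lborel" by (auto simp: null_sets_def)
qed

lemma sum_mset_tendsto:
  fixes f :: "'a \<Rightarrow> nat \<Rightarrow> real"
  assumes "\<And>x. x \<in># X \<Longrightarrow> (\<lambda>N. f x N) \<longlonglongrightarrow> g x"
  shows "(\<lambda>N. \<Sum>x\<in>#X. f x N) \<longlonglongrightarrow> (\<Sum>x\<in>#X. g x)"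
  using assms by (induction X) (auto intro!: tendsto_intros)

lemma sum_sum_mset_swap:
  fixes f :: "'a \<Rightarrow> 'b \<Rightarrow> real"
  shows "(\<Sum>\<zeta>\<in>S. \<Sum>x\<in>#X. f \<zeta> x) = (\<Sum>x\<in>#X. \<Sum>\<zeta>\<in>S. f \<zeta> x)"
  by (induction X) (auto simp: sum.distrib)

lemma sum_mset_divide:
  fixes f :: "'a \<Rightarrow> real"
  shows "(\<Sum>x\<in>#X. f x) / c = (\<Sum>x\<in>#X. f x / c)"
  by (induction X) (auto simp: add_divide_distrib)

text \<open>The circles of radius \<open>r\<close> about the finitely many points, where the means
  may fail to converge, have area zero.\<close>

lemma roots_mean_pot_diff:
  assumes "r > 0"
  shows "AE z in lborel. (\<lambda>N. (\<Sum>\<zeta> | \<zeta> ^ N = of_real r ^ N. pot_diff X Y (z - \<zeta>)) / real N)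
    \<longlonglongrightarrow> pot_diff_max r X Y z"
proof -
  have "AE z in lborel. \<forall>x\<in>set_mset (X + Y). norm (z - x) \<noteq> r"
    by (rule AE_finite_allI) (auto intro: AE_lborel_norm_neq assms)
  then show ?thesis
  proof eventually_elim
    case (elim z)
    have lim: "(\<lambda>N. \<Sum>x\<in>#Z. (\<Sum>\<zeta> | \<zeta> ^ N = of_real r ^ N. ln (norm (z - x - \<zeta>))) / real N)
      \<longlonglongrightarrow> (\<Sum>x\<in>#Z. log_max r (z - x))" if "set_mset Z \<subseteq> set_mset (X + Y)" for Z
      using elim that by (intro sum_mset_tendsto roots_mean_ln_norm assms) auto
    have "(\<lambda>N. (\<Sum>x\<in>#X. (\<Sum>\<zeta> | \<zeta> ^ N = of_real r ^ N. ln (norm (z - x - \<zeta>))) / real N)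
       - (\<Sum>x\<in>#Y. (\<Sum>\<zeta> | \<zeta> ^ N = of_real r ^ N. ln (norm (z - x - \<zeta>))) / real N))
       \<longlonglongrightarrow> pot_diff_max r X Y z"
      unfolding pot_diff_max_def by (intro tendsto_diff lim) auto
    also have "(\<lambda>N. (\<Sum>x\<in>#X. (\<Sum>\<zeta> | \<zeta> ^ N = of_real r ^ N. ln (norm (z - x - \<zeta>))) / real N)
       - (\<Sum>x\<in>#Y. (\<Sum>\<zeta> | \<zeta> ^ N = of_real r ^ N. ln (norm (z - x - \<zeta>))) / real N))
      = (\<lambda>N. (\<Sum>\<zeta> | \<zeta> ^ N = of_real r ^ N. pot_diff X Y (z - \<zeta>)) / real N)"
      unfolding pot_diff_def sum_subtractf sum_sum_mset_swap sum_mset_divide[symmetric] diff_divide_distrib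
      by (simp add: algebra_simps)
    finally show ?case .
  qed
qed

context
  fixes X Y :: "nat \<Rightarrow> complex multiset"
  assumes size_le: "\<And>n. size (X n) \<le> n" "\<And>n. size (Y n) \<le> n"
    and lim: "AE z in lborel. (\<lambda>n. pot_diff (X n) (Y n) z / n) \<longlonglongrightarrow> 0"
begin

text \<open>A circle mean is a limit of averages of translates by vectors of length
  \<open>r\<close>. Each translate has an L1 norm over the ball that is at most the norm of the
  potential difference over the ball enlarged by \<open>r\<close>, and Fatou's lemma passes to the
  limit.\<close>

lemma nn_integral_pot_diff_max_le:
  assumes r: "r > 0"
  shows "(\<integral>\<^sup>+z\<in>ball c R. ennreal \<bar>pot_diff_max r (X n) (Y n) z / n\<bar> \<partial>lborel)
    \<le> (\<integral>\<^sup>+z\<in>ball c (R + r). ennreal \<bar>pot_diff (X n) (Y n) z / n\<bar> \<partial>lborel)" (is "_ \<le> ?I")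
proof -
  have [measurable]: "ball c R \<in> sets borel" "ball c (R + r) \<in> sets borel" by auto
  define W where "W = (\<lambda>z. pot_diff (X n) (Y n) z / n)"
  have [measurable]: "W \<in> borel_measurable borel" unfolding W_def by measurable
  define A where "A = (\<lambda>N z. (\<Sum>\<zeta> | \<zeta> ^ N = of_real r ^ N. W (z - \<zeta>)) / real N)"
  have [measurable]: "A N \<in> borel_measurable borel" for N unfolding A_def by measurable
  have A_lim: "AE z in lborel. (\<lambda>N. A N z) \<longlonglongrightarrow> pot_diff_max r (X n) (Y n) z / n"
    using roots_mean_pot_diff[OF r, of "X n" "Y n"]
  proof eventually_elim
    case (elim z)
    from tendsto_divide[OF elim tendsto_const[of "real n"]] show ?case
      by (cases "n = 0") (auto simp: A_def W_def sum_divide_distrib[symmetric] mult.commute)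
  qed
  have "(\<integral>\<^sup>+z\<in>ball c R. ennreal \<bar>pot_diff_max r (X n) (Y n) z / n\<bar> \<partial>lborel)
    \<le> (\<integral>\<^sup>+z. liminf (\<lambda>N. ennreal \<bar>A N z\<bar> * indicator (ball c R) z) \<partial>lborel)"
    using A_lim
  proof (intro nn_integral_mono_AE, eventually_elim)
    case (elim z)
    have "(\<lambda>N. ennreal \<bar>A N z\<bar> * indicator (ball c R) z) \<longlonglongrightarrow>
      ennreal \<bar>pot_diff_max r (X n) (Y n) z / n\<bar> * indicator (ball c R) z"
    proof (cases "z \<in> ball c R")
      case True
      show ?thesis
        by (simp only: indicator_simps(1)[OF True] mult_1_right) (intro tendsto_ennrealI tendsto_rabs elim(2))
    next
      case False
      show ?thesis by (simp only: indicator_simps(2)[OF False] mult_zero_right tendsto_const)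
    qed
    from lim_imp_Liminf[OF _ this] show ?case by simp
  qed
  also have "\<dots> \<le> liminf (\<lambda>N. \<integral>\<^sup>+z. ennreal \<bar>A N z\<bar> * indicator (ball c R) z \<partial>lborel)"
    by (rule nn_integral_liminf) measurable
  also have "\<dots> \<le> ?I"
  proof (rule Liminf_le)
    show "\<forall>\<^sub>F N in sequentially. (\<integral>\<^sup>+z. ennreal \<bar>A N z\<bar> * indicator (ball c R) z \<partial>lborel) \<le> ?I"
      using eventually_gt_at_top[of 0]
    proof eventually_elim
      case (elim N)
      define S where "S = {\<zeta>::complex. \<zeta> ^ N = of_real r ^ N}"
      have S: "finite S" "card S \<le> N" unfolding S_def using finite_roots_of_power[OF elim] by auto
      have S_norm: "norm \<zeta> = r" if "\<zeta> \<in> S" for \<zeta>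
      proof -
        have "norm (\<zeta> ^ N) = norm (complex_of_real r ^ N)" using that by (simp add: S_def)
        then have "norm \<zeta> ^ N = r ^ N" using r by (simp add: norm_power)
        then show ?thesis using r elim by (simp add: power_eq_iff_eq_base)
      qed
      have "(\<integral>\<^sup>+z. ennreal \<bar>A N z\<bar> * indicator (ball c R) z \<partial>lborel)
        \<le> (\<integral>\<^sup>+z. ennreal (1 / N) * (\<Sum>\<zeta>\<in>S. ennreal \<bar>W (z - \<zeta>)\<bar> * indicator (ball c (R + r)) (z - \<zeta>)) \<partial>lborel)"
      proof (rule nn_integral_mono)
        fix z
        show "ennreal \<bar>A N z\<bar> * indicator (ball c R) z
          \<le> ennreal (1 / N) * (\<Sum>\<zeta>\<in>S. ennreal \<bar>W (z - \<zeta>)\<bar> * indicator (ball c (R + r)) (z - \<zeta>))"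
        proof (cases "z \<in> ball c R")
          case True
          have in_ball: "z - \<zeta> \<in> ball c (R + r)" if "\<zeta> \<in> S" for \<zeta>
            using True S_norm[OF that] norm_triangle_ineq[of "c - z" \<zeta>] by (simp add: dist_norm algebra_simps)
          have "\<bar>A N z\<bar> \<le> (1 / N) * (\<Sum>\<zeta>\<in>S. \<bar>W (z - \<zeta>)\<bar>)"
            unfolding A_def S_def[symmetric] by (simp add: abs_divide divide_right_mono)
          then have "ennreal \<bar>A N z\<bar> \<le> ennreal ((1 / N) * (\<Sum>\<zeta>\<in>S. \<bar>W (z - \<zeta>)\<bar>))" by (rule ennreal_leI)
          also have "\<dots> = ennreal (1 / N) * ennreal (\<Sum>\<zeta>\<in>S. \<bar>W (z - \<zeta>)\<bar>)"
            by (intro ennreal_mult sum_nonneg) auto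
          also have "ennreal (\<Sum>\<zeta>\<in>S. \<bar>W (z - \<zeta>)\<bar>) = (\<Sum>\<zeta>\<in>S. ennreal \<bar>W (z - \<zeta>)\<bar>)"
            by (intro sum_ennreal[symmetric]) auto
          also have "(\<Sum>\<zeta>\<in>S. ennreal \<bar>W (z - \<zeta>)\<bar>) = (\<Sum>\<zeta>\<in>S. ennreal \<bar>W (z - \<zeta>)\<bar> * indicator (ball c (R + r)) (z - \<zeta>))"
            using in_ball by (intro sum.cong refl) simp
          finally show ?thesis using True by simp
        qed auto
      qed
      also have "\<dots> = ennreal (1 / N) * (\<Sum>\<zeta>\<in>S. \<integral>\<^sup>+z. ennreal \<bar>W (z - \<zeta>)\<bar> * indicator (ball c (R + r)) (z - \<zeta>) \<partial>lborel)"
        by (subst nn_integral_cmult) (simp_all add: nn_integral_sum)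
      also have "\<dots> = ennreal (1 / N) * (\<Sum>\<zeta>\<in>S. ?I)"
      proof (intro arg_cong2[of _ _ _ _ "(*)"] sum.cong refl)
        fix \<zeta>
        show "(\<integral>\<^sup>+z. ennreal \<bar>W (z - \<zeta>)\<bar> * indicator (ball c (R + r)) (z - \<zeta>) \<partial>lborel) = ?I"
          using nn_integral_lborel_shift[of "\<lambda>z. ennreal \<bar>W z\<bar> * indicator (ball c (R + r)) z" "- \<zeta>"]
          by (simp add: W_def)
      qed
      also have "\<dots> = ennreal (real (card S) / N) * ?I"
        by (simp add: ennreal_of_nat_eq_real_of_nat ennreal_mult[symmetric] mult.assoc[symmetric])
      also have "\<dots> \<le> 1 * ?I"
        using S elim by (intro mult_right_mono) (auto simp: field_simps)
      finally show ?case by simp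
    qed
  qed simp
  finally show ?thesis .
qed

text \<open>Holds at every \<open>a\<close>, not just almost everywhere: the functions are
  equi-Lipschitz, so smallness in L1 on a ball around \<open>a\<close> forces smallness at
  \<open>a\<close>.\<close>

lemma pot_diff_max_tendsto:
  assumes r: "r > 0"
  shows "(\<lambda>n. pot_diff_max r (X n) (Y n) a / n) \<longlonglongrightarrow> 0"
proof (rule LIMSEQ_I)
  fix e :: real assume e: "e > 0"
  \<comment> \<open>With Lipschitz constant \<open>2 / r\<close> the value moves by at most
    \<open>e / 4\<close> over the distance \<open>t\<close>; starting from a point with value below
    \<open>e / 2\<close> this stays below \<open>e\<close>.\<close>
  define t where "t = e * r / 8"
  have t: "t > 0" unfolding t_def using e r by simp
  have "\<forall>\<^sub>F n in sequentially. (\<integral>\<^sup>+z\<in>ball a (t + r). ennreal \<bar>pot_diff (X n) (Y n) z / n\<bar> \<partial>lborel) \<le> ennreal (pi * t\<^sup>2 * e / 4)"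
    using t e by (intro pot_diff_L1 size_le lim) auto
  then have "\<forall>\<^sub>F n in sequentially. norm (pot_diff_max r (X n) (Y n) a / n - 0) < e"
  proof eventually_elim
    case (elim n)
    define D where "D = (\<lambda>z. pot_diff_max r (X n) (Y n) z / n)"
    have int_le: "(\<integral>\<^sup>+z\<in>ball a t. ennreal \<bar>D z\<bar> \<partial>lborel) \<le> ennreal (pi * t\<^sup>2 * e / 4)"
      unfolding D_def using nn_integral_pot_diff_max_le[OF r] elim by (rule order.trans)
    have "\<exists>z\<in>ball a t. \<bar>D z\<bar> < e / 2"
    proof (rule ccontr)
      assume "\<not> ?thesis"
      then have *: "e / 2 \<le> \<bar>D z\<bar>" if "z \<in> ball a t" for z using that by (meson not_le)
      have "ennreal (e / 2 * (pi * t\<^sup>2)) = ennreal (e / 2) * ennreal (pi * t\<^sup>2)"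
        using t e by (intro ennreal_mult) auto
      also have "ennreal (pi * t\<^sup>2) = emeasure lborel (ball a t)"
        using t by (subst emeasure_ball) (auto simp: unit_ball_vol_2)
      also have "ennreal (e / 2) * emeasure lborel (ball a t) = (\<integral>\<^sup>+z\<in>ball a t. ennreal (e / 2) \<partial>lborel)"
        by (rule nn_integral_cmult_indicator[symmetric]) simp
      also have "\<dots> \<le> (\<integral>\<^sup>+z\<in>ball a t. ennreal \<bar>D z\<bar> \<partial>lborel)"
        using * by (intro nn_integral_mono) (auto simp: indicator_def intro!: ennreal_leI)
      also note int_le
      finally have "e / 2 * (pi * t\<^sup>2) \<le> pi * t\<^sup>2 * e / 4" using e by (subst (asm) ennreal_le_iff) auto
      then show False using t e by simp
    qed
    then obtain z where z: "z \<in> ball a t" "\<bar>D z\<bar> < e / 2" by auto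
    have "\<bar>D a - D z\<bar> \<le> 2 * dist a z / r"
      unfolding D_def by (rule pot_diff_max_mean_lipschitz[OF size_le r])
    also have "\<dots> \<le> 2 * t / r" using z r by (intro divide_right_mono) auto
    also have "\<dots> = e / 4" using r by (simp add: t_def)
    finally have "\<bar>D a\<bar> < e" using z by linarith
    then show ?case by (simp add: D_def)
  qed
  then show "\<exists>n0. \<forall>n\<ge>n0. norm (pot_diff_max r (X n) (Y n) a / n - 0) < e"
    by (simp add: eventually_sequentially)
qed

end

section \<open>A criterion for weak convergence\<close>

text \<open>A difference of two circle potentials, hence a test function that the potentials
  control. It is a continuous bump, \<open>ln 2\<close> on the disc of radius \<open>r\<close> and
  zero beyond \<open>2 * r\<close>, and its translates serve as an approximate identity.\<close>

definition log_tent :: "real \<Rightarrow> complex \<Rightarrow> real" where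
  "log_tent r x = log_max (2 * r) x - log_max r x"

lemma log_tent_measurable [measurable]: "log_tent r \<in> borel_measurable borel"
  unfolding log_tent_def by measurable

lemma log_tent_bounds:
  assumes "r > 0"
  shows "0 \<le> log_tent r x" "log_tent r x \<le> ln 2"
proof -
  show "0 \<le> log_tent r x" using assms by (auto simp: log_tent_def log_max_def)
  have "ln (max (2 * r) (norm x)) \<le> ln (2 * max r (norm x))"
    using assms by (subst ln_le_cancel_iff) (auto simp: max_def)
  also have "\<dots> = ln 2 + ln (max r (norm x))" using assms by (subst ln_mult) auto
  finally show "log_tent r x \<le> ln 2" by (simp add: log_tent_def log_max_def)
qed

lemma log_tent_eq_0: "r > 0 \<Longrightarrow> norm x \<ge> 2 * r \<Longrightarrow> log_tent r x = 0"
  by (auto simp: log_tent_def log_max_def max_def)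

lemma log_tent_eq_ln2: "r > 0 \<Longrightarrow> norm x \<le> r \<Longrightarrow> log_tent r x = ln 2"
  by (auto simp: log_tent_def log_max_def max_def ln_mult)

lemma log_tent_lipschitz:
  assumes "r > 0"
  shows "\<bar>log_tent r x - log_tent r y\<bar> \<le> 2 * norm (x - y) / r"
proof -
  have "norm (x - y) / (2 * r) \<le> norm (x - y) / r" using assms by (intro divide_left_mono) auto
  then show ?thesis
    using log_max_lipschitz[OF assms, of x y] log_max_lipschitz[of "2 * r" x y] assms
    unfolding log_tent_def by simp
qed

text \<open>Normalising constant of the approximate identity; what is used of it is that it is
  positive and finite.\<close>

definition log_tent_mass :: "real \<Rightarrow> ennreal" where
  "log_tent_mass r = (\<integral>\<^sup>+a. ennreal (log_tent r a) \<partial>lborel)"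

lemma log_tent_mass_bounds:
  assumes "r > 0"
  shows "0 < log_tent_mass r" "log_tent_mass r < \<infinity>"
proof -
  have "ennreal (ln 2 * (pi * r\<^sup>2)) = (\<integral>\<^sup>+a. ennreal (ln 2) * indicator (cball (0::complex) r) a \<partial>lborel)"
    using assms by (simp add: nn_integral_cmult_indicator emeasure_cball_complex ennreal_mult[symmetric])
  also have "\<dots> \<le> log_tent_mass r"
    unfolding log_tent_mass_def using assms
    by (intro nn_integral_mono) (auto simp: indicator_def log_tent_eq_ln2)
  finally show "0 < log_tent_mass r"
    using assms by (metis ennreal_eq_0_iff le_zero_eq not_gr_zero mult_pos_pos ln_gt_zero one_less_numeral_iff
        pi_gt_zero semiring_norm(76) zero_less_power not_le)
  have "log_tent_mass r \<le> (\<integral>\<^sup>+a. ennreal (ln 2) * indicator (cball (0::complex) (2 * r)) a \<partial>lborel)"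
    unfolding log_tent_mass_def using assms log_tent_bounds[OF assms] log_tent_eq_0[OF assms]
    by (intro nn_integral_mono) (auto simp: indicator_def intro!: ennreal_leI)
  also have "\<dots> < \<infinity>"
    using assms by (simp add: nn_integral_cmult_indicator emeasure_cball_complex ennreal_mult[symmetric])
  finally show "log_tent_mass r < \<infinity>" .
qed

lemma log_tent_mass_shift:
  "(\<integral>\<^sup>+a. ennreal (log_tent r (x - a)) \<partial>lborel) = log_tent_mass r"
proof -
  have "log_tent r (x - a) = log_tent r (- x + a)" for a
    using norm_minus_commute[of x a] by (simp add: log_tent_def log_max_def)
  then show ?thesis
    unfolding log_tent_mass_def using nn_integral_lborel_shift[of "\<lambda>a. ennreal (log_tent r a)" "- x"] by simp
qed

text \<open>The kernel vanishes beyond distance \<open>2 * r\<close>, so replacing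
  \<open>g a\<close> by \<open>g x\<close> costs at most \<open>e\<close> times the mass. The second
  bound carries its error on the right because subtraction in \<open>ennreal\<close> is
  truncated.\<close>

lemma log_tent_conv_approx:
  fixes g :: "complex \<Rightarrow> real"
  assumes r: "r > 0" and e: "e \<ge> 0" and g_meas [measurable]: "g \<in> borel_measurable borel"
    and g_nonneg: "\<And>x. g x \<ge> 0"
    and g_close: "\<And>x a. norm (x - a) \<le> 2 * r \<Longrightarrow> \<bar>g x - g a\<bar> \<le> e"
  shows "(\<integral>\<^sup>+a. ennreal (g a * log_tent r (x - a)) \<partial>lborel) \<le> ennreal (g x + e) * log_tent_mass r" (is ?A)
    and "ennreal (g x) * log_tent_mass r
      \<le> (\<integral>\<^sup>+a. ennreal (g a * log_tent r (x - a)) \<partial>lborel) + ennreal e * log_tent_mass r" (is ?B)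
proof -
  have *: "\<bar>g x - g a\<bar> * log_tent r (x - a) \<le> e * log_tent r (x - a)" for a
    using g_close[of x a] log_tent_bounds[OF r, of "x - a"] log_tent_eq_0[OF r, of "x - a"]
    by (cases "norm (x - a) \<le> 2 * r") (auto intro!: mult_right_mono)
  have le1: "g a * log_tent r (x - a) \<le> (g x + e) * log_tent r (x - a)" for a
  proof -
    have "(g a - g x) * log_tent r (x - a) \<le> \<bar>g x - g a\<bar> * log_tent r (x - a)"
      using log_tent_bounds[OF r, of "x - a"] by (intro mult_right_mono) auto
    with *[of a] show ?thesis by (simp add: algebra_simps)
  qed
  have le2: "g x * log_tent r (x - a) \<le> g a * log_tent r (x - a) + e * log_tent r (x - a)" for a
  proof -
    have "(g x - g a) * log_tent r (x - a) \<le> \<bar>g x - g a\<bar> * log_tent r (x - a)"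
      using log_tent_bounds[OF r, of "x - a"] by (intro mult_right_mono) auto
    with *[of a] show ?thesis by (simp add: algebra_simps)
  qed
  have scale: "(\<integral>\<^sup>+a. ennreal (c * log_tent r (x - a)) \<partial>lborel) = ennreal c * log_tent_mass r"
    if "c \<ge> 0" for c
    using that log_tent_bounds[OF r]
    by (subst log_tent_mass_shift[of r x, symmetric]) (simp add: nn_integral_cmult[symmetric] ennreal_mult)
  show ?A
    using le1 g_nonneg e by (subst scale[symmetric]) (auto intro!: nn_integral_mono ennreal_leI)
  have "ennreal (g x) * log_tent_mass r = (\<integral>\<^sup>+a. ennreal (g x * log_tent r (x - a)) \<partial>lborel)"
    using g_nonneg by (simp add: scale)
  also have "\<dots> \<le> (\<integral>\<^sup>+a. ennreal (g a * log_tent r (x - a)) + ennreal (e * log_tent r (x - a)) \<partial>lborel)"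
  proof (rule nn_integral_mono)
    fix a
    have "ennreal (g x * log_tent r (x - a)) \<le> ennreal (g a * log_tent r (x - a) + e * log_tent r (x - a))"
      by (rule ennreal_leI[OF le2])
    also have "\<dots> = ennreal (g a * log_tent r (x - a)) + ennreal (e * log_tent r (x - a))"
      using g_nonneg e log_tent_bounds[OF r] by (intro ennreal_plus) auto
    finally show "ennreal (g x * log_tent r (x - a)) \<le> ennreal (g a * log_tent r (x - a)) + ennreal (e * log_tent r (x - a))" .
  qed
  also have "\<dots> = (\<integral>\<^sup>+a. ennreal (g a * log_tent r (x - a)) \<partial>lborel) + ennreal e * log_tent_mass r"
    using e by (subst nn_integral_add) (auto simp: scale)
  finally show ?B .
qed

text \<open>Tonelli: the smoothed \<open>g\<close> integrates against \<open>\<nu>\<close> to an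
  expression that involves \<open>\<nu>\<close> only through its integrals of tents.\<close>

lemma nn_integral_log_tent_conv:
  fixes \<nu> :: "complex measure"
  assumes "prob_space \<nu>" and sets [measurable_cong]: "sets \<nu> = sets borel" and r: "r > 0"
    and g_meas [measurable]: "g \<in> borel_measurable borel" and g_nonneg: "\<And>x. g x \<ge> 0"
  shows "(\<integral>\<^sup>+x. (\<integral>\<^sup>+a. ennreal (g a * log_tent r (x - a)) \<partial>lborel) \<partial>\<nu>)
    = (\<integral>\<^sup>+a. ennreal (g a * (\<integral>x. log_tent r (x - a) \<partial>\<nu>)) \<partial>lborel)"
proof -
  interpret prob_space \<nu> by fact
  interpret pair_sigma_finite \<nu> lborel ..
  have "(\<integral>\<^sup>+x. (\<integral>\<^sup>+a. ennreal (g a * log_tent r (x - a)) \<partial>lborel) \<partial>\<nu>)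
    = (\<integral>\<^sup>+a. (\<integral>\<^sup>+x. ennreal (g a * log_tent r (x - a)) \<partial>\<nu>) \<partial>lborel)"
    by (rule Fubini'[symmetric]) measurable
  also have "\<dots> = (\<integral>\<^sup>+a. ennreal (g a * (\<integral>x. log_tent r (x - a) \<partial>\<nu>)) \<partial>lborel)"
  proof (intro nn_integral_cong)
    fix a
    have "integrable \<nu> (\<lambda>x. log_tent r (x - a))"
      using log_tent_bounds[OF r] by (intro integrable_const_bound[where B = "ln 2"]) auto
    then have "(\<integral>\<^sup>+x. ennreal (log_tent r (x - a)) \<partial>\<nu>) = ennreal (\<integral>x. log_tent r (x - a) \<partial>\<nu>)"
      using log_tent_bounds[OF r] by (intro nn_integral_eq_integral) auto
    then show "(\<integral>\<^sup>+x. ennreal (g a * log_tent r (x - a)) \<partial>\<nu>) = ennreal (g a * (\<integral>x. log_tent r (x - a) \<partial>\<nu>))"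
      using g_nonneg[of a] log_tent_bounds[OF r]
      by (simp add: ennreal_mult nn_integral_cmult Bochner_Integration.integral_nonneg)
  qed
  finally show ?thesis .
qed

text \<open>The radii are restricted to \<open>1 / Suc i\<close> so that later countably many almost
  sure statements suffice.\<close>

lemma uniformly_close_of_compact_support:
  fixes g :: "complex \<Rightarrow> real"
  assumes "continuous_on UNIV g" "\<And>x. norm x \<ge> \<rho> \<Longrightarrow> g x = 0" "e > 0"
  obtains i where "\<And>x a. norm (x - a) \<le> 2 * (1 / real (Suc i)) \<Longrightarrow> \<bar>g x - g a\<bar> \<le> e"
proof -
  have "uniformly_continuous_on (cball 0 (\<rho> + 1)) g"
    by (intro compact_uniformly_continuous continuous_on_subset[OF assms(1)]) auto
  then obtain d where d: "d > 0" "\<And>x a. x \<in> cball 0 (\<rho> + 1) \<Longrightarrow> a \<in> cball 0 (\<rho> + 1) \<Longrightarrow> dist a x < d \<Longrightarrow> dist (g a) (g x) < e"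
    using assms(3) unfolding uniformly_continuous_on_def by metis
  \<comment> \<open>The bound \<open>1 / 4\<close> makes \<open>norm (x - a) \<le> 1 / 2\<close>, so
    if one of the points leaves the ball of radius \<open>\<rho> + 1\<close>, both lie where
    \<open>g\<close> vanishes.\<close>
  define r where "r = min (d / 4) (1 / 4)"
  have "\<bar>g x - g a\<bar> \<le> e" if "norm (x - a) \<le> 2 * r" for x a
  proof (cases "x \<in> cball 0 (\<rho> + 1) \<and> a \<in> cball 0 (\<rho> + 1)")
    case True
    have "dist a x < d" using that d(1) by (simp add: r_def dist_norm norm_minus_commute)
    with d(2)[of x a] True show ?thesis by (simp add: dist_real_def abs_minus_commute)
  next
    case False
    have "norm (x - a) \<le> 1 / 2" using that by (simp add: r_def)
    then have "norm x \<ge> \<rho>" "norm a \<ge> \<rho>"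
      using False norm_triangle_ineq2[of x a] norm_triangle_ineq2[of a x] by (auto simp: norm_minus_commute)
    then show ?thesis using assms by simp
  qed
  moreover have "r > 0" using d by (simp add: r_def)
  then obtain i where "1 / real (Suc i) < r" using nat_approx_posE by blast
  ultimately show ?thesis using that[of i] by (meson less_imp_le mult_left_mono order.trans zero_le_numeral)
qed

text \<open>Comparing \<open>g\<close> with its smoothing costs \<open>e / 3\<close> for
  \<open>\<mu>\<close> and again for \<open>N n\<close>; the smoothed integrals \<open>H\<close>
  converge by dominated convergence in the centre \<open>a\<close>, which costs the last
  \<open>e / 3\<close>. The bound is one-sided because only the lower bound survives the later
  removal of the compact support.\<close>

lemma liminf_integral_compact_support:
  fixes N :: "nat \<Rightarrow> complex measure" and \<mu> :: "complex measure" and g :: "complex \<Rightarrow> real"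
  assumes N: "\<And>n. prob_space (N n)" "\<And>n. sets (N n) = sets borel"
    and \<mu>: "prob_space \<mu>" "sets \<mu> = sets borel"
    and lim: "\<And>i a. (\<lambda>n. \<integral>x. log_tent (1 / real (Suc i)) (x - a) \<partial>N n) \<longlonglongrightarrow> (\<integral>x. log_tent (1 / real (Suc i)) (x - a) \<partial>\<mu>)"
    and g: "continuous_on UNIV g" "\<And>x. g x \<ge> 0" "\<And>x. g x \<le> B" "\<And>x. norm x \<ge> \<rho> \<Longrightarrow> g x = 0"
    and e: "e > 0"
  shows "\<forall>\<^sub>F n in sequentially. (\<integral>x. g x \<partial>\<mu>) - e \<le> (\<integral>x. g x \<partial>N n)"
proof -
  have [measurable]: "g \<in> borel_measurable borel" by (rule borel_measurable_continuous_onI[OF g(1)])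
  have "e / 3 > 0" using e by simp
  then obtain i where close_i: "\<And>x a. norm (x - a) \<le> 2 * (1 / real (Suc i)) \<Longrightarrow> \<bar>g x - g a\<bar> \<le> e / 3"
    using uniformly_close_of_compact_support[OF g(1,4)] by blast
  define r where "r = 1 / real (Suc i)"
  have r: "r > 0" by (simp add: r_def)
  have close: "\<bar>g x - g a\<bar> \<le> e / 3" if "norm (x - a) \<le> 2 * r" for x a
    using close_i that by (simp only: r_def)
  have lim_r: "(\<lambda>n. \<integral>x. log_tent r (x - a) \<partial>N n) \<longlonglongrightarrow> (\<integral>x. log_tent r (x - a) \<partial>\<mu>)" for a
    unfolding r_def by (rule lim)
  define C where "C = enn2real (log_tent_mass r)"
  have C: "log_tent_mass r = ennreal C" "C > 0"
    using log_tent_mass_bounds[OF r] by (auto simp: C_def enn2real_positive_iff)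
  define I where "I = (\<lambda>x. \<integral>\<^sup>+a. ennreal (g a * log_tent r (x - a)) \<partial>lborel)"
  have [measurable]: "I \<in> borel_measurable borel" unfolding I_def by measurable
  have up: "I x \<le> ennreal (g x + e / 3) * ennreal C" for x
    unfolding I_def C(1)[symmetric] using e by (intro log_tent_conv_approx close g r) auto
  have low: "ennreal (g x) * ennreal C \<le> I x + ennreal (e / 3) * ennreal C" for x
    unfolding I_def C(1)[symmetric] using e by (intro log_tent_conv_approx close g r) auto
  have B: "B \<ge> 0" using g(2)[of 0] g(3)[of 0] by linarith
  have int_g: "integrable \<nu> g" "(\<integral>\<^sup>+x. ennreal (g x) \<partial>\<nu>) = ennreal (\<integral>x. g x \<partial>\<nu>)" "0 \<le> (\<integral>x. g x \<partial>\<nu>)"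
    if "prob_space \<nu>" "sets \<nu> = sets borel" for \<nu>
  proof -
    interpret prob_space \<nu> by fact
    have [measurable_cong]: "sets \<nu> = sets borel" by fact
    show i: "integrable \<nu> g" using g by (intro integrable_const_bound[where B = B]) auto
    show "(\<integral>\<^sup>+x. ennreal (g x) \<partial>\<nu>) = ennreal (\<integral>x. g x \<partial>\<nu>)" using i g by (intro nn_integral_eq_integral) auto
    show "0 \<le> (\<integral>x. g x \<partial>\<nu>)" using g by (intro Bochner_Integration.integral_nonneg) auto
  qed
  have tent_int: "0 \<le> (\<integral>x. log_tent r (x - a) \<partial>\<nu>)" "(\<integral>x. log_tent r (x - a) \<partial>\<nu>) \<le> ln 2"
    if "prob_space \<nu>" "sets \<nu> = sets borel" for \<nu> a
  proof -
    interpret prob_space \<nu> by fact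
    have [measurable_cong]: "sets \<nu> = sets borel" by fact
    have i: "integrable \<nu> (\<lambda>x. log_tent r (x - a))"
      using log_tent_bounds[OF r] by (intro integrable_const_bound[where B = "ln 2"]) auto
    show "0 \<le> (\<integral>x. log_tent r (x - a) \<partial>\<nu>)" using log_tent_bounds[OF r] by (intro Bochner_Integration.integral_nonneg) auto
    show "(\<integral>x. log_tent r (x - a) \<partial>\<nu>) \<le> ln 2" using log_tent_bounds[OF r] i by (intro integral_le_const) auto
  qed
  define H where "H = (\<lambda>\<nu>. \<integral>\<^sup>+x. I x \<partial>\<nu>)"
  have H_eq: "H \<nu> = (\<integral>\<^sup>+a. ennreal (g a * (\<integral>x. log_tent r (x - a) \<partial>\<nu>)) \<partial>lborel)"
    if "prob_space \<nu>" "sets \<nu> = sets borel" for \<nu>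
    unfolding H_def I_def using that g r by (intro nn_integral_log_tent_conv) auto
  have H_up: "H \<nu> \<le> ennreal (((\<integral>x. g x \<partial>\<nu>) + e / 3) * C)" if p: "prob_space \<nu>" "sets \<nu> = sets borel" for \<nu>
  proof -
    interpret prob_space \<nu> by fact
    have [measurable_cong]: "sets \<nu> = sets borel" by fact
    have "H \<nu> \<le> (\<integral>\<^sup>+x. ennreal (g x + e / 3) * ennreal C \<partial>\<nu>)"
      unfolding H_def by (intro nn_integral_mono up)
    also have "\<dots> = (\<integral>\<^sup>+x. ennreal (g x + e / 3) \<partial>\<nu>) * ennreal C"
      by (rule nn_integral_multc) measurable
    also have "(\<integral>\<^sup>+x. ennreal (g x + e / 3) \<partial>\<nu>) = (\<integral>\<^sup>+x. ennreal (g x) + ennreal (e / 3) \<partial>\<nu>)"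
      using g e by (intro nn_integral_cong ennreal_plus) auto
    also have "\<dots> = (\<integral>\<^sup>+x. ennreal (g x) \<partial>\<nu>) + ennreal (e / 3)"
      by (subst nn_integral_add) (auto simp: emeasure_space_1)
    also have "\<dots> = ennreal ((\<integral>x. g x \<partial>\<nu>) + e / 3)"
      unfolding int_g(2)[OF p] using int_g(3)[OF p] e by (intro ennreal_plus[symmetric]) auto
    also have "ennreal ((\<integral>x. g x \<partial>\<nu>) + e / 3) * ennreal C = ennreal (((\<integral>x. g x \<partial>\<nu>) + e / 3) * C)"
      using int_g(3)[OF p] e C by (intro ennreal_mult[symmetric]) auto
    finally show ?thesis .
  qed
  have H_low: "ennreal ((\<integral>x. g x \<partial>\<mu>) * C) \<le> H \<mu> + ennreal (e / 3 * C)"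
  proof -
    interpret prob_space \<mu> by fact
    have [measurable_cong]: "sets \<mu> = sets borel" by fact
    have "ennreal ((\<integral>x. g x \<partial>\<mu>) * C) = (\<integral>\<^sup>+x. ennreal (g x) \<partial>\<mu>) * ennreal C"
      using int_g[OF \<mu>] C by (simp add: ennreal_mult)
    also have "\<dots> = (\<integral>\<^sup>+x. ennreal (g x) * ennreal C \<partial>\<mu>)"
      by (rule nn_integral_multc[symmetric]) measurable
    also have "\<dots> \<le> (\<integral>\<^sup>+x. I x + ennreal (e / 3) * ennreal C \<partial>\<mu>)" by (intro nn_integral_mono low)
    also have "\<dots> = H \<mu> + ennreal (e / 3) * ennreal C"
      unfolding H_def by (subst nn_integral_add) (auto simp: emeasure_space_1)
    also have "ennreal (e / 3) * ennreal C = ennreal (e / 3 * C)" using e C by (intro ennreal_mult[symmetric]) auto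
    finally show ?thesis .
  qed
  have "(\<lambda>n. H (N n)) \<longlonglongrightarrow> H \<mu>"
    unfolding H_eq[OF N] H_eq[OF \<mu>]
  proof (rule nn_integral_dominated_convergence[where w = "\<lambda>a. ennreal (B * ln 2) * indicator (cball 0 \<rho>) a"])
    have [measurable]: "cball (0::complex) \<rho> \<in> sets borel" by simp
    have tm: "(\<lambda>a. \<integral>x. log_tent r (x - a) \<partial>\<nu>) \<in> borel_measurable borel"
      if "prob_space \<nu>" "sets \<nu> = sets borel" for \<nu>
    proof -
      interpret prob_space \<nu> by fact
      have [measurable_cong]: "sets \<nu> = sets borel" by fact
      show ?thesis by measurable
    qed
    note tm[OF N, measurable] tm[OF \<mu>, measurable]
    show "(\<lambda>a. ennreal (g a * (\<integral>x. log_tent r (x - a) \<partial>N n))) \<in> borel_measurable lborel" for n by measurable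
    show "(\<lambda>a. ennreal (g a * (\<integral>x. log_tent r (x - a) \<partial>\<mu>))) \<in> borel_measurable lborel" by measurable
    show "(\<lambda>a. ennreal (B * ln 2) * indicator (cball 0 \<rho>) a) \<in> borel_measurable (lborel :: complex measure)" by measurable
    show "(\<integral>\<^sup>+a. ennreal (B * ln 2) * indicator (cball (0::complex) \<rho>) a \<partial>lborel) < \<infinity>"
      using emeasure_lborel_cball_finite[of "0::complex" \<rho>]
      by (simp add: nn_integral_cmult_indicator ennreal_mult_less_top)
    show "AE a in lborel. (\<lambda>n. ennreal (g a * (\<integral>x. log_tent r (x - a) \<partial>N n)))
      \<longlonglongrightarrow> ennreal (g a * (\<integral>x. log_tent r (x - a) \<partial>\<mu>))"
      by (intro AE_I2 tendsto_ennrealI tendsto_mult tendsto_const lim_r)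
    show "AE a in lborel. ennreal (g a * (\<integral>x. log_tent r (x - a) \<partial>N n)) \<le> ennreal (B * ln 2) * indicator (cball 0 \<rho>) a" for n
    proof (rule AE_I2)
      fix a
      show "ennreal (g a * (\<integral>x. log_tent r (x - a) \<partial>N n)) \<le> ennreal (B * ln 2) * indicator (cball 0 \<rho>) a"
      proof (cases "a \<in> cball 0 \<rho>")
        case True
        have "g a * (\<integral>x. log_tent r (x - a) \<partial>N n) \<le> B * ln 2"
          using g tent_int[OF N] B by (intro mult_mono) auto
        then show ?thesis using True by (simp add: ennreal_leI)
      next
        case False
        then show ?thesis using g(4)[of a] by simp
      qed
    qed
  qed
  moreover have "H \<mu> < H \<mu> + ennreal (e / 3 * C)"
  proof -
    have "H \<mu> < \<infinity>" using H_up[OF \<mu>] by (rule order.strict_trans1) simp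
    then show ?thesis using e C by (auto simp: ennreal_zero_less_mult_iff)
  qed
  have "\<forall>\<^sub>F n in sequentially. H \<mu> \<le> H (N n) + ennreal (e / 3 * C)"
  proof -
    have "(\<lambda>n. H (N n) + ennreal (e / 3 * C)) \<longlonglongrightarrow> H \<mu> + ennreal (e / 3 * C)"
      using calculation by (intro tendsto_add tendsto_const)
    from order_tendstoD(1)[OF this \<open>H \<mu> < H \<mu> + ennreal (e / 3 * C)\<close>] show ?thesis
      by (rule eventually_mono) (rule less_imp_le)
  qed
  then show ?thesis
  proof eventually_elim
    case (elim n)
    have nn: "0 \<le> (\<integral>x. g x \<partial>N n)" using int_g(3)[OF N] .
    have "ennreal ((\<integral>x. g x \<partial>\<mu>) * C) \<le> H (N n) + ennreal (e / 3 * C) + ennreal (e / 3 * C)"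
      using H_low elim by (meson add_right_mono order.trans)
    also have "\<dots> \<le> ennreal (((\<integral>x. g x \<partial>N n) + e / 3) * C) + ennreal (e / 3 * C) + ennreal (e / 3 * C)"
      by (intro add_right_mono H_up N)
    also have "\<dots> = ennreal (((\<integral>x. g x \<partial>N n) + e / 3) * C + e / 3 * C + e / 3 * C)"
      using nn e C by (simp add: ennreal_plus[symmetric] del: ennreal_plus)
    finally have "(\<integral>x. g x \<partial>\<mu>) * C \<le> ((\<integral>x. g x \<partial>N n) + e / 3) * C + e / 3 * C + e / 3 * C"
      using nn e C by (subst (asm) ennreal_le_iff) auto
    also have "\<dots> = ((\<integral>x. g x \<partial>N n) + e) * C" by (simp add: field_simps)
    finally have "(\<integral>x. g x \<partial>\<mu>) \<le> (\<integral>x. g x \<partial>N n) + e" using C by simp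
    then show ?case by simp
  qed
qed

text \<open>Cutting off a nonnegative function lowers its integral, which is harmless on the side of
  \<open>N n\<close>; on the side of the single measure \<open>\<mu>\<close> the loss tends to 0.
  This takes the place of a tightness argument.\<close>

lemma liminf_integral_nonneg:
  fixes N :: "nat \<Rightarrow> complex measure" and \<mu> :: "complex measure" and f :: "complex \<Rightarrow> real"
  assumes N: "\<And>n. prob_space (N n)" "\<And>n. sets (N n) = sets borel"
    and \<mu>: "prob_space \<mu>" "sets \<mu> = sets borel"
    and lim: "\<And>i a. (\<lambda>n. \<integral>x. log_tent (1 / real (Suc i)) (x - a) \<partial>N n) \<longlonglongrightarrow> (\<integral>x. log_tent (1 / real (Suc i)) (x - a) \<partial>\<mu>)"
    and f: "continuous_on UNIV f" "\<And>x. f x \<ge> 0" "\<And>x. f x \<le> B"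
    and e: "e > 0"
  shows "\<forall>\<^sub>F n in sequentially. (\<integral>x. f x \<partial>\<mu>) - e \<le> (\<integral>x. f x \<partial>N n)"
proof -
  have [measurable]: "f \<in> borel_measurable borel" by (rule borel_measurable_continuous_onI[OF f(1)])
  define cut :: "nat \<Rightarrow> complex \<Rightarrow> real" where "cut m x = max 0 (min 1 (real m - norm x))" for m x
  have cut: "0 \<le> cut m x" "cut m x \<le> 1" for m x by (auto simp: cut_def)
  have cut_cont: "continuous_on UNIV (cut m)" for m unfolding cut_def by (intro continuous_intros)
  have [measurable]: "cut m \<in> borel_measurable borel" for m by (rule borel_measurable_continuous_onI[OF cut_cont])
  have cut_lim: "(\<lambda>m. f x * cut m x) \<longlonglongrightarrow> f x" for x
  proof (rule tendsto_eventually)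
    obtain m0 where "norm x + 1 \<le> real m0" using real_arch_simple by blast
    then show "\<forall>\<^sub>F m in sequentially. f x * cut m x = f x"
      unfolding eventually_sequentially by (intro exI[of _ m0]) (auto simp: cut_def)
  qed
  have fcut: "f x * cut m x \<le> f x" for m x using cut[of m x] f(2)[of x] by (simp add: mult_left_le)
  have "(\<lambda>m. \<integral>x. f x * cut m x \<partial>\<mu>) \<longlonglongrightarrow> (\<integral>x. f x \<partial>\<mu>)"
  proof -
    interpret prob_space \<mu> by fact
    have [measurable_cong]: "sets \<mu> = sets borel" by fact
    show ?thesis
    proof (rule integral_dominated_convergence[where w = "\<lambda>_. B"])
      show "AE x in \<mu>. norm (f x * cut m x) \<le> B" for m
        using fcut f cut by (intro AE_I2) (auto simp: abs_mult intro: order.trans[OF fcut f(3)])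
    qed (use cut_lim in auto)
  qed
  then have "\<forall>\<^sub>F m in sequentially. (\<integral>x. f x * cut m x \<partial>\<mu>) > (\<integral>x. f x \<partial>\<mu>) - e / 2"
    using e by (intro order_tendstoD(1)) auto
  then obtain m where m: "(\<integral>x. f x * cut m x \<partial>\<mu>) > (\<integral>x. f x \<partial>\<mu>) - e / 2"
    using eventually_happens'[OF sequentially_bot] by blast
  have "\<forall>\<^sub>F n in sequentially. (\<integral>x. f x * cut m x \<partial>\<mu>) - e / 2 \<le> (\<integral>x. f x * cut m x \<partial>N n)"
  proof (rule liminf_integral_compact_support[OF N \<mu> lim])
    show "continuous_on UNIV (\<lambda>x. f x * cut m x)" by (intro continuous_on_mult f cut_cont)
    show "f x * cut m x \<le> B" for x using fcut f(3) by (rule order.trans)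
    show "norm x \<ge> real m \<Longrightarrow> f x * cut m x = 0" for x by (simp add: cut_def)
  qed (use e f cut in auto)
  then show ?thesis
  proof eventually_elim
    case (elim n)
    interpret prob_space "N n" by fact
    have [measurable_cong]: "sets (N n) = sets borel" by fact
    have "(\<integral>x. f x * cut m x \<partial>N n) \<le> (\<integral>x. f x \<partial>N n)"
      using fcut f cut by (intro Bochner_Integration.integral_mono integrable_const_bound[where B = B]) (auto simp: abs_mult intro: order.trans[OF fcut f(3)])
    then show ?case using elim m by linarith
  qed
qed

text \<open>The lower bound applied to \<open>B + f\<close> and to \<open>B - f\<close> gives both
  directions, because all measures have total mass 1. The sequence is shifted by
  \<open>Suc k\<close> since its first members may fail to be probability measures.\<close>

lemma weakly_converges_log_tent:
  fixes N :: "nat \<Rightarrow> complex measure" and \<mu> :: "complex measure"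
  assumes N: "\<And>n. n > k \<Longrightarrow> prob_space (N n)" "\<And>n. sets (N n) = sets borel"
    and \<mu>: "prob_space \<mu>" "sets \<mu> = sets borel"
    and lim: "\<And>i a. (\<lambda>n. \<integral>x. log_tent (1 / real (Suc i)) (x - a) \<partial>N n) \<longlonglongrightarrow> (\<integral>x. log_tent (1 / real (Suc i)) (x - a) \<partial>\<mu>)"
  shows "weakly_converges N \<mu>"
  unfolding weakly_converges_def
proof (intro allI impI)
  fix f :: "complex \<Rightarrow> real" assume f: "continuous_on UNIV f \<and> bounded (range f)"
  then obtain B where B: "\<And>x. \<bar>f x\<bar> \<le> B" by (auto simp: bounded_iff)
  define N' where "N' = (\<lambda>n. N (n + Suc k))"
  have N': "prob_space (N' n)" "sets (N' n) = sets borel" for n using N by (auto simp: N'_def)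
  have lim': "(\<lambda>n. \<integral>x. log_tent (1 / real (Suc i)) (x - a) \<partial>N' n) \<longlonglongrightarrow> (\<integral>x. log_tent (1 / real (Suc i)) (x - a) \<partial>\<mu>)" for i a
    unfolding N'_def by (rule LIMSEQ_ignore_initial_segment[OF lim])
  have [measurable]: "f \<in> borel_measurable borel" using f by (intro borel_measurable_continuous_onI) auto
  have int: "(\<integral>x. B + f x \<partial>\<nu>) = B + (\<integral>x. f x \<partial>\<nu>)" "(\<integral>x. B - f x \<partial>\<nu>) = B - (\<integral>x. f x \<partial>\<nu>)"
    if "prob_space \<nu>" "sets \<nu> = sets borel" for \<nu>
  proof -
    interpret prob_space \<nu> by fact
    have [measurable_cong]: "sets \<nu> = sets borel" by fact
    have "integrable \<nu> f" using B by (intro integrable_const_bound[where B = B]) auto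
    then show "(\<integral>x. B + f x \<partial>\<nu>) = B + (\<integral>x. f x \<partial>\<nu>)" "(\<integral>x. B - f x \<partial>\<nu>) = B - (\<integral>x. f x \<partial>\<nu>)"
      by (auto simp: prob_space)
  qed
  have "(\<lambda>n. integral\<^sup>L (N' n) f) \<longlonglongrightarrow> integral\<^sup>L \<mu> f"
  proof (rule LIMSEQ_I)
    fix e :: real assume e: "e > 0"
    have bounds: "0 \<le> B + f x" "B + f x \<le> 2 * B" "0 \<le> B - f x" "B - f x \<le> 2 * B" for x
      using B[of x] by auto
    have "\<forall>\<^sub>F n in sequentially. (\<integral>x. B + f x \<partial>\<mu>) - e / 2 \<le> (\<integral>x. B + f x \<partial>N' n)"
      using e f bounds by (intro liminf_integral_nonneg[OF N' \<mu> lim', where B = "2 * B"]) (auto intro!: continuous_intros)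
    moreover have "\<forall>\<^sub>F n in sequentially. (\<integral>x. B - f x \<partial>\<mu>) - e / 2 \<le> (\<integral>x. B - f x \<partial>N' n)"
      using e f bounds by (intro liminf_integral_nonneg[OF N' \<mu> lim', where B = "2 * B"]) (auto intro!: continuous_intros)
    ultimately have "\<forall>\<^sub>F n in sequentially. norm (integral\<^sup>L (N' n) f - integral\<^sup>L \<mu> f) < e"
    proof eventually_elim
      case (elim n)
      then show ?case using e unfolding int[OF N'] int[OF \<mu>] by (auto simp: abs_less_iff)
    qed
    then show "\<exists>n0. \<forall>n\<ge>n0. norm (integral\<^sup>L (N' n) f - integral\<^sup>L \<mu> f) < e"
      by (simp add: eventually_sequentially)
  qed
  then show "(\<lambda>n. integral\<^sup>L (N n) f) \<longlonglongrightarrow> integral\<^sup>L \<mu> f"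
    unfolding N'_def by (rule LIMSEQ_offset)
qed

section \<open>Wronskians of polynomials with swapped roots\<close>

lemma norm_det_le:
  fixes A :: "complex mat"
  assumes A: "A \<in> carrier_mat n n" and V: "\<And>i j. i < n \<Longrightarrow> j < n \<Longrightarrow> norm (A $$ (i, j)) \<le> V"
  shows "norm (Determinant.det A) \<le> fact n * V ^ n"
proof -
  have "norm (Determinant.det A) \<le> (\<Sum>p | p permutes {0..<n}. norm (signof p * (\<Prod>i = 0..<n. A $$ (i, p i)) :: complex))"
    unfolding det_def'[OF A] by (rule norm_sum)
  also have "\<dots> \<le> (\<Sum>p | p permutes {0..<n}. V ^ n)"
  proof (rule sum_mono)
    fix p assume p: "p \<in> {p. p permutes {0..<n}}"
    have "norm (\<Prod>i = 0..<n. A $$ (i, p i)) \<le> (\<Prod>i = 0..<n. V)"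
      unfolding prod_norm[symmetric] using p permutes_in_image[of p "{0..<n}"] by (intro prod_mono) (auto intro!: V)
    then show "norm (signof p * (\<Prod>i = 0..<n. A $$ (i, p i)) :: complex) \<le> V ^ n"
      by (simp add: norm_mult sign_def)
  qed
  also have "\<dots> = fact n * V ^ n"
    by (simp add: card_permutations[OF refl])
  finally show ?thesis .
qed

lemma norm_det_diff_le:
  fixes A B :: "complex mat"
  assumes A: "A \<in> carrier_mat n n" and B: "B \<in> carrier_mat n n" and V: "V > 0"
    and AV: "\<And>i j. i < n \<Longrightarrow> j < n \<Longrightarrow> norm (A $$ (i, j)) \<le> V"
    and BV: "\<And>i j. i < n \<Longrightarrow> j < n \<Longrightarrow> norm (B $$ (i, j)) \<le> V"
    and diff: "\<And>i j. i < n \<Longrightarrow> j < n \<Longrightarrow> norm (A $$ (i, j) - B $$ (i, j)) \<le> V * e"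
  shows "norm (Determinant.det A - Determinant.det B) \<le> fact n * (V ^ n * (n * e))"
proof -
  have "norm (Determinant.det A - Determinant.det B)
    = norm (\<Sum>p | p permutes {0..<n}. signof p * ((\<Prod>i = 0..<n. A $$ (i, p i)) - (\<Prod>i = 0..<n. B $$ (i, p i))) :: complex)"
    unfolding det_def'[OF A] det_def'[OF B] by (simp add: sum_subtractf right_diff_distrib)
  also have "\<dots> \<le> (\<Sum>p | p permutes {0..<n}. norm (signof p * ((\<Prod>i = 0..<n. A $$ (i, p i)) - (\<Prod>i = 0..<n. B $$ (i, p i))) :: complex))"
    by (rule norm_sum)
  also have "\<dots> \<le> (\<Sum>p | p permutes {0..<n}. V ^ n * (n * e))"
  proof (rule sum_mono)
    fix p assume "p \<in> {p. p permutes {0..<n}}"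
    then have p: "p i < n" if "i < n" for i using permutes_in_image[of p "{0..<n}" i] that by auto
    \<comment> \<open>Dividing by \<open>V\<close> brings all entries into the unit disc, where
      \<open>norm_prod_diff\<close> bounds the difference of two products by the sum of the
      differences of their factors.\<close>
    define a where "a = (\<lambda>i. A $$ (i, p i) / of_real V)"
    define b where "b = (\<lambda>i. B $$ (i, p i) / of_real V)"
    have ab: "norm (a i) \<le> 1" "norm (b i) \<le> 1" "norm (a i - b i) \<le> e" if "i \<in> {0..<n}" for i
      using AV[of i "p i"] BV[of i "p i"] diff[of i "p i"] p[of i] that V
      by (auto simp: a_def b_def norm_divide field_simps simp flip: diff_divide_distrib)
    have "(\<Prod>i = 0..<n. A $$ (i, p i)) = of_real V ^ n * (\<Prod>i = 0..<n. a i)"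
      "(\<Prod>i = 0..<n. B $$ (i, p i)) = of_real V ^ n * (\<Prod>i = 0..<n. b i)"
      using V by (auto simp: a_def b_def prod_dividef)
    then have "norm ((\<Prod>i = 0..<n. A $$ (i, p i)) - (\<Prod>i = 0..<n. B $$ (i, p i)))
      = V ^ n * norm ((\<Prod>i = 0..<n. a i) - (\<Prod>i = 0..<n. b i))"
      using V by (simp add: norm_mult norm_power flip: right_diff_distrib)
    also have "norm ((\<Prod>i = 0..<n. a i) - (\<Prod>i = 0..<n. b i)) \<le> (\<Sum>i = 0..<n. norm (a i - b i))"
      by (intro norm_prod_diff ab)
    also have "\<dots> \<le> (\<Sum>i = 0..<n. e)" by (intro sum_mono ab)
    finally have "norm ((\<Prod>i = 0..<n. A $$ (i, p i)) - (\<Prod>i = 0..<n. B $$ (i, p i))) \<le> V ^ n * (n * e)"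
      using V by simp
    then show "norm (signof p * ((\<Prod>i = 0..<n. A $$ (i, p i)) - (\<Prod>i = 0..<n. B $$ (i, p i))) :: complex) \<le> V ^ n * (n * e)"
      by (simp add: norm_mult sign_def)
  qed
  also have "\<dots> = fact n * (V ^ n * (n * e))"
    by (simp add: card_permutations[OF refl])
  finally show ?thesis .
qed

text \<open>Cramer's rule: the unknown \<open>g k = 1\<close> equals a determinant with a small column divided by \<open>det a\<close>.\<close>

lemma norm_det_le_of_small_image:
  fixes a :: "nat \<Rightarrow> nat \<Rightarrow> complex"
  assumes V: "\<And>l i. l \<le> k \<Longrightarrow> i \<le> k \<Longrightarrow> norm (a l i) \<le> V"
    and t: "\<And>l. l \<le> k \<Longrightarrow> norm (\<Sum>i\<le>k. a l i * g i) \<le> \<tau>" and g: "g k = 1"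
  shows "norm (Determinant.det (mat (Suc k) (Suc k) (\<lambda>(l, i). a l i))) \<le> fact (Suc k) * V ^ k * \<tau>"
proof -
  define E where "E = mat (Suc k) (Suc k) (\<lambda>(l, i). a l i)"
  have E: "E \<in> carrier_mat (Suc k) (Suc k)" by (simp add: E_def)
  have V0: "V \<ge> 0" using V[of 0 0] by (meson le0 norm_ge_zero order.trans)
  define D where "D = Determinant.det E"
  \<comment> \<open>Laplace expansion along column \<open>k\<close>; for \<open>i \<noteq> k\<close>
    the sum is the determinant of a matrix with two equal columns.\<close>
  have cof: "(\<Sum>l\<le>k. cofactor E l k * a l i) = (if i = k then D else 0)" if "i \<le> k" for i
  proof -
    have "(adj_mat E * E) $$ (k, i) = (D \<cdot>\<^sub>m 1\<^sub>m (Suc k)) $$ (k, i)"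
      using adj_mat(3)[OF E] by (simp add: D_def)
    also have "(adj_mat E * E) $$ (k, i) = (\<Sum>l<Suc k. cofactor E l k * a l i)"
      unfolding times_mat_def scalar_prod_def adj_mat_def using that E
      by (auto simp: E_def lessThan_atLeast0 intro!: sum.cong)
    finally show ?thesis using that by (auto simp: lessThan_Suc_atMost)
  qed
  have "D = (\<Sum>i\<le>k. (if i = k then D else 0) * g i)"
    using g by (subst sum.remove[of _ k]) auto
  also have "\<dots> = (\<Sum>i\<le>k. (\<Sum>l\<le>k. cofactor E l k * a l i) * g i)"
    using cof by (intro sum.cong) auto
  also have "\<dots> = (\<Sum>l\<le>k. cofactor E l k * (\<Sum>i\<le>k. a l i * g i))"
    unfolding sum_distrib_right sum_distrib_left by (subst sum.swap) (simp add: mult.assoc)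
  finally have "norm D \<le> (\<Sum>l\<le>k. norm (cofactor E l k * (\<Sum>i\<le>k. a l i * g i)))"
    using norm_sum by metis
  also have "\<dots> \<le> (\<Sum>l\<le>k. (fact k * V ^ k) * \<tau>)"
  proof (rule sum_mono)
    fix l assume l: "l \<in> {..k}"
    have "norm (cofactor E l k) = norm (Determinant.det (mat_delete E l k))"
      by (simp add: cofactor_def norm_mult norm_power)
    also have "\<dots> \<le> fact k * V ^ k"
    proof (rule norm_det_le)
      show "mat_delete E l k \<in> carrier_mat k k" using mat_delete_carrier[OF E, of l k] by simp
      show "norm (mat_delete E l k $$ (i, j)) \<le> V" if "i < k" "j < k" for i j
        using that l by (auto simp: mat_delete_def E_def intro!: V)
    qed
    finally show "norm (cofactor E l k * (\<Sum>i\<le>k. a l i * g i)) \<le> (fact k * V ^ k) * \<tau>"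
      using t[of l] l V0 by (auto simp: norm_mult intro!: mult_mono)
  qed
  also have "\<dots> = fact (Suc k) * V ^ k * \<tau>" by simp
  finally show ?thesis by (simp add: D_def E_def)
qed

text \<open>Derivatives divided by \<open>fact i\<close>, so that products turn into Cauchy products
  without binomial coefficients.\<close>

definition taylor_coeff :: "complex poly \<Rightarrow> complex \<Rightarrow> nat \<Rightarrow> complex" where
  "taylor_coeff p b i = coeff (p \<circ>\<^sub>p [:b, 1:]) i"

lemma taylor_coeff_0: "taylor_coeff p b 0 = poly p b"
  by (simp add: taylor_coeff_def coeff_pcompose_0)

lemma taylor_coeff_mult: "taylor_coeff (p * q) b k = (\<Sum>i\<le>k. taylor_coeff p b i * taylor_coeff q b (k - i))"
  by (simp add: taylor_coeff_def pcompose_mult coeff_mult)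

lemma poly_funpow_pderiv_eq_taylor_coeff:
  "poly ((pderiv ^^ k) p) b = fact k * taylor_coeff p b k"
proof (induction k arbitrary: p)
  case 0
  show ?case by (simp add: taylor_coeff_0)
next
  case (Suc k)
  have "pderiv (p \<circ>\<^sub>p [:b, 1:]) = pderiv p \<circ>\<^sub>p [:b, 1:]"
    by (simp add: pderiv_pcompose pderiv_pCons)
  then have "taylor_coeff (pderiv p) b k = of_nat (Suc k) * taylor_coeff p b (Suc k)"
    unfolding taylor_coeff_def by (metis coeff_pderiv)
  then show ?case using Suc.IH[of "pderiv p"] by (simp add: funpow_Suc_right del: funpow.simps)
qed

section \<open>Products of linear factors and sublevel sets of polynomials\<close>

definition root_poly :: "'j set \<Rightarrow> ('j \<Rightarrow> complex) \<Rightarrow> complex poly" where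
  "root_poly J c = (\<Prod>j\<in>J. [:- c j, 1:])"

lemma degree_root_poly: "degree (root_poly J c) \<le> card J"
proof (cases "finite J")
  case True
  have "degree (root_poly J c) \<le> sum (degree \<circ> (\<lambda>j. [:- c j, 1:])) J"
    unfolding root_poly_def by (rule degree_prod_sum_le[OF True])
  then show ?thesis by simp
qed (simp add: root_poly_def)

lemma poly_root_poly: "poly (root_poly J c) b = (\<Prod>j\<in>J. b - c j)"
  by (simp add: root_poly_def poly_prod)

lemma taylor_coeff_root_poly:
  "taylor_coeff (root_poly J c) b i = coeff (\<Prod>j\<in>J. [:b - c j, 1:]) i"
  by (simp add: taylor_coeff_def root_poly_def pcompose_prod pcompose_pCons)

lemma coeff_linear_mult:
  fixes p :: "'a::comm_semiring_0 poly"
  shows "coeff ([:a, b:] * p) 0 = a * coeff p 0"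
    and "coeff ([:a, b:] * p) (Suc i) = a * coeff p (Suc i) + b * coeff p i"
  by (auto simp: coeff_pCons)

text \<open>The coefficients are dominated by those of the product of
  \<open>norm (b - c j) + x\<close>, and each of these is at most the value at
  \<open>x = 1\<close>.\<close>

lemma norm_taylor_coeff_root_poly_le:
  assumes "finite J"
  shows "norm (taylor_coeff (root_poly J c) b i) \<le> (\<Prod>j\<in>J. 1 + norm (b - c j))"
  unfolding taylor_coeff_root_poly using assms
proof (induction J arbitrary: i)
  case (insert j J)
  define P where "P = (\<Prod>j\<in>J. 1 + norm (b - c j))"
  have IH: "norm (coeff (\<Prod>j\<in>J. [:b - c j, 1:]) i) \<le> P" for i using insert.IH[of i] by (simp add: P_def)
  have P: "P \<ge> 0" unfolding P_def by (intro prod_nonneg) auto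
  have "norm (coeff ([:b - c j, 1:] * (\<Prod>j\<in>J. [:b - c j, 1:])) i) \<le> norm (b - c j) * P + P"
  proof (cases i)
    case 0
    have "norm (b - c j) * norm (coeff (\<Prod>j\<in>J. [:b - c j, 1:]) 0) \<le> norm (b - c j) * P"
      by (intro mult_left_mono IH) auto
    then show ?thesis using P unfolding 0 coeff_linear_mult norm_mult by linarith
  next
    case (Suc i')
    have "norm ((b - c j) * coeff (\<Prod>j\<in>J. [:b - c j, 1:]) (Suc i') + 1 * coeff (\<Prod>j\<in>J. [:b - c j, 1:]) i')
      \<le> norm (b - c j) * norm (coeff (\<Prod>j\<in>J. [:b - c j, 1:]) (Suc i')) + norm (coeff (\<Prod>j\<in>J. [:b - c j, 1:]) i')"
      by (rule order.trans[OF norm_triangle_ineq]) (simp add: norm_mult)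
    also have "\<dots> \<le> norm (b - c j) * P + P" by (intro add_mono mult_left_mono IH) auto
    finally show ?thesis unfolding Suc coeff_linear_mult .
  qed
  then show ?case using insert.hyps by (simp add: P_def algebra_simps)
qed (auto simp: coeff_pCons split: nat.splits)

text \<open>Divided by the value at \<open>b\<close>, the coefficient is the \<open>i\<close>-th
  elementary symmetric polynomial of the numbers \<open>1 / (b - c j)\<close>. This is the source of
  the upper bound on \<open>P_n^(k) / P_n\<close>.\<close>

lemma norm_taylor_coeff_root_poly_le_sum:
  assumes "finite J" "\<And>j. j \<in> J \<Longrightarrow> b \<noteq> c j"
  shows "norm (taylor_coeff (root_poly J c) b i)
    \<le> norm (poly (root_poly J c) b) * (\<Sum>j\<in>J. 1 / norm (b - c j)) ^ i"
  unfolding taylor_coeff_root_poly poly_root_poly using assms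
proof (induction J arbitrary: i)
  case (insert j J)
  define P where "P = norm (\<Prod>j\<in>J. b - c j)"
  define s where "s = (\<Sum>j\<in>J. 1 / norm (b - c j))"
  define q where "q = (\<Prod>j\<in>J. [:b - c j, 1:])"
  define u where "u = norm (b - c j)"
  have u: "u > 0" using insert.prems[of j] by (simp add: u_def)
  have IH: "norm (coeff q i) \<le> P * s ^ i" for i
    using insert.IH[of i] insert.prems by (simp add: P_def s_def q_def)
  have P: "P \<ge> 0" "s \<ge> 0" unfolding P_def s_def by (auto intro: sum_nonneg)
  have "norm (coeff ([:b - c j, 1:] * q) i) \<le> (u * P) * (1 / u + s) ^ i"
  proof (cases i)
    case 0
    have "u * norm (coeff q 0) \<le> u * P" using IH[of 0] u by (intro mult_left_mono) auto
    then show ?thesis unfolding 0 coeff_linear_mult norm_mult by (simp add: u_def)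
  next
    case (Suc i')
    have "norm ((b - c j) * coeff q (Suc i') + 1 * coeff q i') \<le> u * norm (coeff q (Suc i')) + norm (coeff q i')"
      by (rule order.trans[OF norm_triangle_ineq]) (simp add: norm_mult u_def)
    also have "\<dots> \<le> u * (P * s ^ Suc i') + P * s ^ i'" using u by (intro add_mono mult_left_mono IH) auto
    also have "\<dots> = (u * P) * ((1 / u + s) * s ^ i')" using u by (simp add: field_simps)
    also have "\<dots> \<le> (u * P) * ((1 / u + s) * (1 / u + s) ^ i')"
      using u P by (intro mult_left_mono power_mono) auto
    finally show ?thesis unfolding Suc coeff_linear_mult by simp
  qed
  then show ?case using insert.hyps by (simp add: P_def q_def s_def u_def norm_mult)
qed (auto simp: coeff_pCons split: nat.splits)

text \<open>Root by root comparison with \<open>z0\<close>: outside the discs of radius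
  \<open>e\<close> about the roots, every factor satisfies
  \<open>norm (b - \<zeta>) \<ge> q * norm (z0 - \<zeta>)\<close> with
  \<open>q = e / (3 * R)\<close>. For \<open>norm \<zeta> < 2 * R\<close> this holds since
  \<open>norm (z0 - \<zeta>) \<le> 3 * R\<close>, for the other roots since the ratio of the
  distances is at least \<open>1 / 3\<close>. The leading coefficient cancels.\<close>

lemma emeasure_sublevel_poly:
  fixes Q :: "complex poly"
  assumes deg: "degree Q \<le> D" and z0: "norm z0 \<le> R" "norm (poly Q z0) \<ge> s" and s: "s > 0"
    and e: "0 < e" "e \<le> R"
  shows "emeasure lborel {b \<in> cball 0 R. norm (poly Q b) < s * (e / (3 * R)) ^ D} \<le> ennreal (real D * (pi * e\<^sup>2))"
proof -
  have Q: "Q \<noteq> 0" using z0 s by auto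
  define q where "q = e / (3 * R)"
  have q: "0 < q" "q \<le> 1 / 3" using e by (auto simp: q_def field_simps)
  define Z where "Z = set_mset (proots Q)"
  have fac: "poly Q x = lead_coeff Q * (\<Prod>\<zeta>\<in>#proots Q. x - \<zeta>)" for x
  proof -
    have "poly (\<Prod>\<zeta>\<in>#A. [:- \<zeta>, 1:]) x = (\<Prod>\<zeta>\<in>#A. x - \<zeta>)" for A :: "complex multiset"
      by (induction A) (auto simp: algebra_simps)
    then show ?thesis by (subst complex_poly_decompose_multiset[symmetric]) (simp only: poly_smult)
  qed
  have low: "norm (poly Q b) \<ge> s * q ^ D" if b: "norm b \<le> R" and far: "\<And>\<zeta>. \<zeta> \<in> Z \<Longrightarrow> norm (b - \<zeta>) > e" for b
  proof -
    have step: "norm (b - \<zeta>) \<ge> q * norm (z0 - \<zeta>)" if "\<zeta> \<in> Z" for \<zeta>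
    proof (cases "norm \<zeta> < 2 * R")
      case True
      have "q * norm (z0 - \<zeta>) \<le> q * (3 * R)"
        using True z0(1) q norm_triangle_ineq4[of z0 \<zeta>] by (intro mult_left_mono) auto
      also have "\<dots> = e" using e by (simp add: q_def)
      finally show ?thesis using far[OF that] by simp
    next
      case False
      have "q * norm (z0 - \<zeta>) \<le> (1 / 3) * (R + norm \<zeta>)"
        using q z0(1) norm_triangle_ineq4[of z0 \<zeta>] by (intro mult_mono) auto
      also have "\<dots> \<le> norm \<zeta> - R" using False by simp
      also have "\<dots> \<le> norm (b - \<zeta>)" using b norm_triangle_ineq2[of \<zeta> b] by (simp add: norm_minus_commute)
      finally show ?thesis .
    qed
    have "norm (\<Prod>\<zeta>\<in>#A. b - \<zeta>) \<ge> q ^ size A * norm (\<Prod>\<zeta>\<in>#A. z0 - \<zeta>)" if "set_mset A \<subseteq> Z" for A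
      using that
    proof (induction A)
      case (add \<zeta> A)
      have "(q * norm (z0 - \<zeta>)) * (q ^ size A * norm (\<Prod>\<zeta>\<in>#A. z0 - \<zeta>)) \<le> norm (b - \<zeta>) * norm (\<Prod>\<zeta>\<in>#A. b - \<zeta>)"
        using add step[of \<zeta>] q by (intro mult_mono) auto
      then show ?case by (simp add: norm_mult mult_ac)
    qed auto
    from this[of "proots Q"] have "norm (poly Q b) \<ge> q ^ size (proots Q) * norm (poly Q z0)"
      unfolding fac norm_mult Z_def by (subst mult.left_commute) (intro mult_left_mono, simp_all)
    moreover have "q ^ size (proots Q) \<ge> q ^ D"
      using q deg by (intro power_decreasing) (auto simp: size_proots_complex)
    then have "q ^ size (proots Q) * norm (poly Q z0) \<ge> q ^ D * s"
      using z0 q s by (intro mult_mono) auto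
    ultimately show ?thesis by (simp add: mult.commute)
  qed
  have "{b \<in> cball 0 R. norm (poly Q b) < s * q ^ D} \<subseteq> (\<Union>\<zeta>\<in>Z. cball \<zeta> e)"
    using low by (fastforce simp: dist_norm norm_minus_commute not_le[symmetric])
  then have "emeasure lborel {b \<in> cball 0 R. norm (poly Q b) < s * q ^ D} \<le> emeasure lborel (\<Union>\<zeta>\<in>Z. cball \<zeta> e)"
    by (intro emeasure_mono) (auto simp: Z_def)
  also have "\<dots> \<le> (\<Sum>\<zeta>\<in>Z. emeasure lborel (cball \<zeta> e))"
    by (rule emeasure_subadditive_finite) (auto simp: Z_def)
  also have "\<dots> = of_nat (card Z) * ennreal (pi * e\<^sup>2)"
    using e by (simp add: emeasure_cball_complex)
  also have "\<dots> \<le> of_nat D * ennreal (pi * e\<^sup>2)"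
  proof (intro mult_right_mono of_nat_mono)
    have "card (set_mset A) \<le> size A" for A :: "complex multiset"
      by (induction A) (auto simp: card_insert_if)
    then have "card Z \<le> size (proots Q)" unfolding Z_def .
    then show "card Z \<le> D" using deg by (simp add: size_proots_complex)
  qed auto
  also have "\<dots> = ennreal (real D * (pi * e\<^sup>2))" by (simp add: ennreal_mult ennreal_of_nat_eq_real_of_nat)
  finally show ?thesis by (simp add: q_def)
qed

text \<open>A kernel vector would be the coefficient vector, in the basis \<open>x choose i\<close>,
  of a polynomial of degree at most \<open>k\<close> with the \<open>k + 1\<close> zeros
  \<open>N l\<close>. The determinant is an integer, so being nonzero already means absolute value
  at least 1.\<close>

lemma choose_vandermonde_nonzero:
  fixes N :: "nat \<Rightarrow> nat"
  assumes inj: "inj_on N {..k}"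
  shows "norm (Determinant.det (mat (Suc k) (Suc k) (\<lambda>(l, i). of_nat (N l choose i) :: complex))) \<ge> 1"
proof -
  define C :: "int mat" where "C = mat (Suc k) (Suc k) (\<lambda>(l, i). of_nat (N l choose i))"
  define C' :: "complex mat" where "C' = mat (Suc k) (Suc k) (\<lambda>(l, i). of_nat (N l choose i))"
  have "C' = map_mat of_int C" by (auto simp: C_def C'_def)
  then have det_eq: "Determinant.det C' = of_int (Determinant.det C)" by simp
  have C': "C' \<in> carrier_mat (Suc k) (Suc k)" by (simp add: C'_def)
  have "Determinant.det C' \<noteq> 0"
  proof
    assume "Determinant.det C' = 0"
    then obtain v where v: "v \<in> carrier_vec (Suc k)" "v \<noteq> 0\<^sub>v (Suc k)" "C' *\<^sub>v v = 0\<^sub>v (Suc k)"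
      using det_0_iff_vec_prod_zero[OF C'] by auto
    define bp :: "nat \<Rightarrow> complex poly" where "bp i = Polynomial.smult (1 / fact i) (\<Prod>j<i. [:- of_nat j, 1:])" for i
    have bp_deg: "degree (bp i) = i" for i
      unfolding bp_def by (simp add: degree_prod_sum_eq)
    have bp_lead: "coeff (bp i) i \<noteq> 0" for i
    proof (cases "i = 0")
      case True
      then show ?thesis by (simp add: bp_def)
    next
      case False
      then have "bp i \<noteq> 0" using bp_deg[of i] by auto
      then show ?thesis using bp_deg[of i] leading_coeff_0_iff[of "bp i"] by simp
    qed
    have bp_poly: "poly (bp i) (of_nat n) = of_nat (n choose i)" for i n
      unfolding bp_def binomial_gbinomial gbinomial_prod_rev
      by (simp add: poly_prod lessThan_atLeast0)
    define P where "P = (\<Sum>i\<le>k. Polynomial.smult (vec_index v i) (bp i))"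
    have root: "poly P (of_nat (N l)) = 0" if "l \<le> k" for l
    proof -
      have "vec_index (C' *\<^sub>v v) l = 0" using v(3) that by simp
      moreover have "vec_index (C' *\<^sub>v v) l = (\<Sum>i<Suc k. of_nat (N l choose i) * vec_index v i)"
        using that v(1) by (auto simp: C'_def scalar_prod_def lessThan_atLeast0 intro!: sum.cong)
      ultimately show ?thesis
        by (simp add: P_def poly_sum bp_poly lessThan_Suc_atMost mult.commute)
    qed
    have "P = 0"
    proof (rule ccontr)
      assume P: "P \<noteq> 0"
      have "degree P \<le> k" unfolding P_def
        by (intro degree_sum_le) (auto intro: order.trans[OF degree_smult_le] simp: bp_deg)
      moreover have "(\<lambda>l. of_nat (N l)) ` {..k} \<subseteq> {x. poly P x = 0}" using root by auto
      then have "card ((\<lambda>l. of_nat (N l) :: complex) ` {..k}) \<le> card {x. poly P x = 0}"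
        by (intro card_mono poly_roots_finite P)
      moreover have "card ((\<lambda>l. of_nat (N l) :: complex) ` {..k}) = Suc k"
        using inj by (subst card_image) (auto simp: inj_on_def)
      moreover have "card {x. poly P x = 0} \<le> degree P" using P by (rule card_poly_roots_bound)
      ultimately show False by linarith
    qed
    have "vec_index v i = 0" if "i \<le> k" for i
    proof (rule ccontr)
      assume "vec_index v i \<noteq> 0"
      \<comment> \<open>The basis polynomials have distinct degrees, so the highest index
        \<open>m\<close> with a nonzero coefficient shows up in the coefficient of
        \<open>x ^ m\<close>, to which no other basis polynomial present contributes.\<close>
      define I where "I = {i. i \<le> k \<and> vec_index v i \<noteq> 0}"
      have I: "finite I" "I \<noteq> {}" using \<open>vec_index v i \<noteq> 0\<close> that by (auto simp: I_def)
      define m where "m = Max I"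
      have m: "m \<le> k" "vec_index v m \<noteq> 0" using Max_in[OF I] by (auto simp: m_def I_def)
      have above: "vec_index v i = 0" if "i \<le> k" "i > m" for i
      proof (rule ccontr)
        assume "vec_index v i \<noteq> 0"
        then have "i \<in> I" using that by (simp add: I_def)
        then show False using Max_ge[OF I(1), of i] that by (simp add: m_def)
      qed
      have "coeff P m = (\<Sum>i\<le>k. if i = m then vec_index v m * coeff (bp m) m else 0)"
        unfolding P_def coeff_sum coeff_smult
      proof (intro sum.cong refl)
        fix i assume "i \<in> {..k}"
        then show "vec_index v i * coeff (bp i) m = (if i = m then vec_index v m * coeff (bp m) m else 0)"
          using above[of i] coeff_eq_0[of "bp i" m] bp_deg[of i] by (cases i m rule: linorder_cases) auto
      qed
      also have "\<dots> = vec_index v m * coeff (bp m) m" using m by simp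
      finally show False using \<open>P = 0\<close> m bp_lead by simp
    qed
    then have "v = 0\<^sub>v (Suc k)" using v(1) by (intro eq_vecI) auto
    then show False using v(2) by simp
  qed
  then have "Determinant.det C \<noteq> 0" using det_eq by auto
  then have "\<bar>Determinant.det C\<bar> \<ge> 1" by linarith
  then have "real_of_int \<bar>Determinant.det C\<bar> \<ge> 1" by linarith
  then show ?thesis unfolding C'_def[symmetric] det_eq by (simp only: norm_of_int)
qed

text \<open>Elementary symmetric polynomial of the family \<open>\<alpha>\<close>, encoded as a
  coefficient of the generating polynomial; the recursion on \<open>J\<close> is then multiplication
  by a linear factor.\<close>

definition elem_sym :: "'j set \<Rightarrow> ('j \<Rightarrow> complex) \<Rightarrow> nat \<Rightarrow> complex" where
  "elem_sym J \<alpha> i = coeff (\<Prod>j\<in>J. [:1, \<alpha> j:]) i"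

lemma elem_sym_rec:
  assumes "finite J" "j \<notin> J"
  shows "elem_sym (insert j J) \<alpha> 0 = elem_sym J \<alpha> 0"
    and "elem_sym (insert j J) \<alpha> (Suc i) = elem_sym J \<alpha> (Suc i) + \<alpha> j * elem_sym J \<alpha> i"
  unfolding elem_sym_def prod.insert[OF assms] coeff_linear_mult by simp_all

lemma elem_sym_empty: "elem_sym {} \<alpha> i = (if i = 0 then 1 else 0)"
  by (auto simp: elem_sym_def coeff_pCons split: nat.splits)

lemma elem_sym_0: "finite J \<Longrightarrow> elem_sym J \<alpha> 0 = 1"
  by (induction J rule: finite_induct) (simp_all add: elem_sym_rec elem_sym_empty)

lemma elem_sym_indicator:
  assumes "finite J" "A \<subseteq> J"
  shows "elem_sym J (indicator A) i = of_nat (card A choose i)"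
proof -
  have "(\<Prod>j\<in>J. [:1, indicator A j:]) = (\<Prod>j\<in>J. if j \<in> A then [:1, 1::complex:] else 1)"
    by (intro prod.cong) auto
  also have "\<dots> = [:1, 1:] ^ card A"
    using assms by (simp add: prod.If_cases Int_absorb1)
  finally have *: "(\<Prod>j\<in>J. [:1, indicator A j:]) = ([:1, 1:] :: complex poly) ^ card A" .
  show ?thesis
  proof (cases "i \<le> card A")
    case True
    then show ?thesis unfolding elem_sym_def * by (simp add: coeff_linear_poly_power)
  next
    case False
    then have "degree (([:1, 1:] :: complex poly) ^ card A) < i" by (simp add: degree_power_eq)
    then show ?thesis using False unfolding elem_sym_def * by (simp add: coeff_eq_0)
  qed
qed

lemma elem_sym_scale: "finite J \<Longrightarrow> elem_sym J (\<lambda>j. c * \<alpha> j) i = c ^ i * elem_sym J \<alpha> i"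
proof (induction J arbitrary: i rule: finite_induct)
  case (insert j J)
  then show ?case by (cases i) (auto simp: elem_sym_rec algebra_simps)
qed (auto simp: elem_sym_empty)

lemma taylor_coeff_eq_elem_sym:
  assumes "finite J" "\<And>j. j \<in> J \<Longrightarrow> z \<noteq> c j"
  shows "taylor_coeff (root_poly J c) z i = poly (root_poly J c) z * elem_sym J (\<lambda>j. 1 / (z - c j)) i"
proof -
  have "(\<Prod>j\<in>J. [:z - c j, 1:]) = (\<Prod>j\<in>J. Polynomial.smult (z - c j) [:1, 1 / (z - c j):])"
    using assms by (intro prod.cong) auto
  also have "\<dots> = Polynomial.smult (\<Prod>j\<in>J. z - c j) (\<Prod>j\<in>J. [:1, 1 / (z - c j):])"
    by (rule prod_smult)
  finally show ?thesis by (simp add: taylor_coeff_root_poly elem_sym_def poly_root_poly)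
qed

text \<open>Induction over \<open>J\<close> with the recursion of \<open>elem_sym\<close>. The base
  3 is what closes it: since \<open>norm (\<alpha> j) \<le> 2\<close>, one more index adds at most
  \<open>e * (2 + 1) * (3 * M) ^ i'\<close>, which is absorbed when \<open>(3 * M) ^ Suc i'\<close>
  grows to \<open>(3 * M + 3) ^ Suc i'\<close>.\<close>

lemma elem_sym_diff_le:
  assumes J: "finite J" and \<beta>: "\<And>j. j \<in> J \<Longrightarrow> \<beta> j \<in> {0, 1}"
    and diff: "\<And>j. j \<in> J \<Longrightarrow> norm (\<alpha> j - \<beta> j) \<le> e" and e: "0 \<le> e" "e \<le> 1"
  shows "norm (elem_sym J \<beta> i) \<le> real (card J) ^ i"
    and "norm (elem_sym J \<alpha> i - elem_sym J \<beta> i) \<le> e * (3 * real (card J)) ^ i"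
proof -
  have "(\<forall>i. norm (elem_sym J \<beta> i) \<le> real (card J) ^ i)
    \<and> (\<forall>i. norm (elem_sym J \<alpha> i - elem_sym J \<beta> i) \<le> e * (3 * real (card J)) ^ i)"
    using J \<beta> diff
  proof (induction J rule: finite_induct)
    case empty
    then show ?case using e by (auto simp: elem_sym_empty)
  next
    case (insert j J)
    define M where "M = real (card J)"
    have M: "M \<ge> 0" by (simp add: M_def)
    have cardj: "real (card (insert j J)) = M + 1" using insert.hyps by (simp add: M_def)
    have IH1: "norm (elem_sym J \<beta> i) \<le> M ^ i" and IH2: "norm (elem_sym J \<alpha> i - elem_sym J \<beta> i) \<le> e * (3 * M) ^ i" for i
      using insert.IH insert.prems by (auto simp: M_def)
    have \<beta>j: "norm (\<beta> j) \<le> 1" using insert.prems(1)[of j] by auto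
    have dj: "norm (\<alpha> j - \<beta> j) \<le> e" using insert.prems(2)[of j] by auto
    have \<alpha>j: "norm (\<alpha> j) \<le> 2" using norm_triangle_ineq[of "\<alpha> j - \<beta> j" "\<beta> j"] \<beta>j dj e by simp
    have pow: "x ^ Suc i + c * x ^ i \<le> (x + c) ^ Suc i" if "x \<ge> 0" "c \<ge> 0" for x c :: real and i
    proof -
      have "(x + c) * x ^ i \<le> (x + c) * (x + c) ^ i" using that by (intro mult_left_mono power_mono) auto
      then show ?thesis by (simp add: algebra_simps)
    qed
    have "norm (elem_sym (insert j J) \<beta> i) \<le> (M + 1) ^ i
      \<and> norm (elem_sym (insert j J) \<alpha> i - elem_sym (insert j J) \<beta> i) \<le> e * (3 * (M + 1)) ^ i" for i
    proof (cases i)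
      case 0
      then show ?thesis using insert.hyps e by (simp add: elem_sym_0)
    next
      case (Suc i')
      have "norm (elem_sym (insert j J) \<beta> i) \<le> norm (elem_sym J \<beta> i) + norm (\<beta> j) * norm (elem_sym J \<beta> i')"
        unfolding Suc elem_sym_rec[OF insert.hyps] norm_mult[symmetric] by (rule norm_triangle_ineq)
      also have "\<dots> \<le> M ^ i + 1 * M ^ i'" using \<beta>j M by (intro add_mono mult_mono IH1) auto
      also have "\<dots> \<le> (M + 1) ^ i" using pow[OF M, of 1 i'] by (simp add: Suc)
      finally have 1: "norm (elem_sym (insert j J) \<beta> i) \<le> (M + 1) ^ i" .
      have "elem_sym (insert j J) \<alpha> i - elem_sym (insert j J) \<beta> i
        = (elem_sym J \<alpha> i - elem_sym J \<beta> i) + (\<alpha> j * (elem_sym J \<alpha> i' - elem_sym J \<beta> i')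
          + (\<alpha> j - \<beta> j) * elem_sym J \<beta> i')"
        unfolding Suc elem_sym_rec[OF insert.hyps] by (simp add: algebra_simps)
      also have "norm \<dots> \<le> norm (elem_sym J \<alpha> i - elem_sym J \<beta> i)
        + (norm (\<alpha> j) * norm (elem_sym J \<alpha> i' - elem_sym J \<beta> i') + norm (\<alpha> j - \<beta> j) * norm (elem_sym J \<beta> i'))"
        unfolding norm_mult[symmetric] by (intro order.trans[OF norm_triangle_ineq] add_mono order_refl norm_triangle_ineq)
      also have "\<dots> \<le> e * (3 * M) ^ i + (2 * (e * (3 * M) ^ i') + e * M ^ i')"
        using \<alpha>j dj e M by (intro add_mono mult_mono IH1 IH2) auto
      also have "M ^ i' \<le> (3 * M) ^ i'" using M by (intro power_mono) auto
      then have "e * (3 * M) ^ i + (2 * (e * (3 * M) ^ i') + e * M ^ i') \<le> e * (3 * M) ^ i + (2 * (e * (3 * M) ^ i') + e * (3 * M) ^ i')"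
        using e by (intro add_mono mult_left_mono order_refl) auto
      also have "\<dots> = e * ((3 * M) ^ Suc i' + 3 * (3 * M) ^ i')" by (simp add: Suc algebra_simps)
      also have "\<dots> \<le> e * (3 * M + 3) ^ Suc i'" using e M by (intro mult_left_mono pow) auto
      finally have 2: "norm (elem_sym (insert j J) \<alpha> i - elem_sym (insert j J) \<beta> i) \<le> e * (3 * (M + 1)) ^ i"
        by (simp add: Suc algebra_simps)
      from 1 2 show ?thesis ..
    qed
    then show ?case unfolding cardj by blast
  qed
  then show "norm (elem_sym J \<beta> i) \<le> real (card J) ^ i"
    and "norm (elem_sym J \<alpha> i - elem_sym J \<beta> i) \<le> e * (3 * real (card J)) ^ i" by auto
qed

section \<open>The lower bound for the Wronskian\<close>

lemma det_scale_rows_cols: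
  fixes G :: "nat \<Rightarrow> nat \<Rightarrow> complex"
  shows "Determinant.det (mat n n (\<lambda>(l, i). u l * v i * G l i))
    = (\<Prod>l<n. u l) * (\<Prod>i<n. v i) * Determinant.det (mat n n (\<lambda>(l, i). G l i))"
proof -
  have "(\<Prod>l = 0..<n. mat n n (\<lambda>(l, i). u l * v i * G l i) $$ (l, p l))
    = (\<Prod>l<n. u l) * (\<Prod>i<n. v i) * (\<Prod>l = 0..<n. mat n n (\<lambda>(l, i). G l i) $$ (l, p l))"
    if p: "p permutes {0..<n}" for p
  proof -
    have pl: "p l < n" if "l < n" for l using p that permutes_in_image[of p "{0..<n}" l] by auto
    have "(\<Prod>l = 0..<n. mat n n (\<lambda>(l, i). u l * v i * G l i) $$ (l, p l)) = (\<Prod>l = 0..<n. u l * v (p l) * G l (p l))"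
      using pl by (intro prod.cong) auto
    also have "\<dots> = (\<Prod>l = 0..<n. u l) * (\<Prod>l = 0..<n. v (p l)) * (\<Prod>l = 0..<n. G l (p l))"
      by (simp add: prod.distrib)
    also have "(\<Prod>l = 0..<n. v (p l)) = (\<Prod>i = 0..<n. v i)"
      using prod.permute[OF p, of v] by (simp add: comp_def)
    also have "(\<Prod>l = 0..<n. G l (p l)) = (\<Prod>l = 0..<n. mat n n (\<lambda>(l, i). G l i) $$ (l, p l))"
      using pl by (intro prod.cong) auto
    finally show ?thesis by (simp add: lessThan_atLeast0)
  qed
  then show ?thesis
    by (subst (1 2) det_def'[of _ n]) (auto simp: sum_distrib_left mult.left_commute intro!: sum.cong)
qed

lemma mat_cong:
  assumes "\<And>l i. l < n \<Longrightarrow> i < m \<Longrightarrow> f l i = g l i"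
  shows "mat n m (\<lambda>(l, i). f l i) = mat n m (\<lambda>(l, i). g l i)"
  using assms by (intro eq_matI) auto

text \<open>On the circle of radius \<open>r\<close> about \<open>w\<close> the roots near \<open>w\<close> contribute \<open>r / (z - c) \<approx> 1\<close> and the
  remaining ones \<open>\<approx> 0\<close>, so up to scaling of rows and columns the Wronskian matrix is close to the
  integer matrix of binomial coefficients \<open>card (N l) choose i\<close>.\<close>

lemma wronskian_lower_bound:
  fixes c :: "nat \<Rightarrow> 'j \<Rightarrow> complex" and N :: "nat \<Rightarrow> 'j set"
  assumes J: "finite J" "J \<noteq> {}" and k: "k \<ge> 1"
    and N: "\<And>l. l \<le> k \<Longrightarrow> N l \<subseteq> J" "inj_on (\<lambda>l. card (N l)) {..k}"
    and near: "\<And>l j. l \<le> k \<Longrightarrow> j \<in> N l \<Longrightarrow> norm (c l j - w) \<le> \<rho>"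
    and far: "\<And>l j. l \<le> k \<Longrightarrow> j \<in> J - N l \<Longrightarrow> norm (c l j - w) \<ge> R1"
    and e: "0 < e" "e \<le> 1" and r: "0 < r" "r \<le> 1" and \<rho>: "\<rho> \<le> r * e / 2" and R1: "r \<le> R1 * e / 2"
    and small: "fact (Suc k) * (((4 * real (card J)) ^ k) ^ Suc k * (real (Suc k) * e)) \<le> 1 / 2"
  shows "norm (Determinant.det (mat (Suc k) (Suc k)
      (\<lambda>(l, i). taylor_coeff (root_poly J (c l)) (w + of_real r) i))) \<ge> (1 / 2) * (r / 2) ^ (Suc k * card J)"
proof -
  define M where "M = real (card J)"
  have M: "M \<ge> 1" using J by (simp add: M_def Suc_le_eq card_gt_0_iff)
  define z where "z = w + of_real r"
  define \<alpha> where "\<alpha> = (\<lambda>l j. of_real r * (1 / (z - c l j)))"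
  have "r * e \<le> r" using r e by simp
  have "R1 > 0" using r e R1 by (metis linorder_not_le mult_nonpos_nonneg order.strict_trans2 divide_nonpos_pos less_imp_le zero_less_numeral)
  then have "R1 * e \<le> R1" using e by simp
  have dist_low: "norm (z - c l j) \<ge> r / 2" and \<alpha>_close: "norm (\<alpha> l j - indicator (N l) j) \<le> e"
    if l: "l \<le> k" and j: "j \<in> J" for l j
  proof -
    have "norm (z - c l j) \<ge> r / 2 \<and> norm (\<alpha> l j - indicator (N l) j) \<le> e"
    proof (cases "j \<in> N l")
      case True
      have 1: "norm (c l j - w) \<le> r * e / 2" using near[OF l True] \<rho> by linarith
      have "norm (of_real r :: complex) - norm (c l j - w) \<le> norm (of_real r - (c l j - w))" by (rule norm_triangle_ineq2)
      also have "of_real r - (c l j - w) = z - c l j" by (simp add: z_def)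
      finally have 2: "r - norm (c l j - w) \<le> norm (z - c l j)" using r by simp
      then have low: "norm (z - c l j) \<ge> r / 2" using 1 \<open>r * e \<le> r\<close> by linarith
      then have nz: "z - c l j \<noteq> 0" using r by auto
      have "\<alpha> l j - 1 = (c l j - w) / (z - c l j)" using nz by (simp add: \<alpha>_def z_def field_simps)
      then have "norm (\<alpha> l j - 1) = norm (c l j - w) / norm (z - c l j)" by (simp add: norm_divide)
      also have "\<dots> \<le> (r * e / 2) / (r / 2)" using 1 low r e by (intro frac_le) auto
      also have "\<dots> = e" using r by simp
      finally show ?thesis using low True by simp
    next
      case False
      have 1: "norm (c l j - w) \<ge> R1" using far[OF l] j False by auto
      have "norm (c l j - w) - norm (of_real r :: complex) \<le> norm ((c l j - w) - of_real r)" by (rule norm_triangle_ineq2)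
      also have "norm ((c l j - w) - of_real r) = norm (z - c l j)" by (simp add: z_def norm_minus_commute[of "w + of_real r"] algebra_simps)
      finally have 2: "R1 - r \<le> norm (z - c l j)" using 1 r by simp
      have R: "R1 / 2 \<le> norm (z - c l j)" using 2 R1 \<open>R1 * e \<le> R1\<close> by linarith
      have "r \<le> R1 / 2" using R1 \<open>R1 * e \<le> R1\<close> by linarith
      then have low: "norm (z - c l j) \<ge> r / 2" using R r by linarith
      have "norm (\<alpha> l j) = r / norm (z - c l j)" using r by (simp add: \<alpha>_def norm_divide)
      also have "\<dots> \<le> (R1 * e / 2) / (R1 / 2)" using R R1 r \<open>R1 > 0\<close> by (intro frac_le) auto
      also have "\<dots> = e" using \<open>R1 > 0\<close> by simp
      finally show ?thesis using low False by simp
    qed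
    then show "norm (z - c l j) \<ge> r / 2" "norm (\<alpha> l j - indicator (N l) j) \<le> e" by auto
  qed
  have nz: "z \<noteq> c l j" if "l \<le> k" "j \<in> J" for l j using dist_low[OF that] r by auto
  define G where "G = (\<lambda>l i. elem_sym J (\<alpha> l) i)"
  define u where "u = (\<lambda>l. poly (root_poly J (c l)) z)"
  define v where "v = (\<lambda>i. (1 / of_real r :: complex) ^ i)"
  define detG where "detG = Determinant.det (mat (Suc k) (Suc k) (\<lambda>(l, i). G l i))"
  define C where "C = mat (Suc k) (Suc k) (\<lambda>(l, i). of_nat (card (N l) choose i) :: complex)"
  have taylor: "taylor_coeff (root_poly J (c l)) z i = u l * v i * G l i" if "l \<le> k" for l i
    unfolding G_def \<alpha>_def elem_sym_scale[OF J(1)] u_def v_def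
    using taylor_coeff_eq_elem_sym[OF J(1), of z "c l" i] nz[OF that] r by (simp add: power_divide)
  \<comment> \<open>The common entry bound \<open>(4 * M) ^ k\<close> leaves room for the binomial
    part \<open>M ^ i\<close> and the perturbation \<open>(3 * M) ^ i\<close>; for
    \<open>i = 0\<close> their sum is 2, which is where \<open>k \<ge> 1\<close> enters.\<close>
  have "norm (detG - Determinant.det C) \<le> fact (Suc k) * (((4 * M) ^ k) ^ Suc k * (real (Suc k) * e))"
    unfolding detG_def
  proof (rule norm_det_diff_le)
    show "(4 * M) ^ k > 0" using M by simp
    fix l i assume "l < Suc k" "i < Suc k"
    then have li: "l \<le> k" "i \<le> k" by auto
    have C_eq: "C $$ (l, i) = elem_sym J (indicator (N l)) i"
      using li N(1)[OF li(1)] J by (simp add: C_def elem_sym_indicator)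
    have bounds: "norm (elem_sym J (indicator (N l)) i) \<le> M ^ i"
      "norm (G l i - elem_sym J (indicator (N l)) i) \<le> e * (3 * M) ^ i"
    proof -
      have ind: "indicator (N l) j \<in> {0, 1 :: complex}" for j by (simp add: indicator_def)
      show "norm (elem_sym J (indicator (N l)) i) \<le> M ^ i" unfolding M_def
        by (rule elem_sym_diff_le(1)[OF J(1) ind \<alpha>_close[OF li(1)] less_imp_le[OF e(1)] e(2)])
      show "norm (G l i - elem_sym J (indicator (N l)) i) \<le> e * (3 * M) ^ i" unfolding M_def G_def
        by (rule elem_sym_diff_le(2)[OF J(1) ind \<alpha>_close[OF li(1)] less_imp_le[OF e(1)] e(2)])
    qed
    have pow: "M ^ i \<le> (4 * M) ^ k" "(3 * M) ^ i \<le> (4 * M) ^ k"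
    proof -
      have "(3 * M) ^ i \<le> (4 * M) ^ i" "M ^ i \<le> (4 * M) ^ i" using M by (auto intro!: power_mono)
      moreover have "(4 * M) ^ i \<le> (4 * M) ^ k" using M li by (intro power_increasing) auto
      ultimately show "M ^ i \<le> (4 * M) ^ k" "(3 * M) ^ i \<le> (4 * M) ^ k" by linarith+
    qed
    show "norm (C $$ (l, i)) \<le> (4 * M) ^ k" using C_eq bounds pow by auto
    have e3: "e * (3 * M) ^ i \<le> (4 * M) ^ k * e" using pow(2) e by (simp add: mult.commute)
    then show "norm (mat (Suc k) (Suc k) (\<lambda>(l, i). G l i) $$ (l, i) - C $$ (l, i)) \<le> (4 * M) ^ k * e"
      using C_eq bounds(2) li by simp
    have "norm (G l i) \<le> norm (G l i - elem_sym J (indicator (N l)) i) + norm (elem_sym J (indicator (N l)) i)"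
      using norm_triangle_ineq[of "G l i - elem_sym J (indicator (N l)) i" "elem_sym J (indicator (N l)) i"] by simp
    also have "\<dots> \<le> 1 * (3 * M) ^ i + M ^ i" using bounds e M by (intro add_mono order.trans[OF bounds(2)] mult_right_mono) auto
    also have "\<dots> \<le> (4 * M) ^ k"
    proof (cases "i = 0")
      case True
      show ?thesis
      proof -
        have "(4 * M) ^ 1 \<le> (4 * M) ^ k" using M k by (intro power_increasing) auto
        then show ?thesis using M True by simp
      qed
    next
      case False
      then obtain i' where i': "i = Suc i'" by (cases i) auto
      have "(3 * M) ^ i + M ^ i = 3 * M * (3 * M) ^ i' + M * M ^ i'" by (simp add: i')
      also have "\<dots> \<le> 3 * M * (4 * M) ^ i' + M * (4 * M) ^ i'"
        using M by (intro add_mono mult_left_mono power_mono) auto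
      also have "\<dots> = (4 * M) ^ i" by (simp add: i' algebra_simps)
      also have "\<dots> \<le> (4 * M) ^ k" using M li by (intro power_increasing) auto
      finally show ?thesis by simp
    qed
    finally show "norm (mat (Suc k) (Suc k) (\<lambda>(l, i). G l i) $$ (l, i)) \<le> (4 * M) ^ k" using li by simp
  qed (auto simp: C_def)
  also have "\<dots> \<le> 1 / 2" using small by (simp add: M_def)
  finally have "norm (detG - Determinant.det C) \<le> 1 / 2" .
  moreover have "norm (Determinant.det C) \<ge> 1" unfolding C_def by (rule choose_vandermonde_nonzero[OF N(2)])
  ultimately have detG: "norm detG \<ge> 1 / 2"
    using norm_triangle_ineq2[of "Determinant.det C" detG] by (simp add: norm_minus_commute)
  \<comment> \<open>Each factor of \<open>u l\<close> is a distance of at least \<open>r / 2\<close>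
    from \<open>z\<close> to a root. The column factors treated next are powers of
    \<open>1 / r\<close>, at least 1 because \<open>r \<le> 1\<close>.\<close>
  have "norm (\<Prod>l<Suc k. u l) \<ge> (r / 2) ^ (Suc k * card J)"
  proof -
    have "(r / 2) ^ (Suc k * card J) = ((r / 2) ^ card J) ^ Suc k" by (simp only: power_mult[symmetric] mult.commute)
    also have "\<dots> = (\<Prod>l<Suc k. \<Prod>j\<in>J. r / 2)" by (simp only: prod_constant card_lessThan)
    also have "\<dots> \<le> (\<Prod>l<Suc k. \<Prod>j\<in>J. norm (z - c l j))"
      using r dist_low by (intro prod_mono conjI prod_nonneg) auto
    also have "\<dots> = norm (\<Prod>l<Suc k. u l)" unfolding u_def poly_root_poly prod_norm by (rule refl)
    finally show ?thesis .
  qed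
  moreover have "norm (\<Prod>i<Suc k. v i) \<ge> 1"
  proof -
    have "norm (v i) \<ge> 1" for i using r by (simp add: v_def norm_power norm_divide one_le_power)
    then show ?thesis unfolding prod_norm[symmetric] by (intro prod_ge_1) auto
  qed
  ultimately have "(r / 2) ^ (Suc k * card J) * 1 * (1 / 2) \<le> norm (\<Prod>l<Suc k. u l) * norm (\<Prod>i<Suc k. v i) * norm detG"
    using detG r by (intro mult_mono) auto
  also have "\<dots> = norm (Determinant.det (mat (Suc k) (Suc k) (\<lambda>(l, i). u l * v i * G l i)))"
    unfolding det_scale_rows_cols detG_def norm_mult ..
  also have "mat (Suc k) (Suc k) (\<lambda>(l, i). u l * v i * G l i)
    = mat (Suc k) (Suc k) (\<lambda>(l, i). taylor_coeff (root_poly J (c l)) z i)"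
    using taylor by (intro mat_cong) auto
  finally show ?thesis by (simp add: z_def mult.commute)
qed

text \<open>A set \<open>S\<close> is determined by its traces on the groups, and each trace has one
  of at most \<open>k\<close> sizes, hence at most \<open>k\<close> times the central binomial
  coefficient of possibilities. Compared with \<open>2 ^ (2 * m)\<close> this gains a factor of
  order \<open>1 / sqrt m\<close> per group.\<close>

lemma card_family_le_central_binomial:
  assumes J: "finite J" "J = (\<Union>a<d. Jg a)" and Jg: "\<And>a. a < d \<Longrightarrow> card (Jg a) = 2 * m"
    and T: "T \<subseteq> Pow J" and few: "\<And>a. a < d \<Longrightarrow> card ((\<lambda>S. card (S \<inter> Jg a)) ` T) \<le> k"
  shows "card T \<le> (k * (2 * m choose m)) ^ d"
proof -
  have finT: "finite T" using T J by (meson finite_Pow_iff finite_subset)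
  have finJg: "finite (Jg a)" if "a < d" for a using J that by (metis finite_UN finite_lessThan lessThan_iff)
  define K where "K = (\<lambda>a. (\<lambda>S. card (S \<inter> Jg a)) ` T)"
  define F where "F = (\<lambda>a. \<Union>v\<in>K a. {U. U \<subseteq> Jg a \<and> card U = v})"
  have finF: "finite (F a)" if "a < d" for a
    unfolding F_def K_def using finT finJg[OF that] by auto
  have cardF: "card (F a) \<le> k * (2 * m choose m)" if a: "a < d" for a
  proof -
    have "card (F a) \<le> (\<Sum>v\<in>K a. card {U. U \<subseteq> Jg a \<and> card U = v})"
      unfolding F_def K_def by (intro card_UN_le) (use finT in auto)
    also have "\<dots> = (\<Sum>v\<in>K a. 2 * m choose v)"
      using n_subsets[OF finJg[OF a]] Jg[OF a] by simp
    also have "\<dots> \<le> (\<Sum>v\<in>K a. 2 * m choose m)" by (intro sum_mono binomial_maximum')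
    also have "\<dots> = card (K a) * (2 * m choose m)" by simp
    also have "\<dots> \<le> k * (2 * m choose m)" using few[OF a] by (intro mult_right_mono) (auto simp: K_def)
    finally show ?thesis .
  qed
  define h where "h = (\<lambda>S. \<lambda>a\<in>{..<d}. S \<inter> Jg a)"
  have "inj_on h T"
  proof (rule inj_onI)
    fix S S' assume S: "S \<in> T" "S' \<in> T" "h S = h S'"
    have "S \<inter> Jg a = S' \<inter> Jg a" if "a < d" for a
      using fun_cong[OF S(3), of a] that by (simp add: h_def)
    then show "S = S'" using S(1,2) T unfolding J(2) by blast
  qed
  moreover have "h ` T \<subseteq> (\<Pi>\<^sub>E a\<in>{..<d}. F a)" by (auto simp: h_def F_def K_def)
  ultimately have "card T \<le> card (\<Pi>\<^sub>E a\<in>{..<d}. F a)"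
    by (intro card_inj_on_le[of h]) (auto intro!: finite_PiE finF)
  also have "\<dots> = (\<Prod>a<d. card (F a))" by (subst card_PiE) auto
  also have "\<dots> \<le> (\<Prod>a<d. k * (2 * m choose m))" by (intro prod_mono) (auto simp: cardF)
  finally show ?thesis by simp
qed

text \<open>The deterministic situation for one outcome: \<open>J\<close> holds the indices of the
  free coins, \<open>Jg a\<close> those whose heads position \<open>X j\<close> lies in the disc
  about \<open>w a\<close>; every tails position \<open>Y j\<close> keeps distance \<open>R1\<close>
  from all centres. \<open>R0\<close> bounds the roots carried by free coins and \<open>R\<close>
  the window for \<open>b\<close>. The assumptions on \<open>e\<close>, \<open>r\<close>,
  \<open>\<rho>\<close>, \<open>R1\<close> and \<open>small\<close> are those of
  \<open>wronskian_lower_bound\<close>.\<close>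

locale coin_config =
  fixes J :: "'j set" and Jg :: "nat \<Rightarrow> 'j set" and X Y :: "'j \<Rightarrow> complex" and w :: "nat \<Rightarrow> complex"
    and d m k :: nat and \<rho> R1 R0 r R e :: real
  assumes J: "finite J" "J \<noteq> {}" "J = (\<Union>a<d. Jg a)" and disj: "disjoint_family_on Jg {..<d}"
    and Jg: "\<And>a. a < d \<Longrightarrow> card (Jg a) = 2 * m" and k: "k \<ge> 1"
    and X_near: "\<And>a j. a < d \<Longrightarrow> j \<in> Jg a \<Longrightarrow> norm (X j - w a) \<le> \<rho>"
    and X_far: "\<And>a a' j. a < d \<Longrightarrow> a' < d \<Longrightarrow> a \<noteq> a' \<Longrightarrow> j \<in> Jg a' \<Longrightarrow> norm (X j - w a) \<ge> R1"
    and Y_far: "\<And>a j. a < d \<Longrightarrow> j \<in> J \<Longrightarrow> norm (Y j - w a) \<ge> R1"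
    and XY_bound: "\<And>j. j \<in> J \<Longrightarrow> norm (X j) \<le> R0" "\<And>j. j \<in> J \<Longrightarrow> norm (Y j) \<le> R0"
    and w_bound: "\<And>a. a < d \<Longrightarrow> norm (w a) + r \<le> R"
    and e: "0 < e" "e \<le> 1" and r: "0 < r" "r \<le> 1" and \<rho>: "\<rho> \<le> r * e / 2" and R1: "r \<le> R1 * e / 2"
    and R0: "R0 \<ge> 0" and R: "R > 0"
    and small: "fact (Suc k) * (((4 * real (card J)) ^ k) ^ Suc k * (real (Suc k) * e)) \<le> 1 / 2"
begin

definition coin :: "'j set \<Rightarrow> 'j \<Rightarrow> complex" where
  "coin S j = (if j \<in> S then X j else Y j)"

abbreviation pat :: "'j set \<Rightarrow> complex poly" where
  "pat S \<equiv> root_poly J (coin S)"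

definition wronskian :: "(nat \<Rightarrow> 'j set) \<Rightarrow> complex poly" where
  "wronskian Ss = Determinant.det (mat (Suc k) (Suc k)
     (\<lambda>(l, i). Polynomial.smult (1 / fact i) ((pderiv ^^ i) (pat (Ss l)))))"

text \<open>Distinct root counts in one disc are what makes the Wronskian bounded below near that
  disc. The functions are extensional, which makes the set finite.\<close>

definition tuples :: "(nat \<Rightarrow> 'j set) set" where
  "tuples = {Ss \<in> {..k} \<rightarrow>\<^sub>E Pow J. \<exists>a<d. inj_on (\<lambda>l. card (Ss l \<inter> Jg a)) {..k}}"

text \<open>The first factor is the lower bound of \<open>wronskian_lower_bound\<close> at the point
  \<open>w a + r\<close>; the second is the loss in \<open>emeasure_sublevel_poly\<close> for degree
  \<open>Suc k * card J\<close> and discs of radius \<open>h\<close> about the zeros.\<close>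

definition threshold :: "real \<Rightarrow> real" where
  "threshold h = ((1 / 2) * (r / 2) ^ (Suc k * card J)) * (h / (3 * R)) ^ (Suc k * card J)"

definition exceptional :: "real \<Rightarrow> complex set" where
  "exceptional h = (\<Union>Ss\<in>tuples. {b \<in> cball 0 R. norm (poly (wronskian Ss) b) < threshold h})"

lemma poly_wronskian:
  "poly (wronskian Ss) b = Determinant.det (mat (Suc k) (Suc k) (\<lambda>(l, i). taylor_coeff (pat (Ss l)) b i))"
proof -
  have "poly (signof p) b = signof p" for p :: "nat \<Rightarrow> nat" by (simp add: sign_def)
  then show ?thesis
    unfolding wronskian_def
    by (subst (1 2) det_def'[of _ "Suc k"])
       (auto simp: poly_sum poly_prod poly_funpow_pderiv_eq_taylor_coeff permutes_in_image
         intro!: sum.cong prod.cong)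
qed

lemma degree_wronskian: "degree (wronskian Ss) \<le> Suc k * card J"
proof -
  have entry: "degree (Polynomial.smult (1 / fact i) ((pderiv ^^ i) (pat S))) \<le> card J" for S i
    using degree_root_poly[of J "coin S"] by (simp add: degree_funpow_pderiv)
  show ?thesis
    unfolding wronskian_def
  proof (subst det_def'[of _ "Suc k"], simp, intro degree_sum_le)
    fix p assume p: "p \<in> {p. p permutes {0..<Suc k}}"
    define E where "E = mat (Suc k) (Suc k) (\<lambda>(l, i). Polynomial.smult (1 / fact i) ((pderiv ^^ i) (pat (Ss l))))"
    have "degree (signof p * (\<Prod>i = 0..<Suc k. E $$ (i, p i))) \<le> degree (\<Prod>i = 0..<Suc k. E $$ (i, p i))"
      by (simp add: sign_def)
    also have "\<dots> \<le> sum (degree \<circ> (\<lambda>i. E $$ (i, p i))) {0..<Suc k}"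
      by (intro degree_prod_sum_le) auto
    also have "\<dots> \<le> (\<Sum>i = 0..<Suc k. card J)"
    proof (rule sum_mono)
      fix i assume "i \<in> {0..<Suc k}"
      then have "i < Suc k" "p i < Suc k" using p permutes_in_image[of p "{0..<Suc k}" i] by auto
      then show "(degree \<circ> (\<lambda>i. E $$ (i, p i))) i \<le> card J" using entry by (simp add: E_def)
    qed
    finally show "degree (signof p * (\<Prod>i = 0..<Suc k. E $$ (i, p i))) \<le> Suc k * card J" by simp
  qed (auto simp: finite_permutations)
qed

lemma finite_Jg: "a < d \<Longrightarrow> finite (Jg a)" and Jg_subset: "a < d \<Longrightarrow> Jg a \<subseteq> J"
  using J by (auto intro: finite_subset)

text \<open>Union bound over at most \<open>2 ^ (card J * Suc k)\<close> tuples. As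
  \<open>card J = 2 * m * d\<close>, a radius \<open>h\<close> decaying like
  \<open>exp (- c * m ^ 2)\<close> beats this number.\<close>

lemma emeasure_exceptional:
  assumes h: "0 < h" "h \<le> R"
  shows "emeasure lborel (exceptional h)
    \<le> ennreal (2 ^ (card J * Suc k) * (real (Suc k * card J) * (pi * h\<^sup>2)))"
    and "exceptional h \<in> sets borel"
proof -
  have "finite ({..k} \<rightarrow>\<^sub>E Pow J)" using J by (intro finite_PiE) auto
  then have fin: "finite tuples" by (simp add: tuples_def)
  have "card tuples \<le> card ({..k} \<rightarrow>\<^sub>E Pow J)"
    using \<open>finite ({..k} \<rightarrow>\<^sub>E Pow J)\<close> by (intro card_mono) (auto simp: tuples_def)
  also have "\<dots> = 2 ^ (card J * Suc k)" by (simp only: card_PiE[OF finite_atMost] card_Pow[OF J(1)] prod_constant card_atMost power_mult)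
  finally have card: "card tuples \<le> 2 ^ (card J * Suc k)" .
  have cont: "continuous_on UNIV (\<lambda>b. norm (poly Q b))" for Q :: "complex poly" by (intro continuous_intros)
  have meas: "{b \<in> cball 0 R. norm (poly Q b) < t} \<in> sets borel" for Q :: "complex poly" and t
  proof -
    have [measurable]: "(\<lambda>b. norm (poly Q b)) \<in> borel_measurable borel" by (rule borel_measurable_continuous_onI[OF cont])
    have "{b \<in> cball 0 R. norm (poly Q b) < t} = cball 0 R \<inter> {b \<in> space borel. norm (poly Q b) < t}" by auto
    also have "\<dots> \<in> sets borel" by (intro sets.Int) auto
    finally show ?thesis .
  qed
  show "exceptional h \<in> sets borel" unfolding exceptional_def by (intro sets.finite_UN fin meas)
  have each: "emeasure lborel {b \<in> cball 0 R. norm (poly (wronskian Ss) b) < threshold h}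
    \<le> ennreal (real (Suc k * card J) * (pi * h\<^sup>2))" if Ss: "Ss \<in> tuples" for Ss
  proof -
    obtain a where a: "a < d" "inj_on (\<lambda>l. card (Ss l \<inter> Jg a)) {..k}" using Ss by (auto simp: tuples_def)
    have sub: "Ss l \<subseteq> J" if "l \<le> k" for l using Ss that by (auto simp: tuples_def PiE_iff)
    have "norm (poly (wronskian Ss) (w a + of_real r)) \<ge> (1 / 2) * (r / 2) ^ (Suc k * card J)"
      unfolding poly_wronskian
    proof (rule wronskian_lower_bound[where N = "\<lambda>l. Ss l \<inter> Jg a" and \<rho> = \<rho> and ?R1.0 = R1 and e = e])
      show "norm (coin (Ss l) j - w a) \<ge> R1" if lj: "l \<le> k" "j \<in> J - Ss l \<inter> Jg a" for l j
      proof (cases "j \<in> Ss l")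
        case True
        then have "j \<notin> Jg a" using lj by auto
        then obtain a' where "a' < d" "j \<in> Jg a'" "a' \<noteq> a" using lj J(3) by auto
        then show ?thesis using True X_far[OF a(1)] by (auto simp: coin_def)
      next
        case False
        then show ?thesis using lj Y_far[OF a(1)] by (auto simp: coin_def)
      qed
      show "norm (coin (Ss l) j - w a) \<le> \<rho>" if "l \<le> k" "j \<in> Ss l \<inter> Jg a" for l j
        using that X_near[OF a(1)] by (auto simp: coin_def)
    qed (use J k a sub e r \<rho> R1 small in auto)
    moreover have "norm (w a + of_real r) \<le> R"
      using w_bound[OF a(1)] norm_triangle_ineq[of "w a" "of_real r"] r by simp
    ultimately show ?thesis
      unfolding threshold_def using h r by (intro emeasure_sublevel_poly degree_wronskian) auto
  qed
  have "emeasure lborel (exceptional h)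
    \<le> (\<Sum>Ss\<in>tuples. emeasure lborel {b \<in> cball 0 R. norm (poly (wronskian Ss) b) < threshold h})"
    unfolding exceptional_def using fin meas by (intro emeasure_subadditive_finite) auto
  also have "\<dots> \<le> (\<Sum>Ss\<in>tuples. ennreal (real (Suc k * card J) * (pi * h\<^sup>2)))" by (intro sum_mono each)
  also have "\<dots> = of_nat (card tuples) * ennreal (real (Suc k * card J) * (pi * h\<^sup>2))" by simp
  also have "\<dots> \<le> of_nat (2 ^ (card J * Suc k)) * ennreal (real (Suc k * card J) * (pi * h\<^sup>2))"
    using card by (intro mult_right_mono of_nat_mono) auto
  also have "\<dots> = ennreal (2 ^ (card J * Suc k) * (real (Suc k * card J) * (pi * h\<^sup>2)))"
    by (simp only: ennreal_of_nat_eq_real_of_nat of_nat_power of_nat_numeral) (subst ennreal_mult, auto)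
  finally show "emeasure lborel (exceptional h)
    \<le> ennreal (2 ^ (card J * Suc k) * (real (Suc k * card J) * (pi * h\<^sup>2)))" .
qed

text \<open>If the bad patterns showed \<open>k + 1\<close> different counts in one group, the tuple
  formed by them would lie in \<open>tuples\<close>, while Cramer's rule makes its Wronskian smaller
  than \<open>threshold h\<close> at \<open>b\<close>, against
  \<open>b \<notin> exceptional h\<close>. So each group sees at most \<open>k\<close> counts and
  \<open>card_family_le_central_binomial\<close> applies.\<close>

lemma card_bad_patterns:
  assumes b: "norm b \<le> R" "b \<notin> exceptional h" and F: "poly F b \<noteq> 0" and \<delta>: "\<delta> \<ge> 0"
    and thr: "fact (Suc k) * ((1 + R + R0) ^ card J) ^ Suc k * \<delta> < threshold h"
  shows "card {S \<in> Pow J. norm (taylor_coeff (pat S * F) b k) \<le> \<delta> * norm (poly (pat S * F) b)}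
    \<le> (k * (2 * m choose m)) ^ d" (is "card ?T \<le> _")
proof -
  define T where "T = {S \<in> Pow J. norm (taylor_coeff (pat S * F) b k) \<le> \<delta> * norm (poly (pat S * F) b)}"
  have "card T \<le> (k * (2 * m choose m)) ^ d"
  proof (rule card_family_le_central_binomial[OF J(1,3) Jg])
    show "T \<subseteq> Pow J" by (auto simp: T_def)
    fix a assume a: "a < d"
    show "card ((\<lambda>S. card (S \<inter> Jg a)) ` T) \<le> k"
    proof (rule ccontr)
      assume "\<not> ?thesis"
      then have "Suc k \<le> card ((\<lambda>S. card (S \<inter> Jg a)) ` T)" by simp
      then obtain K where K: "K \<subseteq> (\<lambda>S. card (S \<inter> Jg a)) ` T" "card K = Suc k" "finite K"
        by (rule obtain_subset_with_card_n)
      obtain f where f: "bij_betw f {..k} K"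
        using K by (metis card_atMost finite_atMost finite_same_card_bij)
      have "\<forall>l\<in>{..k}. \<exists>S. S \<in> T \<and> card (S \<inter> Jg a) = f l"
      proof
        fix l assume "l \<in> {..k}"
        then have "f l \<in> K" using f by (auto simp: bij_betw_def)
        then have "f l \<in> (\<lambda>S. card (S \<inter> Jg a)) ` T" using K(1) by blast
        then obtain S where "f l = card (S \<inter> Jg a)" "S \<in> T" by (rule imageE)
        then show "\<exists>S. S \<in> T \<and> card (S \<inter> Jg a) = f l" by (intro exI[of _ S] conjI) simp_all
      qed
      from bchoice[OF this] obtain Ss' where Ss'_all: "\<forall>l\<in>{..k}. Ss' l \<in> T \<and> card (Ss' l \<inter> Jg a) = f l" ..
      then have Ss': "Ss' l \<in> T" "card (Ss' l \<inter> Jg a) = f l" if "l \<le> k" for l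
        using that by (meson atMost_iff)+
      \<comment> \<open>Restriction makes the choice function extensional, as membership in
        \<open>tuples\<close> requires.\<close>
      define Ss where "Ss = restrict Ss' {..k}"
      have Ss: "Ss l \<in> T" "card (Ss l \<inter> Jg a) = f l" if "l \<le> k" for l using Ss' that by (auto simp: Ss_def)
      have "inj_on (\<lambda>l. card (Ss l \<inter> Jg a)) {..k}"
        using f Ss(2) by (auto simp: bij_betw_def inj_on_def)
      then have tup: "Ss \<in> tuples" using Ss(1) a by (auto simp: tuples_def T_def Ss_def)
      define V where "V = (1 + R + R0) ^ card J"
      have V: "norm (taylor_coeff (pat S) b i) \<le> V" for S i
      proof -
        have "norm (taylor_coeff (pat S) b i) \<le> (\<Prod>j\<in>J. 1 + norm (b - coin S j))"
          by (rule norm_taylor_coeff_root_poly_le[OF J(1)])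
        also have "\<dots> \<le> (\<Prod>j\<in>J. 1 + R + R0)"
        proof (intro prod_mono conjI)
          fix j assume j: "j \<in> J"
          have "norm (coin S j) \<le> R0" using XY_bound j by (auto simp: coin_def)
          then show "1 + norm (b - coin S j) \<le> 1 + R + R0"
            using b(1) norm_triangle_ineq4[of b "coin S j"] by linarith
        qed auto
        finally show ?thesis by (simp add: V_def)
      qed
      \<comment> \<open>Dividing by \<open>poly F b\<close> normalises the entry at
        \<open>i = k\<close> to 1 and removes every dependence on the size of
        \<open>F\<close>.\<close>
      define g where "g = (\<lambda>i. taylor_coeff F b (k - i) / poly F b)"
      have "norm (poly (wronskian Ss) b) \<le> fact (Suc k) * V ^ k * (\<delta> * V)"
        unfolding poly_wronskian
      proof (rule norm_det_le_of_small_image)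
        show "g k = 1" using F by (simp add: g_def taylor_coeff_0)
        fix l assume l: "l \<le> k"
        have "(\<Sum>i\<le>k. taylor_coeff (pat (Ss l)) b i * g i) = taylor_coeff (pat (Ss l) * F) b k / poly F b"
          by (simp add: g_def taylor_coeff_mult sum_divide_distrib)
        then have "norm (\<Sum>i\<le>k. taylor_coeff (pat (Ss l)) b i * g i)
          = norm (taylor_coeff (pat (Ss l) * F) b k) / norm (poly F b)" by (simp add: norm_divide)
        also have "\<dots> \<le> (\<delta> * norm (poly (pat (Ss l) * F) b)) / norm (poly F b)"
          using Ss(1)[OF l] by (intro divide_right_mono) (auto simp: T_def)
        also have "\<dots> = \<delta> * norm (taylor_coeff (pat (Ss l)) b 0)" using F by (simp add: norm_mult taylor_coeff_0)
        also have "\<dots> \<le> \<delta> * V" using V \<delta> by (intro mult_left_mono) auto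
        finally show "norm (\<Sum>i\<le>k. taylor_coeff (pat (Ss l)) b i * g i) \<le> \<delta> * V" .
      qed (rule V)
      also have "\<dots> < threshold h" using thr by (simp add: V_def mult_ac)
      finally have "b \<in> exceptional h" using tup b(1) by (auto simp: exceptional_def)
      with b(2) show False by simp
    qed
  qed
  then show ?thesis by (simp only: T_def)
qed

end

section \<open>Counting bad patterns\<close>

text \<open>Badness at the point \<open>b\<close>. Since a nonzero value at \<open>b\<close> is part
  of the event, its negation gives a lower bound only at points that are not roots; this suffices,
  as the roots form a null set.\<close>

definition small_at :: "nat \<Rightarrow> real \<Rightarrow> 'j set \<Rightarrow> ('j \<Rightarrow> complex) \<Rightarrow> complex \<Rightarrow> bool" where
  "small_at k \<delta> I c b \<longleftrightarrow> poly (root_poly I c) b \<noteq> 0 \<and>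
     norm (taylor_coeff (root_poly I c) b k) \<le> \<delta> * norm (poly (root_poly I c) b)"

lemma root_poly_cong: "(\<And>j. j \<in> I \<Longrightarrow> c j = c' j) \<Longrightarrow> root_poly I c = root_poly I c'"
  unfolding root_poly_def by (intro prod.cong) auto

lemma small_at_cong:
  assumes "\<And>j. j \<in> I \<Longrightarrow> c j = c' j"
  shows "small_at k \<delta> I c b = small_at k \<delta> I c' b"
proof -
  have "root_poly I c = root_poly I c'" using assms by (intro root_poly_cong) auto
  then show ?thesis by (simp add: small_at_def)
qed

section \<open>Measurability of the bad event and the count of bad patterns\<close>

lemma borel_measurable_coeff_prod_linear:
  fixes f :: "'j \<Rightarrow> 'x \<Rightarrow> complex"
  assumes "finite I" "\<And>j. j \<in> I \<Longrightarrow> f j \<in> borel_measurable M"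
  shows "(\<lambda>x. coeff (\<Prod>j\<in>I. [:f j x, 1:]) i) \<in> borel_measurable M"
  using assms
proof (induction I arbitrary: i rule: finite_induct)
  case (insert j I)
  have IH [measurable]: "(\<lambda>x. coeff (\<Prod>j\<in>I. [:f j x, 1:]) i) \<in> borel_measurable M" for i
    using insert.IH insert.prems by auto
  have [measurable]: "f j \<in> borel_measurable M" using insert.prems by auto
  show ?case
    unfolding prod.insert[OF insert.hyps] by (cases i) (simp_all add: coeff_linear_mult)
qed simp

text \<open>Roots and point may both depend on \<open>x\<close>: this covers fixed roots with a
  moving point as well as the joint measurability behind areas that depend on the sample.\<close>

lemma pred_small_at:
  assumes I: "finite I" and c: "\<And>j. j \<in> I \<Longrightarrow> (\<lambda>x. c x j) \<in> borel_measurable M"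
    and b: "b \<in> borel_measurable M"
  shows "Measurable.pred M (\<lambda>x. small_at k \<delta> I (c x) (b x))"
proof -
  have 1 [measurable]: "(\<lambda>x. taylor_coeff (root_poly I (c x)) (b x) k) \<in> borel_measurable M"
    unfolding taylor_coeff_root_poly
    by (intro borel_measurable_coeff_prod_linear I borel_measurable_diff b c)
  have 2 [measurable]: "(\<lambda>x. poly (root_poly I (c x)) (b x)) \<in> borel_measurable M"
    unfolding poly_root_poly by (intro borel_measurable_prod borel_measurable_diff b c)
  show ?thesis unfolding small_at_def by measurable
qed

lemma (in coin_config) card_small_patterns:
  assumes I: "finite I" "J \<subseteq> I"
    and b: "norm b \<le> R" "b \<notin> exceptional h" and \<delta>: "\<delta> \<ge> 0"
    and thr: "fact (Suc k) * ((1 + R + R0) ^ card J) ^ Suc k * \<delta> < threshold h"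
  shows "card {S \<in> Pow I. small_at k \<delta> I (coin S) b} \<le> 2 ^ card (I - J) * (k * (2 * m choose m)) ^ d"
proof -
  define P where "P = (\<lambda>S. small_at k \<delta> I (coin S) b)"
  have finJ: "finite (Pow J)" using J(1) by simp
  have each: "card {S1 \<in> Pow J. P (S1 \<union> S2)} \<le> (k * (2 * m choose m)) ^ d" if S2: "S2 \<in> Pow (I - J)" for S2
  proof -
    define F where "F = root_poly (I - J) (coin S2)"
    have split: "root_poly I (coin (S1 \<union> S2)) = pat S1 * F" if "S1 \<in> Pow J" for S1
    proof -
      have "root_poly I (coin (S1 \<union> S2)) = root_poly (I - J) (coin (S1 \<union> S2)) * root_poly J (coin (S1 \<union> S2))"
        unfolding root_poly_def using I by (intro prod.subset_diff) auto
      also have "root_poly (I - J) (coin (S1 \<union> S2)) = F"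
        unfolding F_def using that by (intro root_poly_cong) (auto simp: coin_def)
      also have "root_poly J (coin (S1 \<union> S2)) = pat S1"
        using S2 by (intro root_poly_cong) (auto simp: coin_def)
      finally show ?thesis by (simp add: mult.commute)
    qed
    show ?thesis
    proof (cases "poly F b = 0")
      case True
      have "\<not> P (S1 \<union> S2)" if "S1 \<in> Pow J" for S1
        unfolding P_def small_at_def split[OF that] using True by simp
      then have empty: "{S1 \<in> Pow J. P (S1 \<union> S2)} = {}" by blast
      show ?thesis unfolding empty by simp
    next
      case False
      have "{S1 \<in> Pow J. P (S1 \<union> S2)}
        \<subseteq> {S \<in> Pow J. norm (taylor_coeff (pat S * F) b k) \<le> \<delta> * norm (poly (pat S * F) b)}"
      proof
        fix S1 assume "S1 \<in> {S1 \<in> Pow J. P (S1 \<union> S2)}"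
        then have "S1 \<in> Pow J" "P (S1 \<union> S2)" by auto
        then show "S1 \<in> {S \<in> Pow J. norm (taylor_coeff (pat S * F) b k) \<le> \<delta> * norm (poly (pat S * F) b)}"
          unfolding P_def small_at_def split[OF \<open>S1 \<in> Pow J\<close>] by simp
      qed
      then have "card {S1 \<in> Pow J. P (S1 \<union> S2)}
        \<le> card {S \<in> Pow J. norm (taylor_coeff (pat S * F) b k) \<le> \<delta> * norm (poly (pat S * F) b)}"
        using finJ by (intro card_mono) auto
      also have "\<dots> \<le> (k * (2 * m choose m)) ^ d" by (rule card_bad_patterns[OF b False \<delta> thr])
      finally show ?thesis .
    qed
  qed
  have "{S \<in> Pow I. P S} \<subseteq> (\<Union>S2\<in>Pow (I - J). (\<lambda>S1. S1 \<union> S2) ` {S1 \<in> Pow J. P (S1 \<union> S2)})"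
  proof
    fix S assume S: "S \<in> {S \<in> Pow I. P S}"
    have "S = (S \<inter> J) \<union> (S - J)" by auto
    then have "S \<in> (\<lambda>S1. S1 \<union> (S - J)) ` {S1 \<in> Pow J. P (S1 \<union> (S - J))}"
      using S by (intro image_eqI[of _ _ "S \<inter> J"]) auto
    moreover have "S - J \<in> Pow (I - J)" using S by auto
    ultimately show "S \<in> (\<Union>S2\<in>Pow (I - J). (\<lambda>S1. S1 \<union> S2) ` {S1 \<in> Pow J. P (S1 \<union> S2)})" by blast
  qed
  then have "card {S \<in> Pow I. P S} \<le> card (\<Union>S2\<in>Pow (I - J). (\<lambda>S1. S1 \<union> S2) ` {S1 \<in> Pow J. P (S1 \<union> S2)})"
    using I finJ by (intro card_mono) auto
  also have "\<dots> \<le> (\<Sum>S2\<in>Pow (I - J). card ((\<lambda>S1. S1 \<union> S2) ` {S1 \<in> Pow J. P (S1 \<union> S2)}))"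
    using I by (intro card_UN_le) auto
  also have "\<dots> \<le> (\<Sum>S2\<in>Pow (I - J). (k * (2 * m choose m)) ^ d)"
    using finJ by (intro sum_mono order.trans[OF card_image_le each]) auto
  also have "\<dots> = 2 ^ card (I - J) * (k * (2 * m choose m)) ^ d"
    using I by (simp add: card_Pow)
  finally show ?thesis by (simp add: P_def)
qed

text \<open>The sequence \<open>u m\<close> is nonincreasing from \<open>u 0 = 1\<close>, since its
  successive ratio \<open>t\<close> is at most 1 by the inequality of arithmetic and geometric
  means.\<close>

lemma central_binomial_upper_bound:
  assumes "m > 0"
  shows "real (2 * m choose m) / 4 ^ m \<le> 1 / sqrt m"
proof -
  define u where "u = (\<lambda>m. (real (2 * m choose m))\<^sup>2 * (2 * m + 1) / 16 ^ m)"
  have u: "u m \<le> 1" for m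
  proof (induction m)
    case (Suc m)
    have central: "real (2 * i choose i) = fact (2 * i) / (fact i * fact i)" for i
      using binomial_fact[of i "2 * i", where 'a = real] by (simp add: mult_2)
    have "(fact (2 * Suc m) :: real) = (2 * real m + 2) * (2 * real m + 1) * fact (2 * m)"
      by (simp add: algebra_simps)
    then have 3: "real (2 * Suc m choose Suc m) = 2 * (2 * m + 1) / (m + 1) * real (2 * m choose m)"
      unfolding central by (simp add: divide_simps) (simp add: algebra_simps)
    define t where "t = (2 * real m + 1) * (2 * real m + 3) / (2 * real m + 2)\<^sup>2"
    have "u (Suc m) = u m * t"
    proof -
      have "0 < 4 + (real m * 8 + real m * (real m * 4))" by (intro add_pos_nonneg) auto
      then have pos: "4 + (real m * 8 + real m * (real m * 4)) \<noteq> 0" by linarith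
      show ?thesis
        unfolding u_def 3 t_def by (simp add: divide_simps power2_eq_square) (use pos in \<open>simp add: algebra_simps\<close>)
    qed
    also have "\<dots> \<le> 1 * 1"
    proof (rule mult_mono)
      have "(2 * real m + 1) * (2 * real m + 3) \<le> (2 * real m + 2)\<^sup>2"
        by (simp add: power2_eq_square algebra_simps)
      then show "t \<le> 1" unfolding t_def by (subst divide_le_eq_1_pos) (auto intro!: zero_less_power)
    qed (use Suc in \<open>auto simp: t_def\<close>)
    finally show ?case by simp
  qed (simp add: u_def)
  have "(real (2 * m choose m) / 4 ^ m)\<^sup>2 * m \<le> u m"
  proof -
    have "(4 ^ m)\<^sup>2 = (16 :: real) ^ m" by (simp add: power2_eq_square flip: power_mult_distrib)
    then have "(real (2 * m choose m) / 4 ^ m)\<^sup>2 * m = (real (2 * m choose m))\<^sup>2 * m / 16 ^ m"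
      by (simp add: power_divide)
    also have "\<dots> \<le> u m" unfolding u_def by (intro divide_right_mono mult_left_mono) auto
    finally show ?thesis .
  qed
  also have "\<dots> \<le> 1" by (rule u)
  finally have "(real (2 * m choose m) / 4 ^ m)\<^sup>2 \<le> (1 / sqrt m)\<^sup>2"
    using assms by (simp add: field_simps)
  then show ?thesis by (rule power2_le_imp_le) simp
qed

text \<open>Pigeonhole on a grid of mesh \<open>\<rho> / 2\<close>. What matters is that the loss is
  polynomial in \<open>\<rho>\<close>, so that eligible coins remain frequent when the discs shrink
  with \<open>n\<close>.\<close>

lemma exists_small_set_of_large_measure:
  fixes \<mu> :: "complex measure"
  assumes "finite_measure \<mu>" and sets: "sets \<mu> = sets borel" and \<rho>: "0 < \<rho>" "\<rho> \<le> 1"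
    and S: "S \<in> sets borel" "S \<subseteq> ball s 1"
  obtains A where "A \<in> sets borel" "A \<subseteq> S" "\<And>x y. x \<in> A \<Longrightarrow> y \<in> A \<Longrightarrow> norm (x - y) \<le> \<rho>"
    "measure \<mu> A \<ge> measure \<mu> S * \<rho>\<^sup>2 / 100"
proof -
  interpret finite_measure \<mu> by fact
  define g where "g = \<rho> / 2"
  have g: "0 < g" "g \<le> 1 / 2" using \<rho> by (auto simp: g_def)
  define cell where "cell = (\<lambda>z. (\<lfloor>Re (z - s) / g\<rfloor>, \<lfloor>Im (z - s) / g\<rfloor>))"
  define L where "L = \<lceil>1 / g\<rceil>"
  define C where "C = {-L..L} \<times> {-L..L}"
  have finC: "finite C" by (simp add: C_def)
  have L: "real_of_int L \<ge> 1 / g" "real_of_int L \<le> 1 / g + 1" "L > 0"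
    using g by (auto simp: L_def intro: order.trans[OF of_int_ceiling_le_add_one]) 
  \<comment> \<open>At most \<open>5 / g\<close> cells in each direction, and
    \<open>(5 / g) ^ 2 = 100 / \<rho> ^ 2\<close>; this is the 100 of the statement.\<close>
  have cardC: "real (card C) \<le> 100 / \<rho>\<^sup>2"
  proof -
    have "real (card {-L..L}) = 2 * real_of_int L + 1" using L(3) by simp
    also have "\<dots> \<le> 2 / g + 3" using L(2) by simp
    also have "\<dots> \<le> 5 / g" using g by (simp add: field_simps)
    finally have "real (card {-L..L}) * real (card {-L..L}) \<le> (5 / g) * (5 / g)"
      using g by (intro mult_mono) auto
    also have "\<dots> = 100 / \<rho>\<^sup>2" using \<rho> by (simp add: g_def power2_eq_square)
    finally show ?thesis by (simp add: C_def card_cartesian_product)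
  qed
  have cellC: "cell z \<in> C" if "z \<in> S" for z
  proof -
    have "norm (z - s) < 1" using that S by (auto simp: dist_norm norm_minus_commute)
    then have "\<bar>Re (z - s)\<bar> \<le> 1" "\<bar>Im (z - s)\<bar> \<le> 1"
      using abs_Re_le_cmod[of "z - s"] abs_Im_le_cmod[of "z - s"] by linarith+
    moreover have "\<lfloor>x / g\<rfloor> \<in> {-L..L}" if "\<bar>x\<bar> \<le> 1" for x
    proof -
      have "x / g \<le> 1 / g" "- (1 / g) \<le> x / g" using that g by (auto simp: field_simps)
      then have "x / g \<le> real_of_int L" "- real_of_int L \<le> x / g" using L by linarith+
      then show ?thesis by (auto simp: le_floor_iff floor_le_iff)
    qed
    ultimately show ?thesis by (simp add: cell_def C_def)
  qed
  define A where "A = (\<lambda>c. S \<inter> {z. cell z = c})"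
  have A_sets: "A c \<in> sets borel" for c
  proof -
    have "{z. cell z = c} = {z \<in> space borel. \<lfloor>Re (z - s) / g\<rfloor> = fst c \<and> \<lfloor>Im (z - s) / g\<rfloor> = snd c}"
      by (auto simp: cell_def prod_eq_iff)
    also have "\<dots> \<in> sets borel" by measurable
    finally show ?thesis using S by (auto simp: A_def)
  qed
  have S_eq: "S = (\<Union>c\<in>C. A c)" using cellC by (auto simp: A_def)
  have "measure \<mu> (\<Union>c\<in>C. A c) \<le> (\<Sum>c\<in>C. measure \<mu> (A c))"
    using A_sets sets by (intro finite_measure_subadditive_finite finC) auto
  then have "measure \<mu> S \<le> (\<Sum>c\<in>C. measure \<mu> (A c))" by (simp only: S_eq[symmetric])
  have "\<exists>c\<in>C. measure \<mu> (A c) \<ge> measure \<mu> S * \<rho>\<^sup>2 / 100"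
  proof (rule ccontr)
    assume "\<not> ?thesis"
    then have lt: "measure \<mu> (A c) < measure \<mu> S * \<rho>\<^sup>2 / 100" if "c \<in> C" for c using that by (meson not_le)
    have "C \<noteq> {}" using L(3) by (auto simp: C_def)
    then have "(\<Sum>c\<in>C. measure \<mu> (A c)) < (\<Sum>c\<in>C. measure \<mu> S * \<rho>\<^sup>2 / 100)"
      by (intro sum_strict_mono finC lt)
    also have "\<dots> = real (card C) * (measure \<mu> S * \<rho>\<^sup>2 / 100)" by simp
    also have "\<dots> \<le> (100 / \<rho>\<^sup>2) * (measure \<mu> S * \<rho>\<^sup>2 / 100)"
      by (intro mult_right_mono cardC) auto
    also have "\<dots> = measure \<mu> S" using \<rho> by simp
    finally show False using \<open>measure \<mu> S \<le> (\<Sum>c\<in>C. measure \<mu> (A c))\<close> by simp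
  qed
  then obtain c where c: "measure \<mu> (A c) \<ge> measure \<mu> S * \<rho>\<^sup>2 / 100" by auto
  show ?thesis
  proof (rule that[of "A c"])
    fix x y assume "x \<in> A c" "y \<in> A c"
    then have eq: "\<lfloor>Re (x - s) / g\<rfloor> = \<lfloor>Re (y - s) / g\<rfloor>" "\<lfloor>Im (x - s) / g\<rfloor> = \<lfloor>Im (y - s) / g\<rfloor>"
      by (auto simp: A_def cell_def)
    have fl: "\<bar>u - v\<bar> \<le> g" if "\<lfloor>u / g\<rfloor> = \<lfloor>v / g\<rfloor>" for u v
    proof -
      have "\<bar>u / g - v / g\<bar> \<le> 1" using that by linarith
      then show ?thesis using g by (simp add: abs_le_iff field_simps)
    qed
    have "norm (x - y) \<le> \<bar>Re (x - y)\<bar> + \<bar>Im (x - y)\<bar>" by (rule cmod_le)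
    also have "\<dots> \<le> g + g" using fl[OF eq(1)] fl[OF eq(2)] by simp
    finally show "norm (x - y) \<le> \<rho>" by (simp add: g_def)
  qed (use A_sets c in \<open>auto simp: A_def\<close>)
qed

text \<open>\<open>T\<close> is the support of \<open>\<mu>\<close>, which carries full mass by
  Lindelof's property. If it is infinite, \<open>d + 1\<close> of its points serve as centres:
  \<open>d\<close> balls will host the heads positions and the last one the tails positions.\<close>

lemma finite_support_or_separated_balls:
  fixes \<mu> :: "complex measure"
  assumes "prob_space \<mu>" and sets: "sets \<mu> = sets borel"
  shows "(\<exists>F. finite F \<and> (AE z in \<mu>. z \<in> F)) \<or>
    (\<forall>d. \<exists>s r. 0 < r \<and> r \<le> 1 \<and> (\<forall>a\<le>(d::nat). measure \<mu> (ball (s a) r) > 0) \<and>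
      (\<forall>a\<le>d. \<forall>a'\<le>d. a \<noteq> a' \<longrightarrow> (\<forall>x\<in>ball (s a) r. \<forall>y\<in>ball (s a') r. norm (x - y) \<ge> r)))"
proof -
  interpret prob_space \<mu> by fact
  define T where "T = {x. \<forall>e>0. measure \<mu> (ball x e) > 0}"
  have T_AE: "AE z in \<mu>. z \<in> T"
  proof -
    define F where "F = {ball x e | x e. measure \<mu> (ball x e) = 0}"
    obtain F' where F': "F' \<subseteq> F" "countable F'" "\<Union>F' = \<Union>F"
      by (rule Lindelof[of F]) (auto simp: F_def)
    have "(\<Union>S\<in>F'. S) \<in> null_sets \<mu>"
    proof (rule null_sets_UN')
      fix S assume "S \<in> F'"
      then show "S \<in> null_sets \<mu>" using F' sets by (auto simp: F_def null_sets_def emeasure_eq_measure)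
    qed fact
    moreover have "{z \<in> space \<mu>. \<not> z \<in> T} \<subseteq> (\<Union>S\<in>F'. S)"
    proof
      fix z assume "z \<in> {z \<in> space \<mu>. \<not> z \<in> T}"
      then obtain e where e: "e > 0" "measure \<mu> (ball z e) = 0" by (auto simp: T_def zero_less_measure_iff)
      then have "z \<in> \<Union>F" by (auto simp: F_def intro!: exI[of _ "ball z e"])
      then show "z \<in> (\<Union>S\<in>F'. S)" using F' by simp
    qed
    ultimately show ?thesis by (rule AE_I')
  qed
  show ?thesis
  proof (cases "finite T")
    case True
    then show ?thesis using T_AE by blast
  next
    case False
    have "\<exists>s r. 0 < r \<and> r \<le> 1 \<and> (\<forall>a\<le>(d::nat). measure \<mu> (ball (s a) r) > 0) \<and>
      (\<forall>a\<le>d. \<forall>a'\<le>d. a \<noteq> a' \<longrightarrow> (\<forall>x\<in>ball (s a) r. \<forall>y\<in>ball (s a') r. norm (x - y) \<ge> r))" for d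
    proof -
      obtain s :: "nat \<Rightarrow> complex" where s: "inj s" "range s \<subseteq> T" using infinite_countable_subset[OF False] by blast
      \<comment> \<open>The extra element 3 keeps \<open>D\<close> nonempty and
        \<open>r \<le> 1\<close>. Centres at least \<open>3 * r\<close> apart leave a gap of
        \<open>r\<close> between balls of radius \<open>r\<close>.\<close>
      define D where "D = insert 3 {norm (s a - s a') | a a'. a \<le> d \<and> a' \<le> d \<and> a \<noteq> a'}"
      have "{norm (s a - s a') | a a'. a \<le> d \<and> a' \<le> d \<and> a \<noteq> a'} \<subseteq> (\<lambda>(a, a'). norm (s a - s a')) ` ({..d} \<times> {..d})"
        by auto
      then have finD: "finite D" unfolding D_def by (meson finite_SigmaI finite_atMost finite_imageI finite_insert finite_subset)
      have posD: "x > 0" if "x \<in> D" for x using that s(1) by (auto simp: D_def inj_def)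
      define r where "r = Min D / 3"
      have "Min D \<in> D" using finD by (intro Min_in) (auto simp: D_def)
      then have r0: "r > 0" using posD by (simp add: r_def)
      have "Min D \<le> 3" using finD by (intro Min_le) (auto simp: D_def)
      then have r1: "r \<le> 1" by (simp add: r_def)
      have sep: "norm (x - y) \<ge> r" if "a \<le> d" "a' \<le> d" "a \<noteq> a'" "x \<in> ball (s a) r" "y \<in> ball (s a') r" for a a' x y
      proof -
        have "Min D \<le> norm (s a - s a')" using finD that by (intro Min_le) (auto simp: D_def)
        moreover have "norm (s a - s a') \<le> norm (s a - x) + norm (x - y) + norm (y - s a')"
          using norm_triangle_ineq[of "s a - x" "x - y"] norm_triangle_ineq[of "s a - y" "y - s a'"] by simp
        moreover have "norm (s a - x) < r" "norm (y - s a') < r" using that by (auto simp: dist_norm norm_minus_commute)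
        ultimately show ?thesis unfolding r_def by linarith
      qed
      have "measure \<mu> (ball (s a) r) > 0" for a using s(2) r0 by (auto simp: T_def)
      then show ?thesis using r0 r1 sep by blast
    qed
    then show ?thesis by blast
  qed
qed

section \<open>Independent samples\<close>

context coin_config
begin

lemma card_J: "card J = 2 * m * d"
proof -
  have "card J = (\<Sum>a<d. card (Jg a))"
    unfolding J(3) using disj finite_Jg by (intro card_UN_disjoint) (auto simp: disjoint_family_on_def)
  also have "\<dots> = 2 * m * d" using Jg by simp
  finally show ?thesis .
qed

text \<open>Exchange of the sum over patterns with the area integral: at exceptional points all
  \<open>2 ^ card I\<close> patterns may be bad, elsewhere at most the fraction
  \<open>(k / sqrt m) ^ d\<close> of them.\<close>

lemma sum_emeasure_small_at:
  assumes I: "finite I" "J \<subseteq> I" and m: "m > 0" and \<delta>: "\<delta> \<ge> 0" and h: "0 < h" "h \<le> R"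
    and thr: "fact (Suc k) * ((1 + R + R0) ^ card J) ^ Suc k * \<delta> < threshold h"
  shows "(\<Sum>S\<in>Pow I. emeasure lborel {b \<in> cball 0 R. small_at k \<delta> I (coin S) b})
    \<le> ennreal (2 ^ card I * (2 ^ (card J * Suc k) * (real (Suc k * card J) * (pi * h\<^sup>2))
        + pi * R\<^sup>2 * (real k / sqrt m) ^ d))"
proof -
  define U where "U = (\<lambda>S. {b \<in> cball 0 R. small_at k \<delta> I (coin S) b})"
  define q where "q = (real k / sqrt m) ^ d"
  have q: "q \<ge> 0" by (simp add: q_def)
  have [measurable]: "exceptional h \<in> sets borel" by (rule emeasure_exceptional(2)[OF h])
  have [measurable]: "cball (0::complex) R \<in> sets borel" by simp
  have sm [measurable]: "(U S) \<in> sets borel" for S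
  proof -
    have [measurable]: "Measurable.pred borel (\<lambda>b. small_at k \<delta> I (coin S) b)"
      by (rule pred_small_at[OF I(1)]) auto
    have "U S = cball 0 R \<inter> {b \<in> space borel. small_at k \<delta> I (coin S) b}" by (auto simp: U_def)
    then show ?thesis by simp
  qed
  have pt: "(\<Sum>S\<in>Pow I. indicator (U S) b)
    \<le> ennreal (2 ^ card I) * indicator (exceptional h) b + ennreal (2 ^ card I * q) * indicator (cball 0 R) b" for b
  proof (cases "b \<in> cball 0 R")
    case True
    define T where "T = {S \<in> Pow I. small_at k \<delta> I (coin S) b}"
    have "(\<Sum>S\<in>Pow I. indicator (U S) b :: ennreal)
      = (\<Sum>S\<in>Pow I. if S \<in> T then 1 else 0)"
      using True by (intro sum.cong refl) (auto simp: T_def U_def indicator_def)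
    also have "\<dots> = of_nat (card T)"
      using I(1) by (subst sum.If_cases) (auto simp: T_def Int_def conj_commute)
    also have "\<dots> = ennreal (real (card T))" by (simp add: ennreal_of_nat_eq_real_of_nat)
    finally have eq: "(\<Sum>S\<in>Pow I. indicator (U S) b) = ennreal (real (card T))" .
    show ?thesis
    proof (cases "b \<in> exceptional h")
      case True
      have "card T \<le> card (Pow I)" unfolding T_def using I(1) by (intro card_mono) auto
      then have "real (card T) \<le> 2 ^ card I" using I(1) by (simp add: card_Pow numeral_power_le_of_nat_cancel_iff flip: of_nat_le_iff)
      then show ?thesis unfolding eq using True by (simp add: add_increasing2 ennreal_leI)
    next
      case False
      have "card T \<le> 2 ^ card (I - J) * (k * (2 * m choose m)) ^ d"
        unfolding T_def by (rule card_small_patterns[OF I _ False \<delta> thr]) (use True in simp)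
      then have "real (card T) \<le> real (2 ^ card (I - J) * (k * (2 * m choose m)) ^ d)" by (simp only: of_nat_le_iff)
      also have "\<dots> = 2 ^ card (I - J) * (real k * real (2 * m choose m)) ^ d" by simp
      also have "\<dots> \<le> 2 ^ card (I - J) * (real k * (4 ^ m / sqrt m)) ^ d"
        using central_binomial_upper_bound[OF m] m
        by (intro mult_left_mono power_mono) (auto simp: field_simps)
      also have "\<dots> = 2 ^ card (I - J) * (4 ^ m) ^ d * q"
        by (simp add: q_def power_mult_distrib power_divide)
      also have "(4 ^ m) ^ d = (2 :: real) ^ card J"
        unfolding card_J by (simp add: power_mult)
      also have "2 ^ card (I - J) * 2 ^ card J = (2 :: real) ^ card I"
        using I by (simp add: card_Diff_subset[OF J(1)] card_mono flip: power_add)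
      finally show ?thesis unfolding eq using True False by (simp add: ennreal_leI)
    qed
  next
    case False
    then show ?thesis by (simp add: U_def)
  qed
  have "(\<Sum>S\<in>Pow I. emeasure lborel (U S))
    = (\<integral>\<^sup>+b. (\<Sum>S\<in>Pow I. indicator (U S) b) \<partial>lborel)"
    by (subst nn_integral_sum) auto
  also have "\<dots> \<le> (\<integral>\<^sup>+b. ennreal (2 ^ card I) * indicator (exceptional h) b
      + ennreal (2 ^ card I * q) * indicator (cball 0 R) b \<partial>lborel)"
    by (intro nn_integral_mono pt)
  also have "\<dots> = ennreal (2 ^ card I) * emeasure lborel (exceptional h)
      + ennreal (2 ^ card I * q) * emeasure lborel (cball (0::complex) R)"
    by (subst nn_integral_add) (auto simp: nn_integral_cmult_indicator)
  also have "\<dots> \<le> ennreal (2 ^ card I) * ennreal (2 ^ (card J * Suc k) * (real (Suc k * card J) * (pi * h\<^sup>2)))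
      + ennreal (2 ^ card I * q) * ennreal (pi * R\<^sup>2)"
    using R by (intro add_mono mult_left_mono emeasure_exceptional(1)[OF h]) (auto simp: emeasure_cball_complex)
  also have "\<dots> = ennreal (2 ^ card I * (2 ^ (card J * Suc k) * (real (Suc k * card J) * (pi * h\<^sup>2))))
      + ennreal (2 ^ card I * q * (pi * R\<^sup>2))"
    using q by (subst (1 2) ennreal_mult[symmetric]) auto
  also have "\<dots> = ennreal (2 ^ card I * (2 ^ (card J * Suc k) * (real (Suc k * card J) * (pi * h\<^sup>2)))
      + 2 ^ card I * q * (pi * R\<^sup>2))"
    using q by (intro ennreal_plus[symmetric]) auto
  also have "2 ^ card I * (2 ^ (card J * Suc k) * (real (Suc k * card J) * (pi * h\<^sup>2))) + 2 ^ card I * q * (pi * R\<^sup>2)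
    = 2 ^ card I * (2 ^ (card J * Suc k) * (real (Suc k * card J) * (pi * h\<^sup>2)) + pi * R\<^sup>2 * q)"
    by (simp only: distrib_left mult_ac)
  finally show ?thesis by (simp only: q_def U_def)
qed

end

section \<open>The i.i.d. sample, exchanges of its entries, and concentration\<close>

locale iid_complex = prob_space M for M :: "'a measure" +
  fixes \<mu> :: "complex measure" and Z :: "nat \<Rightarrow> 'a \<Rightarrow> complex"
  assumes prob_\<mu>: "prob_space \<mu>" and sets_\<mu>: "sets \<mu> = sets borel"
    and indep: "indep_vars (\<lambda>_. borel) Z {1..}"
    and distr_Z: "\<And>j. j \<ge> 1 \<Longrightarrow> distr M borel (Z j) = \<mu>"
begin

lemma Z_measurable: "j \<ge> 1 \<Longrightarrow> Z j \<in> borel_measurable M"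
  using indep by (auto simp: indep_vars_def)

lemma prob_Z_in: "j \<ge> 1 \<Longrightarrow> A \<in> sets borel \<Longrightarrow> prob (Z j -` A \<inter> space M) = measure \<mu> A"
  using distr_Z[of j] measure_distr[OF Z_measurable, of j A] by simp

lemma expectation_Z:
  fixes f :: "complex \<Rightarrow> real"
  assumes "j \<ge> 1" and [measurable]: "f \<in> borel_measurable borel"
  shows "expectation (\<lambda>\<omega>. f (Z j \<omega>)) = (\<integral>z. f z \<partial>\<mu>)"
  using integral_distr[OF Z_measurable[OF assms(1)], of f] distr_Z[OF assms(1)] by simp

text \<open>Only the distinctness of the indices matters to the joint law; this is the invariance
  under exchanging \<open>Z j\<close> for \<open>Z (n + j)\<close>. Independence is transferred
  along \<open>\<sigma>\<close> by restricting to the disjoint singletons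
  \<open>{\<sigma> j}\<close>.\<close>

lemma distr_reindex:
  fixes n :: nat and \<sigma> :: "nat \<Rightarrow> nat"
  assumes "n \<ge> 1" and \<sigma>: "inj_on \<sigma> {1..n}" "\<And>j. j \<in> {1..n} \<Longrightarrow> \<sigma> j \<ge> 1"
  shows "distr M (\<Pi>\<^sub>M j\<in>{1..n}. borel) (\<lambda>\<omega>. \<lambda>j\<in>{1..n}. Z (\<sigma> j) \<omega>) = (\<Pi>\<^sub>M j\<in>{1..n}. \<mu>)"
proof -
  have ne: "{1..n} \<noteq> {}" using assms(1) by auto
  have "indep_vars (\<lambda>j. PiM {\<sigma> j} (\<lambda>_. borel)) (\<lambda>j \<omega>. restrict (\<lambda>i. Z i \<omega>) {\<sigma> j}) {1..n}"
  proof (rule indep_vars_restrict[OF indep])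
    show "{\<sigma> j} \<subseteq> {1..}" if "j \<in> {1..n}" for j using \<sigma>(2)[OF that] by simp
    show "disjoint_family_on (\<lambda>j. {\<sigma> j}) {1..n}"
      unfolding disjoint_family_on_def
    proof (intro ballI impI)
      fix i j assume "i \<in> {1..n}" "j \<in> {1..n}" "i \<noteq> j"
      then have "\<sigma> i \<noteq> \<sigma> j" using inj_onD[OF \<sigma>(1)] by metis
      then show "{\<sigma> i} \<inter> {\<sigma> j} = {}" by simp
    qed
  qed
  then have "indep_vars (\<lambda>_. borel) (\<lambda>j \<omega>. restrict (\<lambda>i. Z i \<omega>) {\<sigma> j} (\<sigma> j)) {1..n}"
    by (rule indep_vars_compose2[where Y = "\<lambda>j f. f (\<sigma> j)"]) (auto intro!: measurable_component_singleton)
  then have "indep_vars (\<lambda>_. borel) (\<lambda>j \<omega>. Z (\<sigma> j) \<omega>) {1..n}" by simp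
  then have "distr M (\<Pi>\<^sub>M j\<in>{1..n}. borel) (\<lambda>\<omega>. \<lambda>j\<in>{1..n}. Z (\<sigma> j) \<omega>) = (\<Pi>\<^sub>M j\<in>{1..n}. distr M borel (Z (\<sigma> j)))"
    using \<sigma> Z_measurable by (subst (asm) indep_vars_iff_distr_eq_PiM'[OF ne]) auto
  also have "\<dots> = (\<Pi>\<^sub>M j\<in>{1..n}. \<mu>)" using \<sigma> distr_Z by (intro PiM_cong) auto
  finally show ?thesis .
qed

lemma nn_integral_reindex:
  fixes n :: nat and \<sigma> :: "nat \<Rightarrow> nat"
  assumes "n \<ge> 1" "inj_on \<sigma> {1..n}" "\<And>j. j \<in> {1..n} \<Longrightarrow> \<sigma> j \<ge> 1"
    and [measurable]: "f \<in> borel_measurable (\<Pi>\<^sub>M j\<in>{1..n}. borel)"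
  shows "(\<integral>\<^sup>+\<omega>. f (\<lambda>j\<in>{1..n}. Z (\<sigma> j) \<omega>) \<partial>M) = (\<integral>\<^sup>+\<omega>. f (\<lambda>j\<in>{1..n}. Z j \<omega>) \<partial>M)"
proof -
  have *: "(\<integral>\<^sup>+\<omega>. f (\<lambda>j\<in>{1..n}. Z (\<tau> j) \<omega>) \<partial>M) = (\<integral>\<^sup>+c. f c \<partial>(\<Pi>\<^sub>M j\<in>{1..n}. \<mu>))"
    if \<tau>: "inj_on \<tau> {1..n}" "\<And>j. j \<in> {1..n} \<Longrightarrow> \<tau> j \<ge> 1" for \<tau>
  proof -
    have [measurable]: "(\<lambda>\<omega>. \<lambda>j\<in>{1..n}. Z (\<tau> j) \<omega>) \<in> M \<rightarrow>\<^sub>M (\<Pi>\<^sub>M j\<in>{1..n}. borel)"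
      using \<tau> by (intro measurable_restrict Z_measurable) auto
    have "(\<integral>\<^sup>+c. f c \<partial>(\<Pi>\<^sub>M j\<in>{1..n}. \<mu>))
      = (\<integral>\<^sup>+c. f c \<partial>distr M (\<Pi>\<^sub>M j\<in>{1..n}. borel) (\<lambda>\<omega>. \<lambda>j\<in>{1..n}. Z (\<tau> j) \<omega>))"
      by (simp only: distr_reindex[OF assms(1) \<tau>])
    also have "\<dots> = (\<integral>\<^sup>+\<omega>. f (\<lambda>j\<in>{1..n}. Z (\<tau> j) \<omega>) \<partial>M)"
      by (rule nn_integral_distr) measurable
    finally show ?thesis by (rule sym)
  qed
  show ?thesis using *[of \<sigma>] *[of "\<lambda>j. j"] assms by auto
qed

lemma hoeffding:
  fixes X :: "nat \<Rightarrow> 'a \<Rightarrow> real"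
  assumes "n \<ge> 1" "indep_vars (\<lambda>_. borel) X {1..n}"
    and "\<And>j \<omega>. j \<in> {1..n} \<Longrightarrow> X j \<omega> \<in> {0..1}" and E: "\<And>j. j \<in> {1..n} \<Longrightarrow> expectation (X j) = q"
    and t: "t \<ge> 0"
  shows "prob {\<omega> \<in> space M. (\<Sum>j=1..n. X j \<omega>) \<le> n * q - n * t} \<le> exp (- 2 * real n * t\<^sup>2)"
    and "prob {\<omega> \<in> space M. \<bar>(\<Sum>j=1..n. X j \<omega>) - n * q\<bar> \<ge> n * t} \<le> 2 * exp (- 2 * real n * t\<^sup>2)"
proof -
  interpret H: indep_interval_bounded_random_variables M "{1..n}" X "\<lambda>_. 0" "\<lambda>_. 1"
    by unfold_locales (use assms in auto)
  interpret H: Hoeffding_ineq M "{1..n}" X "\<lambda>_. 0" "\<lambda>_. 1" "\<Sum>i\<in>{1..n}. expectation (X i)"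
    by unfold_locales simp
  have sum: "(\<Sum>i\<in>{1..n}. expectation (X i)) = n * q" using E by simp
  have var: "(\<Sum>i\<in>{1..n}. (1 - 0 :: real)\<^sup>2) = n" by simp
  have ex: "- 2 * (real n * t)\<^sup>2 / real n = - 2 * real n * t\<^sup>2" using assms(1) by (simp add: power2_eq_square)
  have nt: "real n * t \<ge> 0" "(\<Sum>i\<in>{1..n}. (1 - 0 :: real)\<^sup>2) > 0" using t assms(1) by auto
  show "prob {\<omega> \<in> space M. (\<Sum>j=1..n. X j \<omega>) \<le> n * q - n * t} \<le> exp (- 2 * real n * t\<^sup>2)"
    using H.Hoeffding_ineq_le[OF nt] unfolding sum var ex .
  show "prob {\<omega> \<in> space M. \<bar>(\<Sum>j=1..n. X j \<omega>) - n * q\<bar> \<ge> n * t} \<le> 2 * exp (- 2 * real n * t\<^sup>2)"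
    using H.Hoeffding_ineq_abs_ge[OF nt] unfolding sum var ex .
qed

text \<open>For bounded \<open>f\<close> the Hoeffding tails are geometric in \<open>n\<close>, so
  Borel-Cantelli applies for each tolerance \<open>1 / Suc i\<close>.\<close>

lemma strong_law:
  fixes f :: "complex \<Rightarrow> real"
  assumes [measurable]: "f \<in> borel_measurable borel" and f: "\<And>z. f z \<in> {0..1}"
  shows "AE \<omega> in M. (\<lambda>n. (\<Sum>j=1..n. f (Z j \<omega>)) / n) \<longlonglongrightarrow> (\<integral>z. f z \<partial>\<mu>)"
proof -
  define q where "q = (\<integral>z. f z \<partial>\<mu>)"
  have meas: "(\<lambda>\<omega>. f (Z j \<omega>)) \<in> borel_measurable M" if "j \<in> {1..n}" for j n
    using Z_measurable[of j] that by (intro measurable_compose[OF _ assms(1)]) auto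
  define E where "E = (\<lambda>t n. {\<omega> \<in> space M. \<bar>(\<Sum>j=1..n. f (Z j \<omega>)) - n * q\<bar> \<ge> n * t \<and> n \<ge> 1})"
  have E_sets: "E t n \<in> sets M" for t n
  proof -
    have [measurable]: "(\<lambda>\<omega>. \<Sum>j=1..n. f (Z j \<omega>)) \<in> borel_measurable M"
      by (intro borel_measurable_sum meas)
    show ?thesis unfolding E_def by measurable
  qed
  have E_prob: "prob (E t n) \<le> 2 * exp (- 2 * t\<^sup>2) ^ n" if t: "t > 0" for t n
  proof (cases "n \<ge> 1")
    case True
    have "indep_vars (\<lambda>_. borel) (\<lambda>j \<omega>. f (Z j \<omega>)) {1..n}"
      by (rule indep_vars_compose2[OF indep_vars_subset[OF indep]]) auto
    from hoeffding(2)[OF True this, of q t] f t expectation_Z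
    have "prob (E t n) \<le> 2 * exp (- 2 * real n * t\<^sup>2)" using True by (simp add: E_def q_def)
    then show ?thesis by (simp add: exp_of_nat_mult[symmetric] mult_ac)
  qed (simp add: E_def)
  have "AE \<omega> in M. \<forall>\<^sub>F n in sequentially. \<omega> \<in> space M - E (1 / Suc i) n" for i
  proof (rule borel_cantelli_AE1[OF E_sets])
    have "summable (\<lambda>n. 2 * exp (- 2 * (1 / real (Suc i))\<^sup>2) ^ n)"
      by (intro summable_mult summable_geometric) simp
    then show "summable (\<lambda>n. prob (E (1 / Suc i) n))"
      by (rule summable_comparison_test') (use E_prob in auto)
  qed (simp add: emeasure_eq_measure)
  then have "AE \<omega> in M. \<forall>i. \<forall>\<^sub>F n in sequentially. \<omega> \<in> space M - E (1 / Suc i) n"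
    unfolding AE_all_countable by blast
  then show ?thesis
  proof eventually_elim
    case (elim \<omega>)
    show ?case unfolding q_def[symmetric]
    proof (rule LIMSEQ_I)
      fix e :: real assume "e > 0"
      then obtain i where i: "1 / Suc i < e" using nat_approx_posE by blast
      have "\<forall>\<^sub>F n in sequentially. norm ((\<Sum>j=1..n. f (Z j \<omega>)) / n - q) < e"
        using elim[rule_format, of i] eventually_ge_at_top[of 1]
      proof eventually_elim
        case (elim n)
        then have "\<bar>(\<Sum>j=1..n. f (Z j \<omega>)) - n * q\<bar> < n * (1 / Suc i)" by (auto simp: E_def)
        then have "\<bar>(\<Sum>j=1..n. f (Z j \<omega>)) - n * q\<bar> / n < 1 / Suc i" using elim(2) by (simp add: field_simps)
        also have "\<bar>(\<Sum>j=1..n. f (Z j \<omega>)) - n * q\<bar> / n = \<bar>(\<Sum>j=1..n. f (Z j \<omega>)) / n - q\<bar>"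
        proof -
          have "(\<Sum>j=1..n. f (Z j \<omega>)) / n - q = ((\<Sum>j=1..n. f (Z j \<omega>)) - n * q) / n"
            using elim(2) by (simp add: diff_divide_distrib)
          then show ?thesis by (simp only: abs_divide abs_of_nat)
        qed
        finally show ?case using i by simp
      qed
      then show "\<exists>n0. \<forall>n\<ge>n0. norm ((\<Sum>j=1..n. f (Z j \<omega>)) / n - q) < e"
        by (simp add: eventually_sequentially)
    qed
  qed
qed

text \<open>An index is eligible as a free coin if heads fall in \<open>A\<close> and tails in
  \<open>B\<close>. The index pairs \<open>{j, n + j}\<close> are disjoint, so eligibilities are
  independent with probability \<open>p \<ge> q\<close>; Hoeffding with deviation
  \<open>p / 2\<close> gives the exponent \<open>n * p ^ 2 / 2\<close>.\<close>

lemma prob_few_coins: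
  assumes n: "n \<ge> 1" and [measurable]: "A \<in> sets borel" "B \<in> sets borel"
    and q: "q \<le> measure \<mu> A * measure \<mu> B" "q \<ge> 0"
  shows "prob {\<omega> \<in> space M. real (card {j \<in> {1..n}. Z j \<omega> \<in> A \<and> Z (n + j) \<omega> \<in> B}) \<le> n * q / 2} \<le> exp (- (n * q\<^sup>2 / 2))"
proof -
  define p where "p = measure \<mu> A * measure \<mu> B"
  define X :: "nat \<Rightarrow> 'a \<Rightarrow> real" where "X = (\<lambda>j \<omega>. indicator A (Z j \<omega>) * indicator B (Z (n + j) \<omega>))"
  have "indep_vars (\<lambda>j. PiM {j, n + j} (\<lambda>_. borel)) (\<lambda>j \<omega>. restrict (\<lambda>i. Z i \<omega>) {j, n + j}) {1..n}"
  proof (rule indep_vars_restrict[OF indep])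
    show "disjoint_family_on (\<lambda>j. {j, n + j}) {1..n}"
      unfolding disjoint_family_on_def
    proof (intro ballI impI)
      fix i j assume "i \<in> {1..n}" "j \<in> {1..n}" "i \<noteq> j"
      then show "{i, n + i} \<inter> {j, n + j} = {}" by simp
    qed
  qed auto
  then have "indep_vars (\<lambda>_. borel) (\<lambda>j \<omega>. indicator A (restrict (\<lambda>i. Z i \<omega>) {j, n + j} j)
    * indicator B (restrict (\<lambda>i. Z i \<omega>) {j, n + j} (n + j)) :: real) {1..n}"
  proof (rule indep_vars_compose2[where Y = "\<lambda>j f. indicator A (f j) * indicator B (f (n + j))"])
    fix j
    have [measurable]: "(\<lambda>f. f j) \<in> PiM {j, n + j} (\<lambda>_. borel) \<rightarrow>\<^sub>M (borel :: complex measure)"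
      "(\<lambda>f. f (n + j)) \<in> PiM {j, n + j} (\<lambda>_. borel) \<rightarrow>\<^sub>M (borel :: complex measure)"
      by (auto intro!: measurable_component_singleton)
    show "(\<lambda>f. indicator A (f j) * indicator B (f (n + j)) :: real) \<in> borel_measurable (PiM {j, n + j} (\<lambda>_. borel))"
      by measurable
  qed
  then have indepX: "indep_vars (\<lambda>_. borel) X {1..n}" by (simp add: X_def)
  have EX: "expectation (X j) = p" if j: "j \<in> {1..n}" for j
  proof -
    define S where "S = (\<lambda>i. if i = j then A else B)"
    have "(\<Inter>i\<in>{j, n + j}. Z i -` S i \<inter> space M) = {\<omega> \<in> space M. Z j \<omega> \<in> A \<and> Z (n + j) \<omega> \<in> B}"
      using n by (auto simp: S_def)
    moreover have "prob (\<Inter>i\<in>{j, n + j}. Z i -` S i \<inter> space M) = (\<Prod>i\<in>{j, n + j}. prob (Z i -` S i \<inter> space M))"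
      using j by (intro indep_varsD[OF indep]) (auto simp: S_def)
    moreover have "\<dots> = p"
      using n j prob_Z_in by (simp add: S_def p_def)
    ultimately have "prob {\<omega> \<in> space M. Z j \<omega> \<in> A \<and> Z (n + j) \<omega> \<in> B} = p" by simp
    moreover have "expectation (X j) = expectation (indicator {\<omega> \<in> space M. Z j \<omega> \<in> A \<and> Z (n + j) \<omega> \<in> B})"
      by (intro Bochner_Integration.integral_cong) (auto simp: X_def indicator_def)
    moreover have "{\<omega> \<in> space M. Z j \<omega> \<in> A \<and> Z (n + j) \<omega> \<in> B} \<inter> space M
      = {\<omega> \<in> space M. Z j \<omega> \<in> A \<and> Z (n + j) \<omega> \<in> B}" by auto
    ultimately show ?thesis by (simp only: Bochner_Integration.integral_indicator)
  qed
  have sumX: "(\<Sum>j=1..n. X j \<omega>) = real (card {j \<in> {1..n}. Z j \<omega> \<in> A \<and> Z (n + j) \<omega> \<in> B})" for \<omega>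
  proof -
    have "(\<Sum>j=1..n. X j \<omega>) = (\<Sum>j=1..n. if Z j \<omega> \<in> A \<and> Z (n + j) \<omega> \<in> B then 1 else 0)"
      by (intro sum.cong) (auto simp: X_def indicator_def)
    also have "\<dots> = real (card {j \<in> {1..n}. Z j \<omega> \<in> A \<and> Z (n + j) \<omega> \<in> B})"
      by (subst sum.If_cases) (auto simp: Int_def)
    finally show ?thesis .
  qed
  have p0: "p \<ge> 0" "p \<ge> q" using q by (auto simp: p_def)
  have [measurable]: "X j \<in> borel_measurable M" if "j \<in> {1..n}" for j
    using indepX that by (auto simp: indep_vars_def)
  have "prob {\<omega> \<in> space M. (\<Sum>j=1..n. X j \<omega>) \<le> n * q / 2} \<le> prob {\<omega> \<in> space M. (\<Sum>j=1..n. X j \<omega>) \<le> n * p - n * (p / 2)}"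
  proof (intro finite_measure_mono subsetI)
    show "{\<omega> \<in> space M. (\<Sum>j=1..n. X j \<omega>) \<le> n * p - n * (p / 2)} \<in> events"
    proof -
      have "(\<lambda>\<omega>. \<Sum>j=1..n. X j \<omega>) \<in> borel_measurable M" by (intro borel_measurable_sum) auto
      then show ?thesis by measurable
    qed
    fix \<omega> assume \<omega>: "\<omega> \<in> {\<omega> \<in> space M. (\<Sum>j=1..n. X j \<omega>) \<le> n * q / 2}"
    have "real n * q \<le> real n * p" using p0 by (intro mult_left_mono) auto
    moreover have "real n * p - real n * (p / 2) = real n * p / 2" by simp
    moreover have "(\<Sum>j=1..n. X j \<omega>) \<le> n * q / 2" using \<omega> by (simp only: mem_Collect_eq)
    ultimately have "(\<Sum>j=1..n. X j \<omega>) \<le> n * p - n * (p / 2)" by linarith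
    then show "\<omega> \<in> {\<omega> \<in> space M. (\<Sum>j=1..n. X j \<omega>) \<le> n * p - n * (p / 2)}"
      using \<omega> by (simp only: mem_Collect_eq)
  qed
  also have "\<dots> \<le> exp (- 2 * real n * (p / 2)\<^sup>2)"
    using p0 EX by (intro hoeffding(1)[OF n indepX]) (auto simp: X_def indicator_def)
  also have "\<dots> \<le> exp (- (n * q\<^sup>2 / 2))"
  proof -
    have "q\<^sup>2 \<le> p\<^sup>2" using p0 q by (intro power_mono) auto
    then have "n * q\<^sup>2 \<le> n * p\<^sup>2" by (intro mult_left_mono) auto
    then show ?thesis by (simp add: power_divide)
  qed
  finally show ?thesis by (simp only: sumX)
qed

end

context iid_complex
begin

lemma coin_count_measurable:
  assumes "n \<ge> 1" and [measurable]: "A \<in> sets borel" "B \<in> sets borel"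
  shows "(\<lambda>\<omega>. real (card {j \<in> {1..n}. Z j \<omega> \<in> A \<and> Z (n + j) \<omega> \<in> B})) \<in> borel_measurable M"
proof -
  have "real (card {j \<in> {1..n}. Z j \<omega> \<in> A \<and> Z (n + j) \<omega> \<in> B})
    = (\<Sum>j=1..n. indicator A (Z j \<omega>) * indicator B (Z (n + j) \<omega>))" for \<omega>
  proof -
    have "(\<Sum>j=1..n. indicator A (Z j \<omega>) * indicator B (Z (n + j) \<omega>) :: real)
      = (\<Sum>j=1..n. if Z j \<omega> \<in> A \<and> Z (n + j) \<omega> \<in> B then 1 else 0)"
      by (intro sum.cong) (auto simp: indicator_def)
    also have "\<dots> = real (card {j \<in> {1..n}. Z j \<omega> \<in> A \<and> Z (n + j) \<omega> \<in> B})"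
      by (subst sum.If_cases) (auto simp: Int_def)
    finally show ?thesis by simp
  qed
  moreover have "(\<lambda>\<omega>. \<Sum>j=1..n. indicator A (Z j \<omega>) * indicator B (Z (n + j) \<omega>) :: real) \<in> borel_measurable M"
  proof (intro borel_measurable_sum borel_measurable_times)
    fix j assume j: "j \<in> {1..n}"
    show "(\<lambda>\<omega>. indicator A (Z j \<omega>) :: real) \<in> borel_measurable M"
      using j by (intro measurable_compose[OF Z_measurable]) auto
    show "(\<lambda>\<omega>. indicator B (Z (n + j) \<omega>) :: real) \<in> borel_measurable M"
      using j by (intro measurable_compose[OF Z_measurable]) auto
  qed
  ultimately show ?thesis by simp
qed

definition small_area :: "nat \<Rightarrow> real \<Rightarrow> real \<Rightarrow> nat \<Rightarrow> (nat \<Rightarrow> complex) \<Rightarrow> ennreal" where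
  "small_area k \<delta> R n c = emeasure lborel {b \<in> cball 0 R. small_at k \<delta> {1..n} c b}"

lemma small_area_cong: "(\<And>j. j \<in> {1..n} \<Longrightarrow> c j = c' j) \<Longrightarrow> small_area k \<delta> R n c = small_area k \<delta> R n c'"
  unfolding small_area_def using small_at_cong[of "{1..n}" c c'] by simp

lemma small_area_eq_nn_integral:
  "small_area k \<delta> R n c = (\<integral>\<^sup>+b. indicator {b \<in> cball 0 R. small_at k \<delta> {1..n} c b} b \<partial>lborel)"
proof -
  have [measurable]: "Measurable.pred borel (\<lambda>b. small_at k \<delta> {1..n} c b)"
    by (rule pred_small_at) auto
  have [measurable]: "cball (0::complex) R \<in> sets borel" by simp
  have "{b \<in> cball 0 R. small_at k \<delta> {1..n} c b} = cball 0 R \<inter> {b \<in> space borel. small_at k \<delta> {1..n} c b}" by auto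
  also have "\<dots> \<in> sets borel" by measurable
  finally have "{b \<in> cball 0 R. small_at k \<delta> {1..n} c b} \<in> sets lborel" by simp
  then show ?thesis unfolding small_area_def by (rule nn_integral_indicator[symmetric])
qed

lemma small_area_measurable_comp:
  assumes "\<And>j. j \<in> {1..n} \<Longrightarrow> (\<lambda>x. c x j) \<in> borel_measurable N"
  shows "(\<lambda>x. small_area k \<delta> R n (c x)) \<in> borel_measurable N"
proof -
  have [measurable]: "Measurable.pred (N \<Otimes>\<^sub>M lborel) (\<lambda>p. small_at k \<delta> {1..n} (c (fst p)) (snd p))"
  proof (rule pred_small_at)
    fix j assume "j \<in> {1..n}"
    then show "(\<lambda>p. c (fst p) j) \<in> borel_measurable (N \<Otimes>\<^sub>M lborel)"
      using measurable_compose[OF measurable_fst assms] by simp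
  qed auto
  have [measurable]: "cball (0::complex) R \<in> sets borel" by simp
  have "(\<lambda>x. \<integral>\<^sup>+b. (if b \<in> cball 0 R \<and> small_at k \<delta> {1..n} (c x) b then 1 else 0) \<partial>lborel) \<in> borel_measurable N"
  proof (rule lborel.borel_measurable_nn_integral)
    have "(\<lambda>p. if snd p \<in> cball 0 R \<and> small_at k \<delta> {1..n} (c (fst p)) (snd p) then 1 else 0 :: ennreal)
      \<in> borel_measurable (N \<Otimes>\<^sub>M lborel)" by measurable
    then show "(\<lambda>(x, b). if b \<in> cball 0 R \<and> small_at k \<delta> {1..n} (c x) b then 1 else 0 :: ennreal)
      \<in> borel_measurable (N \<Otimes>\<^sub>M lborel)" by (simp add: case_prod_beta)
  qed
  moreover have "small_area k \<delta> R n (c x) = (\<integral>\<^sup>+b. (if b \<in> cball 0 R \<and> small_at k \<delta> {1..n} (c x) b then 1 else 0) \<partial>lborel)" for x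
    unfolding small_area_eq_nn_integral by (intro nn_integral_cong) (simp add: indicator_def)
  ultimately show ?thesis by simp
qed

lemma small_area_le: "R \<ge> 0 \<Longrightarrow> small_area k \<delta> R n c \<le> ennreal (pi * R\<^sup>2)"
  unfolding small_area_def
  by (subst emeasure_cball_complex[where c = 0, symmetric]) (auto intro!: emeasure_mono)

text \<open>Symmetrisation: the expectation is unchanged if the sample is replaced by any of its
  \<open>2 ^ n\<close> exchanged versions, so it may be averaged over all patterns \<open>S\<close>
  inside the integral. The three terms bound the exceptional points, the fraction of bad patterns
  elsewhere, and the event that some disc has too few eligible coins.\<close>

lemma expected_small_area_le:
  fixes n m d k :: nat and A :: "nat \<Rightarrow> complex set" and w :: "nat \<Rightarrow> complex"
    and \<rho> R1 R0 r R e q \<delta> h :: real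
  assumes n: "n \<ge> 1" and m: "m \<ge> 1" and d: "d \<ge> 1" and k: "k \<ge> 1"
    and A: "\<And>a. a < d \<Longrightarrow> A a \<in> sets borel" and B: "B \<in> sets borel"
    and near: "\<And>a x. a < d \<Longrightarrow> x \<in> A a \<Longrightarrow> norm (x - w a) \<le> \<rho>"
    and far: "\<And>a a' x. a < d \<Longrightarrow> a' < d \<Longrightarrow> a \<noteq> a' \<Longrightarrow> x \<in> A a' \<Longrightarrow> norm (x - w a) \<ge> R1"
    and farB: "\<And>a x. a < d \<Longrightarrow> x \<in> B \<Longrightarrow> norm (x - w a) \<ge> R1"
    and bound: "\<And>a x. a < d \<Longrightarrow> x \<in> A a \<Longrightarrow> norm x \<le> R0" "\<And>x. x \<in> B \<Longrightarrow> norm x \<le> R0"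
    and w: "\<And>a. a < d \<Longrightarrow> norm (w a) + r \<le> R"
    and e: "0 < e" "e \<le> 1" and r: "0 < r" "r \<le> 1" and \<rho>: "\<rho> \<le> r * e / 2" and R1: "r \<le> R1 * e / 2"
    and R0: "R0 \<ge> 0" and R: "R > 0"
    and small: "fact (Suc k) * (((4 * real (2 * m * d)) ^ k) ^ Suc k * (real (Suc k) * e)) \<le> 1 / 2"
    and q: "\<And>a. a < d \<Longrightarrow> q \<le> measure \<mu> (A a) * measure \<mu> B" "q \<ge> 0" "real (2 * m) \<le> n * q / 2"
    and \<delta>: "\<delta> \<ge> 0" and h: "0 < h" "h \<le> R"
    and thr: "fact (Suc k) * ((1 + R + R0) ^ (2 * m * d)) ^ Suc k * \<delta>
      < ((1 / 2) * (r / 2) ^ (Suc k * (2 * m * d))) * (h / (3 * R)) ^ (Suc k * (2 * m * d))"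
  shows "(\<integral>\<^sup>+\<omega>. small_area k \<delta> R n (\<lambda>j. Z j \<omega>) \<partial>M)
    \<le> ennreal (2 ^ (2 * m * d * Suc k) * (real (Suc k * (2 * m * d)) * (pi * h\<^sup>2))
        + pi * R\<^sup>2 * (real k / sqrt m) ^ d + pi * R\<^sup>2 * (d * exp (- (n * q\<^sup>2 / 2))))"
proof -
  define T where "T = 2 ^ (2 * m * d * Suc k) * (real (Suc k * (2 * m * d)) * (pi * h\<^sup>2))
        + pi * R\<^sup>2 * (real k / sqrt m) ^ d"
  have T: "T \<ge> 0" unfolding T_def by (intro add_nonneg_nonneg mult_nonneg_nonneg) auto
  \<comment> \<open>Tails replace the index \<open>j\<close> by \<open>n + j\<close>, so the
    alternatives are supplied by sample entries beyond the first \<open>n\<close>.\<close>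
  define \<sigma> where "\<sigma> = (\<lambda>S j. if j \<in> S then j else n + j :: nat)"
  define U where "U = (\<lambda>a \<omega>. {j \<in> {1..n}. Z j \<omega> \<in> A a \<and> Z (n + j) \<omega> \<in> B})"
  define Few where "Few = (\<lambda>a. {\<omega> \<in> space M. real (card (U a \<omega>)) \<le> n * q / 2})"
  have Few_sets: "Few a \<in> sets M" if "a < d" for a
  proof -
    have [measurable]: "(\<lambda>\<omega>. real (card (U a \<omega>))) \<in> borel_measurable M"
      unfolding U_def by (rule coin_count_measurable[OF n A[OF that] B])
    show ?thesis unfolding Few_def by measurable
  qed
  define Bad where "Bad = (\<Union>a<d. Few a)"
  have Bad_sets [measurable]: "Bad \<in> sets M" unfolding Bad_def using Few_sets by auto
  have "prob Bad \<le> (\<Sum>a<d. prob (Few a))"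
    unfolding Bad_def using Few_sets by (intro finite_measure_subadditive_finite) auto
  also have "\<dots> \<le> (\<Sum>a<d. exp (- (n * q\<^sup>2 / 2)))"
    unfolding Few_def U_def by (intro sum_mono prob_few_coins[OF n A B q(1,2)]) auto
  finally have prob_Bad: "prob Bad \<le> d * exp (- (n * q\<^sup>2 / 2))" by simp

  \<comment> \<open>For fixed \<open>\<omega>\<close> the groups \<open>Jg\<close> are arbitrary
    sets of eligible coins of the right size, the same for all \<open>S\<close>; every coin outside
    their union counts as frozen.\<close>
  have pointwise: "(\<Sum>S\<in>Pow {1..n}. small_area k \<delta> R n (\<lambda>j\<in>{1..n}. Z (\<sigma> S j) \<omega>))
    \<le> ennreal (2 ^ n) * (ennreal T + ennreal (pi * R\<^sup>2) * indicator Bad \<omega>)" if \<omega>: "\<omega> \<in> space M" for \<omega>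
  proof (cases "\<omega> \<in> Bad")
    case True
    have "(\<Sum>S\<in>Pow {1..n}. small_area k \<delta> R n (\<lambda>j\<in>{1..n}. Z (\<sigma> S j) \<omega>)) \<le> (\<Sum>S\<in>Pow {1..n}. ennreal (pi * R\<^sup>2))"
      using R by (intro sum_mono small_area_le) auto
    also have "\<dots> = ennreal (2 ^ n) * ennreal (pi * R\<^sup>2)"
      by (simp add: card_Pow ennreal_of_nat_eq_real_of_nat)
    also have "\<dots> \<le> ennreal (2 ^ n) * (ennreal T + ennreal (pi * R\<^sup>2) * indicator Bad \<omega>)"
      using True by (intro mult_left_mono) (auto simp: add_increasing)
    finally show ?thesis .
  next
    case False
    have "\<exists>V. V \<subseteq> U a \<omega> \<and> card V = 2 * m" if a: "a < d" for a
    proof -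
      have "\<not> real (card (U a \<omega>)) \<le> n * q / 2" using False a \<omega> by (auto simp: Bad_def Few_def)
      then have "2 * m \<le> card (U a \<omega>)" using q(3) by linarith
      then show ?thesis by (metis obtain_subset_with_card_n)
    qed
    then have "\<forall>a. \<exists>V. a < d \<longrightarrow> V \<subseteq> U a \<omega> \<and> card V = 2 * m" by blast
    from choice[OF this] obtain Jg where Jg: "\<And>a. a < d \<Longrightarrow> Jg a \<subseteq> U a \<omega>" "\<And>a. a < d \<Longrightarrow> card (Jg a) = 2 * m"
      by blast
    define J where "J = (\<Union>a<d. Jg a)"
    have finJg: "finite (Jg a)" if "a < d" for a using Jg(2)[OF that] m by (intro card_ge_0_finite) simp
    have JgD: "Z j \<omega> \<in> A a" "Z (n + j) \<omega> \<in> B" "j \<in> {1..n}" if "a < d" "j \<in> Jg a" for a j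
      using Jg(1)[OF that(1)] that(2) by (auto simp: U_def)
    have R1pos: "R1 > 0"
    proof (rule ccontr)
      assume "\<not> R1 > 0"
      then have "R1 * e \<le> 0" using e by (simp add: mult_nonpos_nonneg)
      then show False using R1 r by simp
    qed
    \<comment> \<open>Near and far exclude each other, so no index can be eligible for two
      discs.\<close>
    have "\<rho> < R1"
    proof -
      have "r * e \<le> r" "R1 * e \<le> R1" using e r R1pos by (auto simp: mult_left_le)
      then show ?thesis using \<rho> R1 r by linarith
    qed
    have disj: "disjoint_family_on Jg {..<d}"
      unfolding disjoint_family_on_def
    proof (intro ballI impI)
      fix a a' assume a: "a \<in> {..<d}" "a' \<in> {..<d}" "a \<noteq> a'"
      show "Jg a \<inter> Jg a' = {}"
      proof (rule ccontr)
        assume "Jg a \<inter> Jg a' \<noteq> {}"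
        then obtain j where "j \<in> Jg a" "j \<in> Jg a'" by auto
        then have "Z j \<omega> \<in> A a" "Z j \<omega> \<in> A a'" using JgD a by auto
        then have "norm (Z j \<omega> - w a) \<le> \<rho>" "norm (Z j \<omega> - w a) \<ge> R1" using near far a by auto
        then show False using \<open>\<rho> < R1\<close> by linarith
      qed
    qed
    have cardJ: "card J = 2 * m * d"
    proof -
      have "card J = (\<Sum>a<d. card (Jg a))"
        unfolding J_def using disj finJg by (intro card_UN_disjoint) (auto simp: disjoint_family_on_def)
      then show ?thesis using Jg(2) by simp
    qed
    have J1: "finite J" "J \<noteq> {}"
    proof -
      show "finite J" unfolding J_def using finJg by auto
      show "J \<noteq> {}" using cardJ m d by auto
    qed
    interpret C: coin_config J Jg "\<lambda>j. Z j \<omega>" "\<lambda>j. Z (n + j) \<omega>" w d m k \<rho> R1 R0 r R e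
    proof
      show "finite J" "J \<noteq> {}" by fact+
      show "J = (\<Union>a<d. Jg a)" by (rule J_def)
      show "disjoint_family_on Jg {..<d}" by fact
      show "card (Jg a) = 2 * m" if "a < d" for a using Jg(2)[OF that] .
      show "norm (Z j \<omega> - w a) \<le> \<rho>" if "a < d" "j \<in> Jg a" for a j using near[OF that(1)] JgD(1)[OF that] .
      show "norm (Z j \<omega> - w a) \<ge> R1" if "a < d" "a' < d" "a \<noteq> a'" "j \<in> Jg a'" for a a' j
        using far[OF that(1-3)] JgD(1)[OF that(2,4)] .
      have JB: "Z (n + j) \<omega> \<in> B" if "j \<in> J" for j using that JgD(2) by (auto simp: J_def)
      show "norm (Z (n + j) \<omega> - w a) \<ge> R1" if "a < d" "j \<in> J" for a j
        using farB[OF that(1)] JB[OF that(2)] .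
      show "norm (Z (n + j) \<omega>) \<le> R0" if "j \<in> J" for j using bound(2) JB[OF that] .
      show "norm (Z j \<omega>) \<le> R0" if "j \<in> J" for j using that bound(1) JgD(1) by (auto simp: J_def)
      show "fact (Suc k) * (((4 * real (card J)) ^ k) ^ Suc k * (real (Suc k) * e)) \<le> 1 / 2"
        unfolding cardJ by (rule small)
    qed (use k w e r \<rho> R1 R0 R in auto)
    have "(\<Sum>S\<in>Pow {1..n}. small_area k \<delta> R n (\<lambda>j\<in>{1..n}. Z (\<sigma> S j) \<omega>))
      = (\<Sum>S\<in>Pow {1..n}. emeasure lborel {b \<in> cball 0 R. small_at k \<delta> {1..n} (C.coin S) b})"
    proof (rule sum.cong[OF refl])
      fix S
      have "small_area k \<delta> R n (\<lambda>j\<in>{1..n}. Z (\<sigma> S j) \<omega>) = small_area k \<delta> R n (C.coin S)"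
        by (rule small_area_cong) (auto simp: \<sigma>_def C.coin_def)
      then show "small_area k \<delta> R n (\<lambda>j\<in>{1..n}. Z (\<sigma> S j) \<omega>) = emeasure lborel {b \<in> cball 0 R. small_at k \<delta> {1..n} (C.coin S) b}"
        by (simp only: small_area_def)
    qed
    also have "\<dots> \<le> ennreal (2 ^ card {1..n} * (2 ^ (card J * Suc k) * (real (Suc k * card J) * (pi * h\<^sup>2))
        + pi * R\<^sup>2 * (real k / sqrt m) ^ d))"
    proof (rule C.sum_emeasure_small_at)
      show "J \<subseteq> {1..n}" using JgD(3) by (auto simp: J_def)
      show "fact (Suc k) * ((1 + R + R0) ^ card J) ^ Suc k * \<delta> < C.threshold h"
        unfolding C.threshold_def cardJ by (rule thr)
    qed (use m \<delta> h in auto)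
    also have "\<dots> = ennreal (2 ^ n * T)" unfolding cardJ T_def by simp
    also have "\<dots> = ennreal (2 ^ n) * ennreal T" using T by (intro ennreal_mult) auto
    finally show ?thesis using False by simp
  qed

  have "ennreal (2 ^ n) * (\<integral>\<^sup>+\<omega>. small_area k \<delta> R n (\<lambda>j. Z j \<omega>) \<partial>M)
    = (\<Sum>S\<in>Pow {1..n}. \<integral>\<^sup>+\<omega>. small_area k \<delta> R n (\<lambda>j. Z j \<omega>) \<partial>M)"
    by (simp add: card_Pow ennreal_of_nat_eq_real_of_nat)
  also have "\<dots> = (\<Sum>S\<in>Pow {1..n}. \<integral>\<^sup>+\<omega>. small_area k \<delta> R n (\<lambda>j\<in>{1..n}. Z (\<sigma> S j) \<omega>) \<partial>M)"
  proof (rule sum.cong[OF refl])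
    fix S
    have "(\<integral>\<^sup>+\<omega>. small_area k \<delta> R n (\<lambda>j\<in>{1..n}. Z (\<sigma> S j) \<omega>) \<partial>M)
      = (\<integral>\<^sup>+\<omega>. small_area k \<delta> R n (\<lambda>j\<in>{1..n}. Z j \<omega>) \<partial>M)"
    proof (rule nn_integral_reindex[OF n])
      show "inj_on (\<sigma> S) {1..n}"
      proof (rule inj_onI)
        fix i j assume "i \<in> {1..n}" "j \<in> {1..n}" "\<sigma> S i = \<sigma> S j"
        then show "i = j" by (simp add: \<sigma>_def split: if_splits)
      qed
      show "\<sigma> S j \<ge> 1" if "j \<in> {1..n}" for j using that by (simp add: \<sigma>_def)
      show "small_area k \<delta> R n \<in> borel_measurable (\<Pi>\<^sub>M j\<in>{1..n}. borel)"
        by (rule small_area_measurable_comp) (auto intro: measurable_component_singleton)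
    qed
    also have "\<dots> = (\<integral>\<^sup>+\<omega>. small_area k \<delta> R n (\<lambda>j. Z j \<omega>) \<partial>M)"
      by (intro nn_integral_cong small_area_cong) simp
    finally show "(\<integral>\<^sup>+\<omega>. small_area k \<delta> R n (\<lambda>j. Z j \<omega>) \<partial>M)
      = (\<integral>\<^sup>+\<omega>. small_area k \<delta> R n (\<lambda>j\<in>{1..n}. Z (\<sigma> S j) \<omega>) \<partial>M)" by simp
  qed
  also have "\<dots> = (\<integral>\<^sup>+\<omega>. (\<Sum>S\<in>Pow {1..n}. small_area k \<delta> R n (\<lambda>j\<in>{1..n}. Z (\<sigma> S j) \<omega>)) \<partial>M)"
  proof (rule nn_integral_sum[symmetric])
    fix S
    show "(\<lambda>\<omega>. small_area k \<delta> R n (\<lambda>j\<in>{1..n}. Z (\<sigma> S j) \<omega>)) \<in> borel_measurable M"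
    proof (rule small_area_measurable_comp)
      fix j assume j: "j \<in> {1..n}"
      then have "1 \<le> \<sigma> S j" by (simp add: \<sigma>_def)
      then show "(\<lambda>\<omega>. (\<lambda>j\<in>{1..n}. Z (\<sigma> S j) \<omega>) j) \<in> borel_measurable M"
        using j Z_measurable by simp
    qed
  qed
  also have "\<dots> \<le> (\<integral>\<^sup>+\<omega>. ennreal (2 ^ n) * (ennreal T + ennreal (pi * R\<^sup>2) * indicator Bad \<omega>) \<partial>M)"
    by (intro nn_integral_mono pointwise)
  also have "\<dots> = ennreal (2 ^ n) * (\<integral>\<^sup>+\<omega>. ennreal T + ennreal (pi * R\<^sup>2) * indicator Bad \<omega> \<partial>M)"
    by (rule nn_integral_cmult) measurable
  also have "(\<integral>\<^sup>+\<omega>. ennreal T + ennreal (pi * R\<^sup>2) * indicator Bad \<omega> \<partial>M) = ennreal T + ennreal (pi * R\<^sup>2) * emeasure M Bad"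
    by (subst nn_integral_add) (auto simp: nn_integral_cmult_indicator emeasure_space_1)
  also have "ennreal (pi * R\<^sup>2) * emeasure M Bad = ennreal (pi * R\<^sup>2 * prob Bad)"
    by (simp add: emeasure_eq_measure ennreal_mult)
  also have "ennreal T + ennreal (pi * R\<^sup>2 * prob Bad) = ennreal (T + pi * R\<^sup>2 * prob Bad)"
    using T by (intro ennreal_plus[symmetric]) auto
  also have "\<dots> \<le> ennreal (T + pi * R\<^sup>2 * (d * exp (- (n * q\<^sup>2 / 2))))"
    by (intro ennreal_leI add_left_mono mult_left_mono prob_Bad) auto
  finally have "ennreal (2 ^ n) * (\<integral>\<^sup>+\<omega>. small_area k \<delta> R n (\<lambda>j. Z j \<omega>) \<partial>M)
    \<le> ennreal (2 ^ n) * ennreal (T + pi * R\<^sup>2 * (d * exp (- (n * q\<^sup>2 / 2))))"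
    by (simp add: mult_left_mono)
  then have "(\<integral>\<^sup>+\<omega>. small_area k \<delta> R n (\<lambda>j. Z j \<omega>) \<partial>M) \<le> ennreal (T + pi * R\<^sup>2 * (d * exp (- (n * q\<^sup>2 / 2))))"
    by (subst (asm) ennreal_mult_le_mult_iff) auto
  then show ?thesis by (simp only: T_def)
qed

end

section \<open>Decay of the expected exceptional area\<close>

lemma power_exp_linear_tendsto_0:
  assumes c: "c > 0"
  shows "(\<lambda>m. A * (real m ^ q * exp (- c * real m))) \<longlonglongrightarrow> 0"
proof -
  have "((\<lambda>x::real. x ^ q / exp x) \<longlongrightarrow> 0) at_top" by (rule tendsto_power_div_exp_0)
  moreover have "filterlim (\<lambda>m. c * real m) at_top sequentially"
    using c by (intro filterlim_tendsto_pos_mult_at_top[OF tendsto_const]) (auto simp: filterlim_real_sequentially)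
  ultimately have "(\<lambda>m. (c * real m) ^ q / exp (c * real m)) \<longlonglongrightarrow> 0" by (rule filterlim_compose)
  then have "(\<lambda>m. (A / c ^ q) * ((c * real m) ^ q / exp (c * real m))) \<longlonglongrightarrow> (A / c ^ q) * 0"
    by (intro tendsto_mult tendsto_const)
  moreover have "(A / c ^ q) * ((c * real m) ^ q / exp (c * real m)) = A * (real m ^ q * exp (- c * real m))" for m
    using c by (simp add: power_mult_distrib exp_minus field_simps)
  ultimately show ?thesis by simp
qed

text \<open>The Gaussian factor beats \<open>exp (a * m)\<close>, which leaves plain exponential
  decay.\<close>

lemma power_exp_square_tendsto_0:
  assumes c: "c > 0" and A: "A \<ge> 0"
  shows "(\<lambda>m. A * (exp (a * real m) * real m ^ q * exp (- c * (real m)\<^sup>2))) \<longlonglongrightarrow> 0"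
proof (rule tendsto_sandwich[OF _ _ tendsto_const power_exp_linear_tendsto_0[of 1 A q]])
  show "\<forall>\<^sub>F m in sequentially. 0 \<le> A * (exp (a * real m) * real m ^ q * exp (- c * (real m)\<^sup>2))"
    using A by simp
  obtain m0 where m0: "(a + 1) / c \<le> real m0" using real_arch_simple by blast
  show "\<forall>\<^sub>F m in sequentially. A * (exp (a * real m) * real m ^ q * exp (- c * (real m)\<^sup>2)) \<le> A * (real m ^ q * exp (- 1 * real m))"
    using eventually_ge_at_top[of m0]
  proof eventually_elim
    case (elim m)
    have "(a + 1) / c \<le> real m" using m0 elim by linarith
    then have "a + 1 \<le> c * real m" using c by (simp add: field_simps)
    then have "(a + 1) * real m \<le> (c * real m) * real m" by (intro mult_right_mono) auto
    then have "a * real m + - c * (real m)\<^sup>2 \<le> - 1 * real m" by (simp add: algebra_simps power2_eq_square)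
    then have "exp (a * real m) * exp (- c * (real m)\<^sup>2) \<le> exp (- 1 * real m)" by (simp flip: exp_add)
    then have "(exp (a * real m) * exp (- c * (real m)\<^sup>2)) * real m ^ q \<le> exp (- 1 * real m) * real m ^ q"
      by (intro mult_right_mono) auto
    then show ?case using A by (intro mult_left_mono) (auto simp: mult_ac)
  qed
qed simp

lemma exists_power_bracket:
  fixes n p :: nat
  assumes "p \<ge> 1"
  obtains m where "m ^ p \<le> n" "n < (m + 1) ^ p"
proof -
  define m where "m = (LEAST m. n < (m + 1) ^ p)"
  have "n + 1 \<le> (n + 1) ^ p" using assms self_le_power[of "n + 1" p] by simp
  then have "n < (n + 1) ^ p" by simp
  then have 1: "n < (m + 1) ^ p" unfolding m_def by (rule LeastI)
  have "m ^ p \<le> n"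
  proof (cases m)
    case 0
    then show ?thesis using assms by (simp add: power_0_left)
  next
    case (Suc m')
    then have "\<not> n < (m' + 1) ^ p" using not_less_Least[of m' "\<lambda>m. n < (m + 1) ^ p"] by (simp add: m_def)
    then show ?thesis using Suc by simp
  qed
  with 1 that show ?thesis by blast
qed

context iid_complex
begin

lemma small_area_mono: "R \<le> R' \<Longrightarrow> small_area k \<delta> R n c \<le> small_area k \<delta> R' n c"
  unfolding small_area_eq_nn_integral by (intro nn_integral_mono) (auto simp: indicator_def)

text \<open>All scales are tied to \<open>m\<close>, the integer part of the \<open>p\<close>-th
  root of \<open>n\<close>: \<open>e\<close> and \<open>r\<close> are of order
  \<open>m ^ (- B)\<close>, \<open>\<rho>\<close> of order \<open>m ^ (- 2 * B)\<close>, and the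
  bound \<open>q\<close> on the density of eligible coins of order \<open>m ^ (- 4 * B)\<close>. The
  radius \<open>h\<close> decays like \<open>exp (- c3 * m ^ 2)\<close>, up to a power of
  \<open>m\<close>: fast enough to beat the number of tuples, slow enough that
  \<open>threshold h\<close>, roughly \<open>exp (- \<epsilon> * m ^ 3)\<close>, can be kept above
  the bound that \<open>exp (- \<epsilon> * n)\<close> gives for the Wronskian.\<close>

lemma expected_small_area_decay:
  fixes k :: nat and \<epsilon> R :: real
  assumes sep: "\<forall>d. \<exists>s r. 0 < r \<and> r \<le> 1 \<and> (\<forall>a\<le>(d::nat). measure \<mu> (ball (s a) r) > 0) \<and>
      (\<forall>a\<le>d. \<forall>a'\<le>d. a \<noteq> a' \<longrightarrow> (\<forall>x\<in>ball (s a) r. \<forall>y\<in>ball (s a') r. norm (x - y) \<ge> r))"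
    and k: "k \<ge> 1" and \<epsilon>: "\<epsilon> > 0"
  shows "\<exists>C n0. C \<ge> 0 \<and> (\<forall>n\<ge>n0. (\<integral>\<^sup>+\<omega>. small_area k (exp (- \<epsilon> * n)) R n (\<lambda>j. Z j \<omega>) \<partial>M) \<le> ennreal (C / (real n)\<^sup>2))"
proof -
  \<comment> \<open>The power of \<open>m\<close> in the smallness condition of
    \<open>wronskian_lower_bound\<close>: entries of order \<open>m ^ k\<close> in a determinant of
    size \<open>Suc k\<close>.\<close>
  define B where "B = k * Suc k"
  have B: "B \<ge> 2" using k mult_le_mono[of 1 k 2 "Suc k"] by (simp add: B_def)
  \<comment> \<open>With \<open>n \<ge> m ^ p\<close> this gives
    \<open>n * q m \<ge> c4 * m ^ (12 * B)\<close> and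
    \<open>n * (q m) ^ 2 \<ge> c4 ^ 2 * m ^ (8 * B)\<close>.\<close>
  define p where "p = 16 * B"
  \<comment> \<open>Makes \<open>(1 / sqrt m) ^ d\<close> equal to \<open>m ^ (- 2 * p)\<close>,
    which is of order \<open>n ^ (- 2)\<close> and thus summable.\<close>
  define d where "d = 4 * p"
  have d: "d \<ge> 1" "d > 0" using B by (auto simp: d_def p_def)
  obtain s r1 where r1: "0 < r1" "r1 \<le> 1" and pos: "\<And>a. a \<le> d \<Longrightarrow> measure \<mu> (ball (s a) r1) > 0"
    and apart: "\<And>a a' x y. a \<le> d \<Longrightarrow> a' \<le> d \<Longrightarrow> a \<noteq> a' \<Longrightarrow> x \<in> ball (s a) r1 \<Longrightarrow> y \<in> ball (s a') r1 \<Longrightarrow> norm (x - y) \<ge> r1"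
    using sep by metis
  define c0 where "c0 = Min ((\<lambda>a. measure \<mu> (ball (s a) r1)) ` {..d})"
  have c0: "c0 > 0" unfolding c0_def using pos by (subst Min_gr_iff) auto
  have c0_le: "c0 \<le> measure \<mu> (ball (s a) r1)" if "a \<le> d" for a
    unfolding c0_def using that by (intro Min_le) auto
  define R0 where "R0 = Max ((\<lambda>a. norm (s a)) ` {..d}) + 1"
  have norm_s: "norm (s a) + 1 \<le> R0" if "a \<le> d" for a
    unfolding R0_def using that by (auto intro!: Max_ge)
  have R0: "R0 \<ge> 1" using norm_s[of 0] norm_ge_zero[of "s 0"] by linarith
  have ball_bound: "norm x \<le> R0" if "a \<le> d" "x \<in> ball (s a) r1" for a x
    using norm_s[OF that(1)] that(2) r1 norm_triangle_ineq2[of x "s a"] by (auto simp: dist_norm norm_minus_commute)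
  \<comment> \<open>The window is enlarged so that it contains the points \<open>w a + r\<close> at
    which the Wronskians are bounded below.\<close>
  define R' where "R' = max R (R0 + 1)"
  have R': "R' \<ge> R0 + 1" "R' > 0" "R \<le> R'" using R0 by (auto simp: R'_def)
  \<comment> \<open>Chosen so that \<open>e m = 1 / (c1 * m ^ B)\<close> turns the smallness
    condition into an equality with \<open>1 / 2\<close>.\<close>
  define c1 where "c1 = 2 * fact (Suc k) * real (Suc k) * (8 * real d) ^ B"
  have c1: "c1 \<ge> 1"
  proof -
    have "(1::real) \<le> (8 * real d) ^ B" using d by (intro one_le_power) simp
    moreover have "(1::real) \<le> 2 * fact (Suc k) * real (Suc k)"
      using fact_ge_1[of "Suc k", where 'a = real] mult_mono[of 1 "2 * fact (Suc k)" 1 "real (Suc k)"] by simp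
    ultimately have "1 * 1 \<le> c1" unfolding c1_def by (intro mult_mono) auto
    then show ?thesis by simp
  qed
  define e where "e = (\<lambda>m. 1 / (c1 * real m ^ B))"
  define r where "r = (\<lambda>m. r1 * e m / 2)"
  define \<rho> where "\<rho> = (\<lambda>m. r m * e m / 2)"
  \<comment> \<open>The constant in \<open>q m = (c0 * (\<rho> m) ^ 2 / 100) * c0\<close>, the mass
    of a small set in one ball times the mass of the tails ball; 1600 is 16 from
    \<open>(\<rho> m) ^ 2\<close> times 100 from the grid.\<close>
  define c4 where "c4 = c0\<^sup>2 * r1\<^sup>2 / (1600 * c1 ^ 4)"
  have c4: "c4 > 0" using c0 r1 c1 by (simp add: c4_def)
  define q where "q = (\<lambda>m. c4 / real m ^ (4 * B))"
  \<comment> \<open>Such that \<open>D m * c3 * m ^ 2 = \<epsilon> * m ^ 3\<close>.\<close>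
  define c3 where "c3 = \<epsilon> / (2 * real d * real (Suc k))"
  have c3: "c3 > 0" using \<epsilon> d by (simp add: c3_def)
  \<comment> \<open>\<open>1 + R' + R0\<close> absorbs the bound on the Taylor coefficients;
    \<open>4 * fact (Suc k)\<close>, raised to the power \<open>D m \<ge> 1\<close>, absorbs the
    factorial and the \<open>1 / 2\<close> and keeps the inequality strict.\<close>
  define K0 where "K0 = (1 + R' + R0) * (4 * fact (Suc k))"
  have K0: "K0 > 0" using R' R0 by (simp add: K0_def)
  \<comment> \<open>Makes \<open>h m\<close> the solution of
    \<open>(r m / 2) * (h m / (3 * R')) = K0 * exp (- c3 * m ^ 2)\<close>.\<close>
  define K1 where "K1 = 3 * R' * K0 * (4 * c1 / r1)"
  have K1: "K1 > 0" using R' K0 c1 r1 by (simp add: K1_def)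
  define h where "h = (\<lambda>m. K1 * real m ^ B * exp (- c3 * (real m)\<^sup>2))"
  define D where "D = (\<lambda>m::nat. Suc k * (2 * m * d))"

  have e_bounds: "0 < e m" "e m \<le> 1" if "m \<ge> 1" for m
  proof -
    have "1 \<le> real m ^ B" using that by (intro one_le_power) simp
    then have "1 * 1 \<le> c1 * real m ^ B" using c1 by (intro mult_mono) auto
    then show "0 < e m" "e m \<le> 1" unfolding e_def by (auto simp: field_simps)
  qed
  have r_bounds: "0 < r m" "r m \<le> 1" "0 < \<rho> m" "\<rho> m \<le> 1" if "m \<ge> 1" for m
  proof -
    show r0: "0 < r m" using r1 e_bounds[OF that] by (simp add: r_def)
    have "r1 * e m \<le> 1 * 1" using r1 e_bounds[OF that] by (intro mult_mono) auto
    then show r1': "r m \<le> 1" by (simp add: r_def)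
    show "0 < \<rho> m" using r0 e_bounds[OF that] by (simp add: \<rho>_def)
    have "r m * e m \<le> 1 * 1" using r0 r1' e_bounds[OF that] by (intro mult_mono) auto
    then show "\<rho> m \<le> 1" by (simp add: \<rho>_def)
  qed

  have bound: "(\<integral>\<^sup>+\<omega>. small_area k (exp (- \<epsilon> * n)) R' n (\<lambda>j. Z j \<omega>) \<partial>M)
    \<le> ennreal (2 ^ (2 * m * d * Suc k) * (real (D m) * (pi * (h m)\<^sup>2))
        + pi * R'\<^sup>2 * (real k / sqrt m) ^ d + pi * R'\<^sup>2 * (d * exp (- (n * (q m)\<^sup>2 / 2))))"
    if m: "m \<ge> 1" and n: "m ^ p \<le> n" and hm: "h m \<le> R'" and mq: "real (2 * m) \<le> n * q m / 2" for m n
  proof -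
    have n1: "n \<ge> 1" using m n one_le_power[of m p] by linarith
    \<comment> \<open>Inside each ball a set of diameter at most \<open>\<rho> m\<close> is
      selected, with one of its own points as centre; since \<open>w a\<close> then lies in the
      ball, the separation of the balls gives the far condition with \<open>R1 = r1\<close>.\<close>
    define P where "P = (\<lambda>a A w. A \<in> sets borel \<and> A \<subseteq> ball (s a) r1 \<and> w \<in> A \<and> (\<forall>x\<in>A. norm (x - w) \<le> \<rho> m) \<and>
      measure \<mu> A \<ge> c0 * (\<rho> m)\<^sup>2 / 100)"
    have ex: "\<exists>A w. P a A w" if a: "a < d" for a
    proof -
      have fm: "finite_measure \<mu>" using prob_\<mu> by (rule prob_space.finite_measure)
      have sub: "ball (s a) r1 \<subseteq> ball (s a) 1" using r1 by auto
      obtain A where A: "A \<in> sets borel" "A \<subseteq> ball (s a) r1" "\<And>x y. x \<in> A \<Longrightarrow> y \<in> A \<Longrightarrow> norm (x - y) \<le> \<rho> m"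
        "measure \<mu> A \<ge> measure \<mu> (ball (s a) r1) * (\<rho> m)\<^sup>2 / 100"
        by (rule exists_small_set_of_large_measure[OF fm sets_\<mu> r_bounds(3,4)[OF m] _ sub]) auto
      have "c0 * (\<rho> m)\<^sup>2 \<le> measure \<mu> (ball (s a) r1) * (\<rho> m)\<^sup>2" using c0_le[of a] a by (intro mult_right_mono) auto
      then have large: "measure \<mu> A \<ge> c0 * (\<rho> m)\<^sup>2 / 100" using A(4) by simp
      moreover have "c0 * (\<rho> m)\<^sup>2 / 100 > 0" using c0 r_bounds[OF m] by simp
      ultimately have "A \<noteq> {}" by auto
      then obtain w where "w \<in> A" by blast
      then have "P a A w" using A large by (auto simp: P_def)
      then show ?thesis by blast
    qed
    from ex have "\<forall>a. \<exists>A w. a < d \<longrightarrow> P a A w" by blast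
    then obtain A w where AwP: "\<And>a. a < d \<Longrightarrow> P a (A a) (w a)" by metis
    have Aw: "\<And>a. a < d \<Longrightarrow> A a \<in> sets borel" "\<And>a. a < d \<Longrightarrow> A a \<subseteq> ball (s a) r1" "\<And>a. a < d \<Longrightarrow> w a \<in> A a"
      "\<And>a x. a < d \<Longrightarrow> x \<in> A a \<Longrightarrow> norm (x - w a) \<le> \<rho> m" "\<And>a. a < d \<Longrightarrow> measure \<mu> (A a) \<ge> c0 * (\<rho> m)\<^sup>2 / 100"
      using AwP unfolding P_def by simp_all
    have wb: "w a \<in> ball (s a) r1" if "a < d" for a using Aw that by blast
    have mB: "real m ^ B > 0" using m by simp
    \<comment> \<open>Here \<open>n \<ge> m ^ p \<ge> m ^ 3\<close> enters, which makes
      \<open>exp (- \<epsilon> * n)\<close> small on the scale of \<open>m\<close>.\<close>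
    have exp_D: "exp (- c3 * (real m)\<^sup>2) ^ D m \<ge> exp (- \<epsilon> * n)"
    proof -
      have eq1: "exp (- c3 * (real m)\<^sup>2) ^ D m = exp (- (real (D m) * c3 * (real m)\<^sup>2))"
        by (simp flip: exp_of_nat_mult)
      have eq2: "real (D m) * c3 * (real m)\<^sup>2 = \<epsilon> * real m ^ 3"
      proof -
        define x where "x = 2 * real d * real (Suc k)"
        have "x > 0" unfolding x_def using d by (intro mult_pos_pos) auto
        moreover have "real (D m) = x * real m" by (simp add: x_def D_def algebra_simps)
        moreover have "c3 = \<epsilon> / x" by (simp only: x_def c3_def)
        ultimately show ?thesis by (simp add: power2_eq_square power3_eq_cube)
      qed
      have "real m ^ 3 \<le> real m ^ p" using m B by (intro power_increasing) (auto simp: p_def)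
      also have "real m ^ p \<le> real n" using n by (metis of_nat_le_iff of_nat_power)
      finally have "\<epsilon> * real m ^ 3 \<le> \<epsilon> * real n" using \<epsilon> by (intro mult_left_mono) auto
      then show ?thesis unfolding eq1 eq2 by simp
    qed
    show ?thesis
      unfolding D_def
    proof (rule expected_small_area_le[where A = A and B = "ball (s d) r1" and w = w and \<rho> = "\<rho> m" and ?R1.0 = r1
          and ?R0.0 = R0 and r = "r m" and e = "e m"])
      show "norm (x - w a) \<ge> r1" if "a < d" "a' < d" "a \<noteq> a'" "x \<in> A a'" for a a' x
        using apart[of a' a x "w a"] that Aw(2)[of a'] wb[of a] by auto
      show "norm (x - w a) \<ge> r1" if "a < d" "x \<in> ball (s d) r1" for a x
        using apart[of d a x "w a"] that wb[of a] by auto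
      show "norm x \<le> R0" if "a < d" "x \<in> A a" for a x using ball_bound[of a x] that Aw(2)[of a] by auto
      show "norm x \<le> R0" if "x \<in> ball (s d) r1" for x using ball_bound[of d x] that by auto
      show "norm (w a) + r m \<le> R'" if "a < d" for a
        using ball_bound[of a "w a"] wb[OF that] that r_bounds[OF m] R' by simp
      show "fact (Suc k) * (((4 * real (2 * m * d)) ^ k) ^ Suc k * (real (Suc k) * e m)) \<le> 1 / 2"
      proof -
        have "((4 * real (2 * m * d)) ^ k) ^ Suc k = (8 * real d) ^ B * real m ^ B"
          unfolding power_mult[symmetric] B_def[symmetric] power_mult_distrib[symmetric] by (simp add: mult_ac)
        then have "fact (Suc k) * (((4 * real (2 * m * d)) ^ k) ^ Suc k * (real (Suc k) * e m))
          = (c1 * real m ^ B / 2) * e m" by (simp add: c1_def)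
        also have "\<dots> = 1 / 2" using c1 mB by (simp add: e_def)
        finally show ?thesis by simp
      qed
      show "q m \<le> measure \<mu> (A a) * measure \<mu> (ball (s d) r1)" if a: "a < d" for a
      proof -
        have "q m = (c0 * (\<rho> m)\<^sup>2 / 100) * c0"
        proof -
          define x where "x = real m ^ B"
          have x4: "real m ^ (4 * B) = x ^ 4" by (simp add: x_def mult.commute flip: power_mult)
          have em: "e m = 1 / (c1 * x)" by (simp add: e_def x_def)
          have "\<rho> m = r1 * (e m)\<^sup>2 / 4" by (simp add: \<rho>_def r_def power2_eq_square)
          also have "\<dots> = r1 / (4 * (c1 * x)\<^sup>2)" unfolding em by (simp add: power_divide)
          finally have "(\<rho> m)\<^sup>2 = r1\<^sup>2 / (16 * ((c1 * x)\<^sup>2)\<^sup>2)" by (simp add: power_divide power_mult_distrib)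
          also have "((c1 * x)\<^sup>2)\<^sup>2 = c1 ^ 4 * x ^ 4" by (simp add: power_mult_distrib flip: power_mult)
          finally have \<rho>2: "(\<rho> m)\<^sup>2 = r1\<^sup>2 / (16 * (c1 ^ 4 * x ^ 4))" .
          have n1600: "(1600 :: real) = 16 * 100" by simp
          show ?thesis unfolding \<rho>2 q_def c4_def x4 n1600
            by (simp only: divide_inverse inverse_mult_distrib power2_eq_square mult_ac)
        qed
        also have "\<dots> \<le> measure \<mu> (A a) * measure \<mu> (ball (s d) r1)"
          using Aw(5)[OF a] c0_le[of d] c0 by (intro mult_mono) auto
        finally show ?thesis .
      qed
      show "fact (Suc k) * ((1 + R' + R0) ^ (2 * m * d)) ^ Suc k * exp (- \<epsilon> * n)
        < ((1 / 2) * (r m / 2) ^ (Suc k * (2 * m * d))) * (h m / (3 * R')) ^ (Suc k * (2 * m * d))"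
      proof -
        have "0 < D m" unfolding D_def using m d by (intro mult_pos_pos) auto
        then have Dm: "D m \<ge> 1" by linarith
        have prod: "(r m / 2) * (h m / (3 * R')) = K0 * exp (- c3 * (real m)\<^sup>2)"
        proof -
          define x where "x = real m ^ B"
          define E where "E = exp (- c3 * (real m)\<^sup>2)"
          have "x > 0" using mB by (simp only: x_def)
          moreover have "r m = r1 * (1 / (c1 * x)) / 2" "h m = K1 * x * E"
            by (simp_all only: r_def e_def h_def x_def E_def)
          ultimately have "(r m / 2) * (h m / (3 * R')) = K0 * E"
            using c1 r1 R' by (simp add: K1_def)
          then show ?thesis by (simp only: E_def)
        qed
        define f where "f = (fact (Suc k) :: real)"
        have f: "f \<ge> 1" unfolding f_def by (rule fact_ge_1)
        have "fact (Suc k) * ((1 + R' + R0) ^ (2 * m * d)) ^ Suc k * exp (- \<epsilon> * n)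
          = f * (1 + R' + R0) ^ D m * exp (- \<epsilon> * n)"
          unfolding D_def f_def by (simp only: power_mult[symmetric] mult.commute)
        also have "\<dots> \<le> f * (1 + R' + R0) ^ D m * exp (- c3 * (real m)\<^sup>2) ^ D m"
          using f R' R0 exp_D by (intro mult_left_mono) auto
        also have "\<dots> < (2 * f) * (1 + R' + R0) ^ D m * exp (- c3 * (real m)\<^sup>2) ^ D m"
          using f R' R0 by (intro mult_strict_right_mono zero_less_power) auto
        also have "\<dots> \<le> (1 / 2 * (4 * f) ^ D m) * (1 + R' + R0) ^ D m * exp (- c3 * (real m)\<^sup>2) ^ D m"
        proof (intro mult_right_mono)
          have "(4 * f) ^ 1 \<le> (4 * f) ^ D m" using f Dm by (intro power_increasing) auto
          then show "2 * f \<le> 1 / 2 * (4 * f) ^ D m" by simp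
        qed (use R' R0 in auto)
        also have "\<dots> = 1 / 2 * (K0 * exp (- c3 * (real m)\<^sup>2)) ^ D m"
          by (simp add: K0_def f_def power_mult_distrib)
        also have "\<dots> = 1 / 2 * ((r m / 2) ^ D m * (h m / (3 * R')) ^ D m)"
          unfolding prod[symmetric] power_mult_distrib ..
        finally show ?thesis unfolding D_def by (simp only: mult.assoc)
      qed
      show "0 < h m" using K1 mB by (simp add: h_def)
      show "r m \<le> r1 * e m / 2" "\<rho> m \<le> r m * e m / 2" by (simp_all add: r_def \<rho>_def)
    qed (use n1 m d k Aw e_bounds[OF m] r_bounds[OF m] R0 R' mq hm c4 in \<open>auto simp: q_def\<close>)
  qed

  \<comment> \<open>Half of \<open>d\<close>: the power of \<open>m\<close> that each of the three
    terms has to gain.\<close>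
  define Kq where "Kq = 2 * p"
  have ev1: "\<forall>\<^sub>F m in sequentially. h m \<le> R'"
  proof -
    have "(\<lambda>m. K1 * (exp (0 * real m) * real m ^ B * exp (- c3 * (real m)\<^sup>2))) \<longlonglongrightarrow> 0"
      using K1 c3 by (intro power_exp_square_tendsto_0) auto
    then have "h \<longlonglongrightarrow> 0" by (simp add: h_def mult_ac)
    from order_tendstoD(2)[OF this R'(2)] show ?thesis by (rule eventually_mono) simp
  qed
  have ev2: "\<forall>\<^sub>F m in sequentially. 2 ^ (2 * m * d * Suc k) * (real (D m) * (pi * (h m)\<^sup>2)) * real m ^ Kq \<le> 1"
  proof -
    define Q where "Q = real (Suc k) * 2 * real d * pi * K1\<^sup>2"
    define a where "a = 2 * real d * real (Suc k) * ln 2"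
    have "(\<lambda>m. Q * (exp (a * real m) * real m ^ (1 + 2 * B + Kq) * exp (- (2 * c3) * (real m)\<^sup>2))) \<longlonglongrightarrow> 0"
      using c3 by (intro power_exp_square_tendsto_0) (auto simp: Q_def)
    moreover have "Q * (exp (a * real m) * real m ^ (1 + 2 * B + Kq) * exp (- (2 * c3) * (real m)\<^sup>2))
      = 2 ^ (2 * m * d * Suc k) * (real (D m) * (pi * (h m)\<^sup>2)) * real m ^ Kq" for m
    proof -
      have "(2::real) ^ (2 * m * d * Suc k) = exp (real (2 * m * d * Suc k) * ln 2)"
        by (simp only: exp_of_nat_mult) simp
      also have "real (2 * m * d * Suc k) * ln 2 = a * real m" by (simp add: a_def algebra_simps)
      finally have 1: "(2::real) ^ (2 * m * d * Suc k) = exp (a * real m)" .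
      have "exp (- c3 * (real m)\<^sup>2) ^ 2 = exp (- (2 * c3) * (real m)\<^sup>2)" by (simp flip: exp_of_nat_mult)
      then have 2: "(h m)\<^sup>2 = K1\<^sup>2 * real m ^ (2 * B) * exp (- (2 * c3) * (real m)\<^sup>2)"
        by (simp add: h_def power_mult_distrib power_mult[symmetric] mult.commute)
      show ?thesis unfolding 1 2 by (simp add: D_def Q_def power_add algebra_simps)
    qed
    ultimately have "(\<lambda>m. 2 ^ (2 * m * d * Suc k) * (real (D m) * (pi * (h m)\<^sup>2)) * real m ^ Kq) \<longlonglongrightarrow> 0" by simp
    from order_tendstoD(2)[OF this, of 1] show ?thesis by (auto elim: eventually_mono)
  qed
  have ev3: "\<forall>\<^sub>F m in sequentially. real d * (real m ^ Kq * exp (- (c4\<^sup>2 / 2) * real m)) \<le> 1"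
  proof -
    have "(\<lambda>m. real d * (real m ^ Kq * exp (- (c4\<^sup>2 / 2) * real m))) \<longlonglongrightarrow> 0"
      using c4 by (intro power_exp_linear_tendsto_0) auto
    from order_tendstoD(2)[OF this, of 1] show ?thesis by (auto elim: eventually_mono)
  qed
  have ev4: "\<forall>\<^sub>F m in sequentially. real m \<ge> 4 / c4"
    using filterlim_real_sequentially by (simp add: filterlim_at_top)
  have "\<forall>\<^sub>F m in sequentially. m \<ge> 1 \<and> h m \<le> R' \<and> real m \<ge> 4 / c4 \<and>
      2 ^ (2 * m * d * Suc k) * (real (D m) * (pi * (h m)\<^sup>2)) * real m ^ Kq \<le> 1 \<and>
      real d * (real m ^ Kq * exp (- (c4\<^sup>2 / 2) * real m)) \<le> 1"
    using ev1 ev2 ev3 ev4 eventually_ge_at_top[of 1] by eventually_elim auto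
  then obtain m0 where m0: "\<And>m. m \<ge> m0 \<Longrightarrow> m \<ge> 1 \<and> h m \<le> R' \<and> real m \<ge> 4 / c4 \<and>
      2 ^ (2 * m * d * Suc k) * (real (D m) * (pi * (h m)\<^sup>2)) * real m ^ Kq \<le> 1 \<and>
      real d * (real m ^ Kq * exp (- (c4\<^sup>2 / 2) * real m)) \<le> 1"
    unfolding eventually_sequentially by blast

  define C0 where "C0 = 1 + pi * R'\<^sup>2 * real k ^ d + pi * R'\<^sup>2"
  have C0: "C0 \<ge> 0" by (simp add: C0_def)
  \<comment> \<open>The factor \<open>2 ^ Kq\<close> comes from
    \<open>n < (m + 1) ^ p \<le> (2 * m) ^ p\<close>.\<close>
  define C where "C = C0 * 2 ^ Kq"
  have "(\<integral>\<^sup>+\<omega>. small_area k (exp (- \<epsilon> * n)) R n (\<lambda>j. Z j \<omega>) \<partial>M) \<le> ennreal (C / (real n)\<^sup>2)"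
    if n: "n \<ge> (m0 + 1) ^ p" for n
  proof -
    obtain m where m: "m ^ p \<le> n" "n < (m + 1) ^ p"
      using exists_power_bracket[of p n] B by (auto simp: p_def)
    have "(m0 + 1) ^ p < (m + 1) ^ p" using n m by linarith
    then have "m \<ge> m0" using power_less_imp_less_base by (metis Suc_eq_plus1 Suc_less_eq less_imp_le zero_le)
    note M = m0[OF this]
    have m1: "m \<ge> 1" using M by simp
    have mp: "real m ^ p \<le> real n" using m(1) by (metis of_nat_le_iff of_nat_power)
    have m0': "real m > 0" "real m \<ge> 1" using m1 by auto
    have mK: "real m ^ Kq > 0" using m0' by simp
    have nq: "real (2 * m) \<le> n * q m / 2"
    proof -
      have "real m ^ 2 \<le> real m ^ (12 * B)" using m0' B by (intro power_increasing) auto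
      then have "c4 * real m ^ 2 \<le> c4 * real m ^ (12 * B)" using c4 by simp
      also have "\<dots> = real m ^ p * q m"
        using m0' by (simp add: q_def p_def field_simps flip: power_add)
      also have "\<dots> \<le> n * q m" using mp c4 by (intro mult_right_mono) (auto simp: q_def)
      finally have 1: "c4 * real m ^ 2 \<le> n * q m" .
      have "4 \<le> c4 * real m" using M c4 by (simp add: field_simps)
      then have "4 * real m \<le> c4 * real m * real m" using m0' by (intro mult_right_mono) auto
      then show ?thesis using 1 by (simp add: power2_eq_square mult.assoc)
    qed
    have nq2: "exp (- (n * (q m)\<^sup>2 / 2)) \<le> exp (- (c4\<^sup>2 / 2) * real m)"
    proof -
      have "real m ^ 1 \<le> real m ^ (8 * B)" using m0' B by (intro power_increasing) auto
      then have "c4\<^sup>2 * real m \<le> c4\<^sup>2 * real m ^ (8 * B)" using c4 by simp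
      also have "\<dots> = real m ^ p * (q m)\<^sup>2"
        using m0' by (simp add: q_def p_def power_divide field_simps flip: power_mult power_add)
      also have "\<dots> \<le> n * (q m)\<^sup>2" using mp by (intro mult_right_mono) auto
      finally show ?thesis by simp
    qed
    have t1: "2 ^ (2 * m * d * Suc k) * (real (D m) * (pi * (h m)\<^sup>2)) \<le> 1 / real m ^ Kq"
      using M mK by (simp add: field_simps)
    have t2: "(real k / sqrt m) ^ d = real k ^ d / real m ^ Kq"
    proof -
      have "sqrt (real m) ^ d = (sqrt (real m) ^ 2) ^ Kq" unfolding power_mult[symmetric] by (simp add: d_def Kq_def)
      also have "\<dots> = real m ^ Kq" by simp
      finally show ?thesis by (simp add: power_divide)
    qed
    have t3: "d * exp (- (n * (q m)\<^sup>2 / 2)) \<le> 1 / real m ^ Kq"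
    proof -
      have "d * exp (- (n * (q m)\<^sup>2 / 2)) \<le> d * exp (- (c4\<^sup>2 / 2) * real m)" using nq2 by (intro mult_left_mono) auto
      also have "\<dots> \<le> 1 / real m ^ Kq" using M mK by (simp add: field_simps)
      finally show ?thesis .
    qed
    have "(\<integral>\<^sup>+\<omega>. small_area k (exp (- \<epsilon> * n)) R n (\<lambda>j. Z j \<omega>) \<partial>M)
      \<le> (\<integral>\<^sup>+\<omega>. small_area k (exp (- \<epsilon> * n)) R' n (\<lambda>j. Z j \<omega>) \<partial>M)"
      by (intro nn_integral_mono small_area_mono R')
    also have "\<dots> \<le> ennreal (2 ^ (2 * m * d * Suc k) * (real (D m) * (pi * (h m)\<^sup>2))
        + pi * R'\<^sup>2 * (real k / sqrt m) ^ d + pi * R'\<^sup>2 * (d * exp (- (n * (q m)\<^sup>2 / 2))))"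
      using M m(1) nq by (intro bound) auto
    also have "\<dots> \<le> ennreal (C / (real n)\<^sup>2)"
    proof (rule ennreal_leI)
      have "2 ^ (2 * m * d * Suc k) * (real (D m) * (pi * (h m)\<^sup>2))
        + pi * R'\<^sup>2 * (real k / sqrt m) ^ d + pi * R'\<^sup>2 * (d * exp (- (n * (q m)\<^sup>2 / 2)))
        \<le> 1 / real m ^ Kq + pi * R'\<^sup>2 * (real k ^ d / real m ^ Kq) + pi * R'\<^sup>2 * (1 / real m ^ Kq)"
        unfolding t2 by (intro add_mono t1 mult_left_mono t3) auto
      also have "\<dots> = C0 / real m ^ Kq" by (simp add: C0_def add_divide_distrib)
      also have "\<dots> \<le> C / (real n)\<^sup>2"
      proof -
        have n0: "real n > 0" using mp m0' by (meson less_le_trans zero_less_power)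
        have "real n \<le> (2 * real m) ^ p"
        proof -
          have "real n \<le> real ((m + 1) ^ p)" using m(2) by (simp only: of_nat_le_iff)
          also have "\<dots> = (real m + 1) ^ p" by (simp add: add.commute)
          also have "\<dots> \<le> (2 * real m) ^ p" using m0' by (intro power_mono) auto
          finally show ?thesis .
        qed
        then have "(real n)\<^sup>2 \<le> ((2 * real m) ^ p)\<^sup>2" using n0 by (intro power_mono) auto
        also have "\<dots> = 2 ^ Kq * real m ^ Kq" by (simp add: Kq_def power_mult_distrib mult.commute flip: power_mult)
        finally have "C0 * (real n)\<^sup>2 \<le> C0 * (2 ^ Kq * real m ^ Kq)" using C0 by (intro mult_left_mono)
        then show ?thesis using n0 mK by (simp add: C_def field_simps)
      qed
      finally show "2 ^ (2 * m * d * Suc k) * (real (D m) * (pi * (h m)\<^sup>2))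
        + pi * R'\<^sup>2 * (real k / sqrt m) ^ d + pi * R'\<^sup>2 * (d * exp (- (n * (q m)\<^sup>2 / 2))) \<le> C / (real n)\<^sup>2" .
    qed
    finally show ?thesis .
  qed
  moreover have "C \<ge> 0" using C0 by (simp add: C_def)
  ultimately show ?thesis by blast
qed

end

section \<open>Zeros of the derivatives\<close>

lemma random_poly_eq_root_poly: "random_poly z n = root_poly {1..n} z"
  by (simp add: random_poly_def root_poly_def)

section \<open>Integration against the zero measure\<close>

lemma sum_mset_eq_sum_count:
  fixes f :: "'a \<Rightarrow> 'b::comm_semiring_1"
  assumes "finite S" "set_mset X \<subseteq> S"
  shows "(\<Sum>x\<in>#X. f x) = (\<Sum>x\<in>S. of_nat (count X x) * f x)"
  using assms(2)
proof (induction X)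
  case (add y X)
  have "(\<Sum>x\<in>S. of_nat (count (add_mset y X) x) * f x)
    = (\<Sum>x\<in>S. of_nat (count X x) * f x + (if x = y then f y else 0))"
    by (intro sum.cong refl) (auto simp: algebra_simps)
  also have "\<dots> = (\<Sum>x\<in>#X. f x) + f y"
    using add assms(1) by (simp add: sum.distrib)
  finally show ?case by (simp add: add.commute)
qed simp

text \<open>Read as the law of a uniformly chosen element of the multiset, the measure inherits the
  finite-sum formulas for integrals over a \<open>pmf\<close>.\<close>

lemma deriv_zeros_measure_eq_distr:
  fixes z :: "nat \<Rightarrow> complex"
  assumes "k < n"
  defines "X \<equiv> proots ((pderiv ^^ k) (random_poly z n))"
  shows "deriv_zeros_measure z k n = distr (measure_pmf (pmf_of_multiset X)) borel (\<lambda>x. x)"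
proof (rule measure_eqI)
  have size: "size X = n - k"
    by (simp add: X_def size_proots_complex degree_funpow_pderiv degree_random_poly)
  then have X: "X \<noteq> {#}" using assms(1) by auto
  show "sets (deriv_zeros_measure z k n) = sets (distr (measure_pmf (pmf_of_multiset X)) borel (\<lambda>x. x))" by simp
  fix A assume "A \<in> sets (deriv_zeros_measure z k n)"
  then have A: "A \<in> sets borel" by simp
  have "emeasure (distr (measure_pmf (pmf_of_multiset X)) borel (\<lambda>x. x)) A = emeasure (measure_pmf (pmf_of_multiset X)) A"
    using A by (subst emeasure_distr) auto
  also have "\<dots> = (\<integral>\<^sup>+x. indicator A x \<partial>measure_pmf (pmf_of_multiset X))" by simp
  also have "\<dots> = (\<Sum>x\<in>set_mset X. indicator A x * ennreal (pmf (pmf_of_multiset X) x))"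
    using X by (subst nn_integral_measure_pmf_finite) auto
  also have "\<dots> = (\<Sum>x\<in>set_mset X. of_nat (count X x) * indicator A x / of_nat (n - k))"
  proof (rule sum.cong[OF refl])
    fix x
    have "ennreal (pmf (pmf_of_multiset X) x) = ennreal (real (count X x)) / ennreal (real (n - k))"
      using X size assms(1) by (simp add: divide_ennreal)
    also have "\<dots> = of_nat (count X x) / of_nat (n - k)" by (simp add: ennreal_of_nat_eq_real_of_nat)
    finally show "indicator A x * ennreal (pmf (pmf_of_multiset X) x) = of_nat (count X x) * indicator A x / of_nat (n - k)"
      by (simp add: divide_ennreal_def mult_ac)
  qed
  also have "\<dots> = (\<Sum>x\<in>set_mset X. of_nat (count X x) * indicator A x) / of_nat (n - k)"
    by (simp only: divide_ennreal_def sum_distrib_right)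
  also have "\<dots> = (\<Sum>w\<in>#X. indicator A w) / of_nat (n - k)"
    by (subst sum_mset_eq_sum_count[of "set_mset X"]) auto
  also have "\<dots> = emeasure (deriv_zeros_measure z k n) A"
    by (simp add: emeasure_deriv_zeros_measure[OF A] X_def)
  finally show "emeasure (deriv_zeros_measure z k n) A
    = emeasure (distr (measure_pmf (pmf_of_multiset X)) borel (\<lambda>x. x)) A" by simp
qed

lemma integral_deriv_zeros_measure:
  fixes f :: "complex \<Rightarrow> real"
  assumes "k < n" and [measurable]: "f \<in> borel_measurable borel"
  shows "(\<integral>x. f x \<partial>deriv_zeros_measure z k n)
    = (\<Sum>x\<in>#proots ((pderiv ^^ k) (random_poly z n)). f x) / real (n - k)"
proof -
  define X where "X = proots ((pderiv ^^ k) (random_poly z n))"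
  have size: "size X = n - k"
    by (simp add: X_def size_proots_complex degree_funpow_pderiv degree_random_poly)
  then have X: "X \<noteq> {#}" using assms(1) by auto
  have "(\<integral>x. f x \<partial>deriv_zeros_measure z k n) = (\<integral>x. f x \<partial>measure_pmf (pmf_of_multiset X))"
    unfolding deriv_zeros_measure_eq_distr[OF assms(1)] X_def by (subst integral_distr) auto
  also have "\<dots> = (\<Sum>x\<in>set_mset X. f x * pmf (pmf_of_multiset X) x)"
    using X by (subst integral_measure_pmf[of "set_mset X"]) (auto simp: mult.commute)
  also have "\<dots> = (\<Sum>x\<in>set_mset X. of_nat (count X x) * f x) / real (n - k)"
    using X size by (simp add: sum_divide_distrib mult.commute)
  also have "\<dots> = (\<Sum>x\<in>#X. f x) / real (n - k)"
    by (subst sum_mset_eq_sum_count[of "set_mset X" X f]) auto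
  finally show ?thesis by (simp add: X_def)
qed

text \<open>The leading coefficient is a falling factorial of the degree; polynomial bounds suffice
  since only its logarithm divided by \<open>n\<close> matters.\<close>

lemma lead_coeff_funpow_pderiv_bounds:
  fixes p :: "complex poly"
  assumes "lead_coeff p = 1" "k \<le> degree p"
  shows "1 \<le> norm (lead_coeff ((pderiv ^^ k) p))" "norm (lead_coeff ((pderiv ^^ k) p)) \<le> real (degree p) ^ k"
proof -
  have "1 \<le> norm (lead_coeff ((pderiv ^^ k) p)) \<and> norm (lead_coeff ((pderiv ^^ k) p)) \<le> real (degree p) ^ k"
    using assms(2)
  proof (induction k)
    case 0
    then show ?case using assms by simp
  next
    case (Suc k)
    define q where "q = (pderiv ^^ k) p"
    have deg: "degree q = degree p - k" "degree q \<ge> 1" using Suc.prems by (auto simp: q_def degree_funpow_pderiv)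
    have "lead_coeff ((pderiv ^^ Suc k) p) = of_nat (degree q) * lead_coeff q"
      using deg(2) by (simp add: q_def[symmetric] degree_pderiv coeff_pderiv)
    then have eq: "norm (lead_coeff ((pderiv ^^ Suc k) p)) = real (degree q) * norm (lead_coeff q)"
      by (simp only: norm_mult norm_of_nat)
    have IH: "1 \<le> norm (lead_coeff q)" "norm (lead_coeff q) \<le> real (degree p) ^ k"
      using Suc by (auto simp: q_def)
    have "1 * 1 \<le> real (degree q) * norm (lead_coeff q)" using deg IH by (intro mult_mono) auto
    moreover have "real (degree q) * norm (lead_coeff q) \<le> real (degree p) * real (degree p) ^ k"
      using deg IH by (intro mult_mono) auto
    ultimately show ?case unfolding eq by simp
  qed
  then show "1 \<le> norm (lead_coeff ((pderiv ^^ k) p))" "norm (lead_coeff ((pderiv ^^ k) p)) \<le> real (degree p) ^ k"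
    by auto
qed

lemma ln_norm_prod_mset:
  "0 \<notin># image_mset f X \<Longrightarrow> ln (norm (\<Prod>x\<in>#X. f x :: complex)) = (\<Sum>x\<in>#X. ln (norm (f x)))"
proof (induction X)
  case (add x X)
  then have nz: "f x \<noteq> 0" "(\<Prod>x\<in>#X. f x) \<noteq> 0" by (auto simp: prod_mset_zero_iff)
  have "ln (norm (\<Prod>x\<in>#add_mset x X. f x)) = ln (norm (f x) * norm (\<Prod>x\<in>#X. f x))" by (simp add: norm_mult)
  also have "\<dots> = ln (norm (f x)) + ln (norm (\<Prod>x\<in>#X. f x))" using nz by (subst ln_mult) auto
  finally show ?case using add by simp
qed simp

lemma sum_ln_norm_proots:
  fixes p :: "complex poly"
  assumes "poly p b \<noteq> 0"
  shows "(\<Sum>x\<in>#proots p. ln (norm (b - x))) = ln (norm (poly p b)) - ln (norm (lead_coeff p))"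
proof -
  have p: "p \<noteq> 0" using assms by auto
  have "poly (\<Prod>\<zeta>\<in>#A. [:- \<zeta>, 1:]) b = (\<Prod>\<zeta>\<in>#A. b - \<zeta>)" for A :: "complex multiset"
    by (induction A) (auto simp: algebra_simps)
  then have fac: "poly p b = lead_coeff p * (\<Prod>\<zeta>\<in>#proots p. b - \<zeta>)"
    by (subst complex_poly_decompose_multiset[symmetric]) (simp only: poly_smult)
  then have nz: "(\<Prod>\<zeta>\<in>#proots p. b - \<zeta>) \<noteq> 0" using assms by auto
  have "ln (norm (poly p b)) = ln (norm (lead_coeff p) * norm (\<Prod>\<zeta>\<in>#proots p. b - \<zeta>))"
    by (subst fac) (simp only: norm_mult)
  also have "\<dots> = ln (norm (lead_coeff p)) + ln (norm (\<Prod>\<zeta>\<in>#proots p. b - \<zeta>))"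
    using nz p by (subst ln_mult) auto
  also have "ln (norm (\<Prod>\<zeta>\<in>#proots p. b - \<zeta>)) = (\<Sum>x\<in>#proots p. ln (norm (b - x)))"
    using nz by (intro ln_norm_prod_mset) (simp add: prod_mset_zero_iff)
  finally show ?thesis by simp
qed

text \<open>After taking logarithms and dividing by \<open>n\<close> the bounds read
  \<open>- \<eta>\<close> and \<open>k * \<eta> + o(1)\<close>, with \<open>\<eta>\<close>
  arbitrarily small; choosing \<open>2 * (k + 1) * \<eta> < e\<close> leaves \<open>e / 2\<close>
  for the vanishing terms.\<close>

lemma ln_over_n_tendsto_of_bounds:
  fixes t :: "nat \<Rightarrow> real"
  assumes low: "\<And>i. \<forall>\<^sub>F n in sequentially. exp (- (1 / real (Suc i)) * n) < t n"
    and up: "\<And>i. \<exists>C\<ge>1. \<forall>\<^sub>F n in sequentially. t n \<le> (real n * C * exp (1 / real (Suc i) * n)) ^ k"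
  shows "(\<lambda>n. ln (t n) / n) \<longlonglongrightarrow> 0"
proof (rule LIMSEQ_I)
  fix e :: real assume e: "e > 0"
  have "e / (2 * (real k + 1)) > 0" using e by simp
  then obtain i where i: "1 / real (Suc i) < e / (2 * (real k + 1))" using nat_approx_posE by blast
  define \<eta> where "\<eta> = 1 / real (Suc i)"
  have \<eta>: "\<eta> > 0" "2 * (real k + 1) * \<eta> < e" using i by (auto simp: \<eta>_def field_simps)
  obtain C where C: "C \<ge> 1" "\<forall>\<^sub>F n in sequentially. t n \<le> (real n * C * exp (\<eta> * n)) ^ k"
    using up[of i] by (auto simp: \<eta>_def)
  have "(\<lambda>n. real k * (ln (real n) / real n + ln C / real n)) \<longlonglongrightarrow> real k * (0 + 0)"
    by (intro tendsto_intros lim_ln_over_n tendsto_divide_0 filterlim_real_sequentially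
        filterlim_at_top_imp_at_infinity)
  then have "\<forall>\<^sub>F n in sequentially. real k * (ln (real n) / real n + ln C / real n) < e / 2"
    using e by (intro order_tendstoD(2)) auto
  then have "\<forall>\<^sub>F n in sequentially. norm (ln (t n) / n - 0) < e"
    using low[of i] C(2) eventually_gt_at_top[of 0]
  proof eventually_elim
    case (elim n)
    have n: "real n > 0" using elim by simp
    have tpos: "t n > 0" using elim(2) by (rule less_trans[OF exp_gt_zero])
    have "- \<eta> * n \<le> ln (t n)"
      using elim(2) tpos by (subst ln_ge_iff) (auto simp: \<eta>_def)
    then have 1: "- \<eta> \<le> ln (t n) / n" using n by (simp add: field_simps)
    have pos: "real n * C * exp (\<eta> * n) > 0" using n C by simp
    have "ln (t n) \<le> ln ((real n * C * exp (\<eta> * n)) ^ k)"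
      using elim(3) tpos pos by (subst ln_le_cancel_iff) auto
    also have "\<dots> = real k * ln (real n * C * exp (\<eta> * n))" by (rule ln_realpow)
    also have "ln (real n * C * exp (\<eta> * n)) = ln n + ln C + \<eta> * n"
      using n C by (simp add: ln_mult)
    finally have "ln (t n) / n \<le> real k * (ln n + ln C + \<eta> * n) / n" using n by (intro divide_right_mono) auto
    also have "\<dots> = real k * (ln (real n) / real n + ln C / real n) + real k * \<eta>"
      using n by (simp add: field_simps)
    also have "\<dots> < e / 2 + real k * \<eta>" using elim(1) by simp
    finally have 2: "ln (t n) / n < e / 2 + real k * \<eta>" .
    have "real k * \<eta> \<ge> 0" using \<eta> by simp
    moreover have "2 * (real k * \<eta>) + 2 * \<eta> < e" using \<eta>(2) by (simp add: algebra_simps)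
    ultimately have "real k * \<eta> < e / 2" "\<eta> < e" using \<eta>(1) by linarith+
    then show ?case using 1 2 by (simp add: abs_less_iff)
  qed
  then show "\<exists>n0. \<forall>n\<ge>n0. norm (ln (t n) / n - 0) < e" by (simp add: eventually_sequentially)
qed

section \<open>Potentials of the zeros of the derivative\<close>

definition deriv_roots :: "(nat \<Rightarrow> complex) \<Rightarrow> nat \<Rightarrow> nat \<Rightarrow> complex multiset" where
  "deriv_roots z k n = proots ((pderiv ^^ k) (random_poly z n))"

definition sample :: "(nat \<Rightarrow> complex) \<Rightarrow> nat \<Rightarrow> complex multiset" where
  "sample z n = image_mset z (mset_set {1..n})"

lemma size_deriv_roots: "size (deriv_roots z k n) = n - k"
  by (simp add: deriv_roots_def size_proots_complex degree_funpow_pderiv degree_random_poly)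

lemma size_sample: "size (sample z n) = n"
  by (simp add: sample_def)

lemma sum_sample: "(\<Sum>y\<in>#sample z n. f y) = (\<Sum>j=1..n. f (z j))"
  by (simp add: sample_def image_mset.compositionality comp_def sum_unfold_sum_mset)

lemma lead_coeff_random_poly: "lead_coeff (random_poly z n) = 1"
  unfolding random_poly_def by (simp add: lead_coeff_prod)

lemma proots_random_poly: "proots (random_poly z n) = sample z n"
proof -
  have "proots (random_poly z n) = (\<Sum>j=1..n. {#z j#})"
    unfolding random_poly_def by (subst proots_prod) auto
  also have "\<dots> = image_mset z (mset_set {1..n})"
    by (induction n) (auto simp: atLeastAtMostSuc_conv)
  finally show ?thesis by (simp add: sample_def)
qed

text \<open>The potential difference equals \<open>ln (fact k) + ln (t n) - ln (L n)\<close>, with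
  \<open>t n\<close> the quotient of Taylor coefficient and value and \<open>L n\<close> the modulus
  of the leading coefficient of the derivative; each term is \<open>o(n)\<close>. Here
  \<open>low\<close> bounds \<open>t n\<close> from below and \<open>up\<close> bounds it from above
  through the sum of inverse distances.\<close>

lemma pot_diff_deriv_roots_tendsto:
  assumes ne: "\<And>j. j \<ge> 1 \<Longrightarrow> b \<noteq> z j"
    and low: "\<And>i. \<forall>\<^sub>F n in sequentially. \<not> small_at k (exp (- (1 / real (Suc i)) * n)) {1..n} z b"
    and up: "\<And>i. \<forall>\<^sub>F j in sequentially. exp (- (1 / real (Suc i)) * j) \<le> norm (b - z j)"
  shows "(\<lambda>n. pot_diff (deriv_roots z k n) (sample z n) b / n) \<longlonglongrightarrow> 0"
proof -
  define P where "P = (\<lambda>n. root_poly {1..n} z)"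
  have P_nz: "poly (P n) b \<noteq> 0" for n using ne by (auto simp: P_def poly_root_poly)
  define t where "t = (\<lambda>n. norm (taylor_coeff (P n) b k) / norm (poly (P n) b))"
  have t_low: "\<forall>\<^sub>F n in sequentially. exp (- (1 / real (Suc i)) * n) < t n" for i
    using low[of i]
  proof eventually_elim
    case (elim n)
    then have "exp (- (1 / real (Suc i)) * n) * norm (poly (P n) b) < norm (taylor_coeff (P n) b k)"
      using P_nz[of n] by (simp add: small_at_def P_def)
    then show ?case using P_nz[of n] by (simp add: t_def field_simps)
  qed
  have t_up: "\<exists>C\<ge>1. \<forall>\<^sub>F n in sequentially. t n \<le> (real n * C * exp (1 / real (Suc i) * n)) ^ k" for i
  proof -
    define \<eta> where "\<eta> = 1 / real (Suc i)"
    have \<eta>: "\<eta> > 0" by (simp add: \<eta>_def)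
    obtain j0 where j0: "\<And>j. j \<ge> j0 \<Longrightarrow> exp (- \<eta> * j) \<le> norm (b - z j)"
      using up[of i] by (auto simp: eventually_sequentially \<eta>_def)
    \<comment> \<open>The finitely many roots before \<open>j0\<close> obey no rate; their inverse
      distances are put into the constant.\<close>
    define C where "C = 1 + (\<Sum>j<j0. 1 / norm (b - z j))"
    have C: "C \<ge> 1" by (simp add: C_def sum_nonneg)
    have "t n \<le> (real n * C * exp (\<eta> * n)) ^ k" for n
    proof -
      have each: "1 / norm (b - z j) \<le> C * exp (\<eta> * n)" if j: "j \<in> {1..n}" for j
      proof (cases "j < j0")
        case True
        have "1 / norm (b - z j) \<le> (\<Sum>j<j0. 1 / norm (b - z j))"
          using True by (intro member_le_sum) auto
        then have "1 / norm (b - z j) \<le> C * 1" by (simp add: C_def)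
        also have "\<dots> \<le> C * exp (\<eta> * n)" using C \<eta> by (intro mult_left_mono) auto
        finally show ?thesis .
      next
        case False
        have nz: "norm (b - z j) > 0" using ne[of j] j by auto
        have "1 / norm (b - z j) \<le> 1 / exp (- \<eta> * j)" using j0[of j] False nz by (intro divide_left_mono) auto
        also have "\<dots> = exp (\<eta> * j)" by (simp add: exp_minus field_simps)
        also have "\<dots> \<le> exp (\<eta> * n)" using j \<eta> by simp
        also have "\<dots> \<le> C * exp (\<eta> * n)" using C by simp
        finally show ?thesis .
      qed
      have "norm (taylor_coeff (P n) b k) \<le> norm (poly (P n) b) * (\<Sum>j\<in>{1..n}. 1 / norm (b - z j)) ^ k"
        unfolding P_def using ne by (intro norm_taylor_coeff_root_poly_le_sum) auto
      then have "t n \<le> (\<Sum>j\<in>{1..n}. 1 / norm (b - z j)) ^ k"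
        using P_nz[of n] by (simp add: t_def field_simps)
      also have "\<dots> \<le> (\<Sum>j\<in>{1..n}. C * exp (\<eta> * n)) ^ k"
        by (intro power_mono sum_mono each sum_nonneg) auto
      also have "\<dots> = (real n * C * exp (\<eta> * n)) ^ k" by (simp add: mult.assoc)
      finally show ?thesis .
    qed
    then show ?thesis using C by (auto simp: \<eta>_def)
  qed
  have t_lim: "(\<lambda>n. ln (t n) / n) \<longlonglongrightarrow> 0" using t_low t_up by (rule ln_over_n_tendsto_of_bounds)
  define L where "L = (\<lambda>n. norm (lead_coeff ((pderiv ^^ k) (random_poly z n))))"
  have L_lim: "(\<lambda>n. ln (L n) / n) \<longlonglongrightarrow> 0"
  proof (rule tendsto_sandwich[OF _ _ tendsto_const])
    have L: "1 \<le> L n" "L n \<le> real n ^ k" if "n \<ge> k" for n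
      unfolding L_def using lead_coeff_funpow_pderiv_bounds[OF lead_coeff_random_poly, of k z n] that
      by (simp_all only: degree_random_poly)
    show "\<forall>\<^sub>F n in sequentially. 0 \<le> ln (L n) / n"
      using eventually_ge_at_top[of k] by eventually_elim (use L in simp)
    show "\<forall>\<^sub>F n in sequentially. ln (L n) / n \<le> real k * (ln (real n) / n)"
      using eventually_ge_at_top[of k] eventually_gt_at_top[of 0]
    proof eventually_elim
      case (elim n)
      have "ln (L n) \<le> ln (real n ^ k)" using L[OF elim(1)] elim(2) by (subst ln_le_cancel_iff) auto
      also have "\<dots> = real k * ln (real n)" by (rule ln_realpow)
      finally have "ln (L n) / n \<le> (real k * ln (real n)) / n" by (intro divide_right_mono) auto
      then show ?case by simp
    qed
    show "(\<lambda>n. real k * (ln (real n) / n)) \<longlonglongrightarrow> 0"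
      using tendsto_mult[OF tendsto_const[of "real k"] lim_ln_over_n] by simp
  qed
  have fact_lim: "(\<lambda>n. ln (fact k) / real n) \<longlonglongrightarrow> 0" by (rule lim_const_over_n)
  have "(\<lambda>n. ln (fact k) / real n + ln (t n) / n - ln (L n) / n) \<longlonglongrightarrow> 0 + 0 - 0"
    by (intro tendsto_intros t_lim L_lim fact_lim)
  moreover have "\<forall>\<^sub>F n in sequentially. ln (fact k) / real n + ln (t n) / n - ln (L n) / n
    = pot_diff (deriv_roots z k n) (sample z n) b / n"
    using t_low[of 0] eventually_ge_at_top[of k]
  proof eventually_elim
    case (elim n)
    have tpos: "t n > 0" using elim(1) by (rule less_trans[OF exp_gt_zero])
    have rp: "random_poly z n = P n" by (simp add: P_def random_poly_eq_root_poly)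
    have T_nz: "taylor_coeff (P n) b k \<noteq> 0" using tpos by (auto simp: t_def)
    have D: "poly ((pderiv ^^ k) (P n)) b = fact k * taylor_coeff (P n) b k"
      by (rule poly_funpow_pderiv_eq_taylor_coeff)
    have D_nz: "poly ((pderiv ^^ k) (P n)) b \<noteq> 0" unfolding D using T_nz by simp
    have "(\<Sum>x\<in>#deriv_roots z k n. ln (norm (b - x))) = ln (norm (poly ((pderiv ^^ k) (P n)) b)) - ln (L n)"
      unfolding deriv_roots_def L_def rp by (rule sum_ln_norm_proots[OF D_nz])
    also have "ln (norm (poly ((pderiv ^^ k) (P n)) b)) = ln (fact k) + ln (norm (taylor_coeff (P n) b k))"
      unfolding D norm_mult using T_nz by (subst ln_mult) (auto simp: norm_fact)
    also have "norm (taylor_coeff (P n) b k) = t n * norm (poly (P n) b)" using P_nz[of n] by (simp add: t_def)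
    also have "ln (t n * norm (poly (P n) b)) = ln (t n) + ln (norm (poly (P n) b))"
      using tpos P_nz[of n] by (subst ln_mult) auto
    finally have 1: "(\<Sum>x\<in>#deriv_roots z k n. ln (norm (b - x)))
      = ln (fact k) + (ln (t n) + ln (norm (poly (P n) b))) - ln (L n)" .
    have "(\<Sum>y\<in>#sample z n. ln (norm (b - y))) = ln (norm (poly (P n) b))"
      using sum_ln_norm_proots[OF P_nz[of n]] unfolding rp[symmetric] proots_random_poly lead_coeff_random_poly by simp
    then have "pot_diff (deriv_roots z k n) (sample z n) b = ln (fact k) + ln (t n) - ln (L n)"
      unfolding pot_diff_def 1 by simp
    then show ?case by (simp add: add_divide_distrib diff_divide_distrib)
  qed
  ultimately show ?thesis by (auto dest: Lim_transform_eventually)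
qed

text \<open>Borel-Cantelli in the variable \<open>b\<close>: the discs of radius
  \<open>exp (- \<eta> * j)\<close> about the \<open>z j\<close> have summable area, for any
  sequence whatsoever.\<close>

lemma AE_eventually_far:
  fixes z :: "nat \<Rightarrow> complex"
  shows "AE b in lborel. \<forall>i. \<forall>\<^sub>F j in sequentially. exp (- (1 / real (Suc i)) * j) \<le> norm (b - z j)"
proof -
  have "AE b in lborel. \<forall>\<^sub>F j in sequentially. exp (- (1 / real (Suc i)) * j) \<le> norm (b - z j)" for i
  proof -
    define \<eta> where "\<eta> = 1 / real (Suc i)"
    have \<eta>: "\<eta> > 0" by (simp add: \<eta>_def)
    define A where "A = (\<lambda>j. cball (z j) (exp (- \<eta> * real j)))"
    have measA: "measure lborel (A j) = pi * exp (- 2 * \<eta>) ^ j" for j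
    proof -
      have "emeasure lborel (A j) = ennreal (pi * (exp (- \<eta> * real j))\<^sup>2)"
        unfolding A_def by (rule emeasure_cball_complex) simp
      also have "(exp (- \<eta> * real j))\<^sup>2 = exp (- 2 * \<eta>) ^ j"
        by (simp add: power2_eq_square mult_exp_exp flip: exp_of_nat_mult)
      finally show ?thesis by (simp add: measure_def)
    qed
    have "AE b in lborel. \<forall>\<^sub>F j in sequentially. b \<in> space lborel - A j"
    proof (rule borel_cantelli_AE1)
      show "A j \<in> sets lborel" for j by (simp add: A_def)
      show "emeasure lborel (A j) < \<infinity>" for j unfolding A_def by (rule emeasure_lborel_cball_finite)
      show "summable (\<lambda>j. measure lborel (A j))"
        unfolding measA using \<eta> by (intro summable_mult summable_geometric) simp
    qed
    then show ?thesis
    proof eventually_elim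
      case (elim b)
      then show ?case
        by (rule eventually_mono) (auto simp: A_def \<eta>_def dist_norm norm_minus_commute not_le)
    qed
  qed
  then show ?thesis unfolding AE_all_countable by blast
qed

lemma AE_neq_sequence: "AE b in lborel. \<forall>j. b \<noteq> (z j :: complex)" for z :: "nat \<Rightarrow> complex"
  unfolding AE_all_countable using AE_lborel_neq by blast

text \<open>A zero of multiplicity \<open>N\<close> of the polynomial is a zero of multiplicity at least \<open>N - k\<close> of its
  \<open>k\<close>-th derivative, so for finitely many distinct roots the two zero multisets almost coincide.\<close>

lemma order_funpow_pderiv_ge:
  fixes p :: "complex poly"
  assumes "p \<noteq> 0"
  shows "(pderiv ^^ k) p \<noteq> 0 \<Longrightarrow> order w p \<le> order w ((pderiv ^^ k) p) + k"
proof (induction k)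
  case (Suc k)
  define q where "q = (pderiv ^^ k) p"
  have q: "pderiv q \<noteq> 0" "q \<noteq> 0" using Suc.prems by (auto simp: q_def)
  have "order w q \<le> Suc (order w (pderiv q))"
    using order_pderiv[OF q(2), of w] order_root[of q w] by (cases "poly q w = 0") auto
  then show ?case using Suc.IH q(2) by (simp add: q_def)
qed simp

text \<open>Both multisets consist of \<open>C\<close> and at most \<open>m\<close> further points,
  each contributing a value in the unit interval.\<close>

lemma sum_mset_close:
  fixes f :: "complex \<Rightarrow> real"
  assumes f: "\<And>x. 0 \<le> f x" "\<And>x. f x \<le> 1" and sub: "C \<subseteq># A" "C \<subseteq># B"
    and size: "size A \<le> size C + m" "size B \<le> size C + m"
  shows "\<bar>(\<Sum>x\<in>#A. f x) - (\<Sum>x\<in>#B. f x)\<bar> \<le> m"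
proof -
  have *: "0 \<le> (\<Sum>x\<in>#E. f x) \<and> (\<Sum>x\<in>#E. f x) \<le> size E" for E :: "complex multiset"
  proof (induction E)
    case (add x E)
    then show ?case using f[of x] by simp
  qed simp
  have "\<exists>E. A' = C + E \<and> size E \<le> m" if "C \<subseteq># A'" "size A' \<le> size C + m" for A'
    using that by (metis add_le_cancel_left mset_subset_eq_exists_conv size_union)
  then obtain E E' where "A = C + E" "size E \<le> m" "B = C + E'" "size E' \<le> m"
    using sub size by metis
  moreover from this have "real (size E) \<le> m" "real (size E') \<le> m" by auto
  then have "\<bar>(\<Sum>x\<in>#E. f x) - (\<Sum>x\<in>#E'. f x)\<bar> \<le> m" using *[of E] *[of E'] by linarith
  ultimately show ?thesis by simp
qed

text \<open>\<open>C\<close> is the sample with up to \<open>k\<close> copies of every point of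
  \<open>F\<close> removed; what remains survives as zeros of the derivative, so both multisets
  exceed \<open>C\<close> by at most \<open>k * card F\<close> points.\<close>

lemma deriv_roots_close_to_sample:
  fixes f :: "complex \<Rightarrow> real"
  assumes F: "finite F" "\<And>j. j \<ge> 1 \<Longrightarrow> z j \<in> F" and f: "\<And>x. 0 \<le> f x" "\<And>x. f x \<le> 1" and n: "n > k"
  shows "\<bar>(\<Sum>x\<in>#deriv_roots z k n. f x) - (\<Sum>x\<in>#sample z n. f x)\<bar> \<le> k * card F"
proof -
  define P where "P = random_poly z n"
  have P: "P \<noteq> 0" using degree_random_poly[of z n] n by (auto simp: P_def)
  have D: "(pderiv ^^ k) P \<noteq> 0"
    using degree_funpow_pderiv[of k P] degree_random_poly[of z n] n by (auto simp: P_def)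
  define R where "R = (\<Sum>w\<in>F. replicate_mset k w)"
  have countR: "count R w = k" if "w \<in> F" for w
    using F(1) that by (simp add: R_def count_sum)
  have "size (\<Sum>w\<in>S. replicate_mset k w) = k * card S" if "finite S" for S :: "complex set"
    using that by (induction S) auto
  then have sizeR: "size R = k * card F" using F(1) by (simp add: R_def)
  define C where "C = sample z n - R"
  have sub1: "C \<subseteq># sample z n" by (simp add: C_def)
  have sub2: "C \<subseteq># deriv_roots z k n"
  proof (rule mset_subset_eqI)
    fix w
    show "count C w \<le> count (deriv_roots z k n) w"
    proof (cases "w \<in> F")
      case True
      have "count (sample z n) w = order w P" using P by (simp add: P_def proots_random_poly[symmetric])
      also have "\<dots> \<le> order w ((pderiv ^^ k) P) + k" by (rule order_funpow_pderiv_ge[OF P D])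
      also have "order w ((pderiv ^^ k) P) = count (deriv_roots z k n) w"
        using D by (simp add: deriv_roots_def P_def)
      finally show ?thesis using countR[OF True] by (simp add: C_def)
    next
      case False
      then have "w \<notin># sample z n" using F(2) by (auto simp: sample_def)
      then have "count (sample z n) w = 0" by (simp only: not_in_iff)
      then show ?thesis by (simp add: C_def)
    qed
  qed
  have "size (sample z n) \<le> size C + k * card F"
    using diff_size_le_size_Diff[of "sample z n" R] unfolding C_def sizeR by linarith
  then show ?thesis
    using size_deriv_roots[of z k n] size_sample[of z n]
    by (intro sum_mset_close[OF f sub2 sub1]) (auto simp flip: of_nat_mult)
qed

section \<open>Almost sure convergence\<close>

context iid_complex
begin

text \<open>Expected areas of order \<open>n ^ (- 2)\<close> are summable, so almost surely the
  areas themselves have a finite sum and Borel-Cantelli applies in \<open>b\<close>. The integer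
  window radii \<open>R\<close> exhaust the plane.\<close>

lemma AE_eventually_not_small:
  fixes k :: nat and \<epsilon> :: real
  assumes sep: "\<forall>d. \<exists>s r. 0 < r \<and> r \<le> 1 \<and> (\<forall>a\<le>(d::nat). measure \<mu> (ball (s a) r) > 0) \<and>
      (\<forall>a\<le>d. \<forall>a'\<le>d. a \<noteq> a' \<longrightarrow> (\<forall>x\<in>ball (s a) r. \<forall>y\<in>ball (s a') r. norm (x - y) \<ge> r))"
    and k: "k \<ge> 1" and \<epsilon>: "\<epsilon> > 0"
  shows "AE \<omega> in M. AE b in lborel. \<forall>\<^sub>F n in sequentially. \<not> small_at k (exp (- \<epsilon> * n)) {1..n} (\<lambda>j. Z j \<omega>) b"
proof -
  have sa_meas: "(\<lambda>\<omega>. small_area k \<delta> R n (\<lambda>j. Z j \<omega>)) \<in> borel_measurable M" for \<delta> R n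
    by (rule small_area_measurable_comp) (use Z_measurable in simp)
  have "AE \<omega> in M. AE b in lborel. b \<in> cball 0 (real R) \<longrightarrow> (\<forall>\<^sub>F n in sequentially. \<not> small_at k (exp (- \<epsilon> * n)) {1..n} (\<lambda>j. Z j \<omega>) b)" for R :: nat
  proof -
    obtain C n0 where C: "C \<ge> 0" "\<And>n. n \<ge> n0 \<Longrightarrow> (\<integral>\<^sup>+\<omega>. small_area k (exp (- \<epsilon> * n)) R n (\<lambda>j. Z j \<omega>) \<partial>M) \<le> ennreal (C / (real n)\<^sup>2)"
      using expected_small_area_decay[OF sep k \<epsilon>, of "real R"] by auto
    \<comment> \<open>Shifted by \<open>n0\<close>, from where on the decay holds; the first indices
      do not affect an eventual statement.\<close>
    define a where "a = (\<lambda>n \<omega>. small_area k (exp (- \<epsilon> * (n + n0))) R (n + n0) (\<lambda>j. Z j \<omega>))"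
    have a_meas [measurable]: "a n \<in> borel_measurable M" for n unfolding a_def by (rule sa_meas)
    have "summable (\<lambda>n. inverse ((real n)\<^sup>2))" by (rule inverse_power_summable) simp
    then have "summable (\<lambda>n. C * inverse ((real (n + n0))\<^sup>2))"
      by (intro summable_mult summable_ignore_initial_segment)
    then have summ: "summable (\<lambda>n. C / (real (n + n0))\<^sup>2)" by (simp add: divide_inverse)
    have "(\<integral>\<^sup>+\<omega>. (\<Sum>n. a n \<omega>) \<partial>M) = (\<Sum>n. \<integral>\<^sup>+\<omega>. a n \<omega> \<partial>M)" by (rule nn_integral_suminf) simp
    also have "\<dots> \<le> (\<Sum>n. ennreal (C / (real (n + n0))\<^sup>2))"
      unfolding a_def by (intro suminf_le C) auto
    also have "\<dots> = ennreal (\<Sum>n. C / (real (n + n0))\<^sup>2)"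
      using C(1) summ by (intro suminf_ennreal2) auto
    finally have "(\<integral>\<^sup>+\<omega>. (\<Sum>n. a n \<omega>) \<partial>M) \<noteq> \<infinity>" by (auto simp: top_unique)
    then have "AE \<omega> in M. (\<Sum>n. a n \<omega>) \<noteq> \<infinity>" by (intro nn_integral_noteq_infinite) auto
    then show ?thesis
    proof eventually_elim
      case (elim \<omega>)
      define A where "A = (\<lambda>n. {b \<in> cball 0 (real R). small_at k (exp (- \<epsilon> * (n + n0))) {1..n + n0} (\<lambda>j. Z j \<omega>) b})"
      have A_eq: "emeasure lborel (A n) = a n \<omega>" for n by (simp add: A_def a_def small_area_def)
      have A_sets: "A n \<in> sets borel" for n
      proof -
        have [measurable]: "Measurable.pred borel (\<lambda>b. small_at k (exp (- \<epsilon> * (n + n0))) {1..n + n0} (\<lambda>j. Z j \<omega>) b)"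
          by (rule pred_small_at) auto
        have "A n = cball 0 (real R) \<inter> {b \<in> space borel. small_at k (exp (- \<epsilon> * (n + n0))) {1..n + n0} (\<lambda>j. Z j \<omega>) b}"
          by (auto simp: A_def)
        also have "\<dots> \<in> sets borel" by (intro sets.Int; measurable)
        finally show ?thesis .
      qed
      have A_fin: "emeasure lborel (A n) < \<infinity>" for n
      proof -
        have "a n \<omega> \<le> ennreal (pi * (real R)\<^sup>2)" unfolding a_def by (rule small_area_le) simp
        also have "\<dots> < \<infinity>" by simp
        finally show ?thesis by (simp only: A_eq)
      qed
      have "(\<Sum>n. ennreal (measure lborel (A n))) = (\<Sum>n. a n \<omega>)"
      proof (intro suminf_cong)
        fix n
        have "emeasure lborel (A n) \<noteq> \<infinity>" using A_fin[of n] by auto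
        from emeasure_eq_ennreal_measure[OF this[unfolded infinity_ennreal_def]] show "ennreal (measure lborel (A n)) = a n \<omega>"
          by (simp only: A_eq)
      qed
      then have "summable (\<lambda>n. measure lborel (A n))"
        using elim by (intro summable_suminf_not_top) auto
      then have "AE b in lborel. \<forall>\<^sub>F n in sequentially. b \<in> space lborel - A n"
        using A_sets A_fin by (intro borel_cantelli_AE1) auto
      then show ?case
      proof eventually_elim
        case (elim b)
        show ?case
        proof
          assume b: "b \<in> cball 0 (real R)"
          have "\<forall>\<^sub>F n in sequentially. \<not> small_at k (exp (- \<epsilon> * (n + n0))) {1..n + n0} (\<lambda>j. Z j \<omega>) b"
            using elim by (rule eventually_mono) (use b in \<open>simp add: A_def\<close>)
          then show "\<forall>\<^sub>F n in sequentially. \<not> small_at k (exp (- \<epsilon> * n)) {1..n} (\<lambda>j. Z j \<omega>) b"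
            using eventually_sequentially_seg[of "\<lambda>n. \<not> small_at k (exp (- \<epsilon> * n)) {1..n} (\<lambda>j. Z j \<omega>) b" n0] by simp
        qed
      qed
    qed
  qed
  then have "AE \<omega> in M. \<forall>R::nat. AE b in lborel. b \<in> cball 0 (real R) \<longrightarrow> (\<forall>\<^sub>F n in sequentially. \<not> small_at k (exp (- \<epsilon> * n)) {1..n} (\<lambda>j. Z j \<omega>) b)"
    unfolding AE_all_countable by blast
  then show ?thesis
  proof eventually_elim
    case (elim \<omega>)
    then have "AE b in lborel. \<forall>R::nat. b \<in> cball 0 (real R) \<longrightarrow> (\<forall>\<^sub>F n in sequentially. \<not> small_at k (exp (- \<epsilon> * n)) {1..n} (\<lambda>j. Z j \<omega>) b)"
      unfolding AE_all_countable .
    then show ?case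
    proof eventually_elim
      case (elim b)
      obtain R :: nat where "norm b \<le> real R" using real_arch_simple by blast
      then show ?case using elim by (auto simp: dist_norm)
    qed
  qed
qed

text \<open>The exceptional event comes from the rates \<open>1 / Suc i\<close> alone; for the
  remaining outcomes the potential argument is deterministic, so it yields all radii and centres at
  once.\<close>

lemma AE_tent_diff_separated:
  assumes sep: "\<forall>d. \<exists>s r. 0 < r \<and> r \<le> 1 \<and> (\<forall>a\<le>(d::nat). measure \<mu> (ball (s a) r) > 0) \<and>
      (\<forall>a\<le>d. \<forall>a'\<le>d. a \<noteq> a' \<longrightarrow> (\<forall>x\<in>ball (s a) r. \<forall>y\<in>ball (s a') r. norm (x - y) \<ge> r))"
    and k: "k \<ge> 1"
  shows "AE \<omega> in M. \<forall>r>0. \<forall>a. (\<lambda>n. ((\<Sum>x\<in>#deriv_roots (\<lambda>j. Z j \<omega>) k n. log_tent r (x - a))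
    - (\<Sum>x\<in>#sample (\<lambda>j. Z j \<omega>) n. log_tent r (x - a))) / n) \<longlonglongrightarrow> 0"
proof -
  have "AE \<omega> in M. \<forall>i. AE b in lborel. \<forall>\<^sub>F n in sequentially. \<not> small_at k (exp (- (1 / real (Suc i)) * n)) {1..n} (\<lambda>j. Z j \<omega>) b"
    unfolding AE_all_countable by (intro allI AE_eventually_not_small[OF sep k]) simp
  then show ?thesis
  proof eventually_elim
    case (elim \<omega>)
    define z where "z = (\<lambda>j. Z j \<omega>)"
    have "AE b in lborel. \<forall>i. \<forall>\<^sub>F n in sequentially. \<not> small_at k (exp (- (1 / real (Suc i)) * n)) {1..n} z b"
      using elim unfolding AE_all_countable z_def .
    then have pot: "AE b in lborel. (\<lambda>n. pot_diff (deriv_roots z k n) (sample z n) b / n) \<longlonglongrightarrow> 0"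
      using AE_eventually_far[of z] AE_neq_sequence[of z]
    proof eventually_elim
      case (elim b)
      then show ?case by (intro pot_diff_deriv_roots_tendsto) auto
    qed
    have lim: "(\<lambda>n. pot_diff_max r (deriv_roots z k n) (sample z n) a / n) \<longlonglongrightarrow> 0" if "r > 0" for r a
      by (rule pot_diff_max_tendsto[OF _ _ pot that]) (simp_all add: size_deriv_roots size_sample)
    show ?case
    proof (intro allI impI)
      fix r :: real and a assume r: "r > 0"
      have tent: "log_tent r (x - a) = log_max (2 * r) (a - x) - log_max r (a - x)" for x
        by (simp add: log_tent_def log_max_def norm_minus_commute)
      have sub: "(\<Sum>x\<in>#X. log_tent r (x - a)) = (\<Sum>x\<in>#X. log_max (2 * r) (a - x)) - (\<Sum>x\<in>#X. log_max r (a - x))" for X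
        by (induction X) (auto simp: tent)
      have "(\<lambda>n. pot_diff_max (2 * r) (deriv_roots z k n) (sample z n) a / n
        - pot_diff_max r (deriv_roots z k n) (sample z n) a / n) \<longlonglongrightarrow> 0 - 0"
        using r by (intro tendsto_diff lim) auto
      then show "(\<lambda>n. ((\<Sum>x\<in>#deriv_roots (\<lambda>j. Z j \<omega>) k n. log_tent r (x - a))
        - (\<Sum>x\<in>#sample (\<lambda>j. Z j \<omega>) n. log_tent r (x - a))) / n) \<longlonglongrightarrow> 0"
        unfolding sub pot_diff_max_def z_def[symmetric] by (simp add: diff_divide_distrib[symmetric] algebra_simps)
    qed
  qed
qed

lemma log_tent_in_unit: "r > 0 \<Longrightarrow> log_tent r x \<in> {0..1}"
  using log_tent_bounds[of r x] ln_2_less_1 by auto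

text \<open>The difference of the two sums is bounded by \<open>k * card F\<close>, independently of
  \<open>n\<close>.\<close>

lemma AE_tent_diff_finite:
  assumes F: "finite F" "AE z in \<mu>. z \<in> F"
  shows "AE \<omega> in M. \<forall>r>0. \<forall>a. (\<lambda>n. ((\<Sum>x\<in>#deriv_roots (\<lambda>j. Z j \<omega>) k n. log_tent r (x - a))
    - (\<Sum>x\<in>#sample (\<lambda>j. Z j \<omega>) n. log_tent r (x - a))) / n) \<longlonglongrightarrow> 0"
proof -
  have F_sets: "F \<in> sets borel" using F(1) by (rule borel_closed[OF finite_imp_closed])
  have "AE \<omega> in M. Z j \<omega> \<in> F" if j: "j \<ge> 1" for j
  proof -
    have "AE z in distr M borel (Z j). z \<in> F" unfolding distr_Z[OF j] by (rule F(2))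
    then show ?thesis using F_sets by (subst (asm) AE_distr_iff[OF Z_measurable[OF j]]) auto
  qed
  then have "AE \<omega> in M. \<forall>j. j \<ge> 1 \<longrightarrow> Z j \<omega> \<in> F" unfolding AE_all_countable by auto
  then show ?thesis
  proof eventually_elim
    case (elim \<omega>)
    show ?case
    proof (intro allI impI)
      fix r :: real and a assume r: "r > 0"
      define d where "d = (\<lambda>n. (\<Sum>x\<in>#deriv_roots (\<lambda>j. Z j \<omega>) k n. log_tent r (x - a))
        - (\<Sum>x\<in>#sample (\<lambda>j. Z j \<omega>) n. log_tent r (x - a)))"
      have bound: "\<bar>d n\<bar> \<le> k * card F" if "n > k" for n
        unfolding d_def using elim log_tent_in_unit[OF r] by (intro deriv_roots_close_to_sample[OF F(1) _ _ _ that]) auto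
      have "\<forall>\<^sub>F n in sequentially. norm (d n / n) \<le> real (k * card F) / n"
        using eventually_gt_at_top[of k]
      proof eventually_elim
        case (elim n)
        have "\<bar>d n\<bar> / n \<le> real (k * card F) / n" using bound[OF elim] by (intro divide_right_mono) auto
        then show ?case by simp
      qed
      moreover have "(\<lambda>n. real (k * card F) / real n) \<longlonglongrightarrow> 0" by (rule lim_const_over_n)
      ultimately have "(\<lambda>n. d n / n) \<longlonglongrightarrow> 0" by (rule Lim_null_comparison)
      then show "(\<lambda>n. ((\<Sum>x\<in>#deriv_roots (\<lambda>j. Z j \<omega>) k n. log_tent r (x - a))
        - (\<Sum>x\<in>#sample (\<lambda>j. Z j \<omega>) n. log_tent r (x - a))) / n) \<longlonglongrightarrow> 0" by (simp only: d_def)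
    qed
  qed
qed

text \<open>The strong law is used at a countable dense set of centres; the Lipschitz bound of
  \<open>log_tent\<close> extends it to all centres outside one null set.\<close>

lemma AE_sample_mean_log_tent:
  "AE \<omega> in M. \<forall>i a. (\<lambda>n. (\<Sum>j=1..n. log_tent (1 / real (Suc i)) (Z j \<omega> - a)) / n)
    \<longlonglongrightarrow> (\<integral>z. log_tent (1 / real (Suc i)) (z - a) \<partial>\<mu>)"
proof -
  obtain D :: "complex set" where D: "countable D" "\<And>X. open X \<Longrightarrow> X \<noteq> {} \<Longrightarrow> \<exists>d\<in>D. d \<in> X"
    using countable_dense_setE by blast
  have "AE \<omega> in M. \<forall>i. \<forall>a\<in>D. (\<lambda>n. (\<Sum>j=1..n. log_tent (1 / real (Suc i)) (Z j \<omega> - a)) / n)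
    \<longlonglongrightarrow> (\<integral>z. log_tent (1 / real (Suc i)) (z - a) \<partial>\<mu>)"
    unfolding AE_all_countable AE_ball_countable[OF D(1)]
    by (intro allI ballI strong_law log_tent_in_unit) auto
  then show ?thesis
  proof eventually_elim
    case (elim \<omega>)
    show ?case
    proof (intro allI)
      fix i and a :: complex
      define r where "r = 1 / real (Suc i)"
      have r: "r > 0" by (simp add: r_def)
      interpret \<mu>: prob_space \<mu> by (rule prob_\<mu>)
      have [measurable_cong]: "sets \<mu> = sets borel" by (rule sets_\<mu>)
      have int: "integrable \<mu> (\<lambda>z. log_tent r (z - a))" for a
        using log_tent_in_unit[OF r] by (intro \<mu>.integrable_const_bound[where B = 1]) auto
      show "(\<lambda>n. (\<Sum>j=1..n. log_tent (1 / real (Suc i)) (Z j \<omega> - a)) / n)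
        \<longlonglongrightarrow> (\<integral>z. log_tent (1 / real (Suc i)) (z - a) \<partial>\<mu>)"
        unfolding r_def[symmetric]
      proof (rule LIMSEQ_I)
        fix e :: real assume e: "e > 0"
        \<comment> \<open>The Lipschitz constant is \<open>2 / r\<close>, so moving the centre by
          \<open>e * r / 6\<close> costs \<open>e / 3\<close>, once for the sample mean and once for
          the integral.\<close>
        have "e * r / 6 > 0" using e r by simp
        then have "ball a (e * r / 6) \<noteq> {}" using centre_in_ball[of a "e * r / 6"] by blast
        then obtain a' where a': "a' \<in> D" "dist a a' < e * r / 6" using D(2)[of "ball a (e * r / 6)"] by auto
        have close: "\<bar>log_tent r (x - a) - log_tent r (x - a')\<bar> \<le> e / 3" for x
        proof -
          have "\<bar>log_tent r (x - a) - log_tent r (x - a')\<bar> \<le> 2 * norm ((x - a) - (x - a')) / r"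
            by (rule log_tent_lipschitz[OF r])
          also have "norm ((x - a) - (x - a')) = dist a a'" by (simp add: dist_norm norm_minus_commute)
          also have "2 * dist a a' / r \<le> 2 * (e * r / 6) / r" using a' r by (intro divide_right_mono mult_left_mono) auto
          also have "\<dots> = e / 3" using r by simp
          finally show ?thesis .
        qed
        have int_close: "\<bar>(\<integral>z. log_tent r (z - a) \<partial>\<mu>) - (\<integral>z. log_tent r (z - a') \<partial>\<mu>)\<bar> \<le> e / 3"
        proof -
          have "(\<integral>z. log_tent r (z - a) \<partial>\<mu>) - (\<integral>z. log_tent r (z - a') \<partial>\<mu>)
            = (\<integral>z. log_tent r (z - a) - log_tent r (z - a') \<partial>\<mu>)" by (simp add: int)
          also have "\<bar>\<dots>\<bar> \<le> (\<integral>z. \<bar>log_tent r (z - a) - log_tent r (z - a')\<bar> \<partial>\<mu>)"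
            by (rule integral_abs_bound)
          also have "\<dots> \<le> e / 3"
            using close int by (intro \<mu>.integral_le_const) auto
          finally show ?thesis .
        qed
        have "(\<lambda>n. (\<Sum>j=1..n. log_tent r (Z j \<omega> - a')) / n) \<longlonglongrightarrow> (\<integral>z. log_tent r (z - a') \<partial>\<mu>)"
          using elim a'(1) by (simp only: r_def)
        from LIMSEQ_D[OF this, of "e / 3"] e obtain n0 where n0: "\<And>n. n \<ge> n0 \<Longrightarrow>
          norm ((\<Sum>j=1..n. log_tent r (Z j \<omega> - a')) / n - (\<integral>z. log_tent r (z - a') \<partial>\<mu>)) < e / 3" by auto
        have "norm ((\<Sum>j=1..n. log_tent r (Z j \<omega> - a)) / n - (\<integral>z. log_tent r (z - a) \<partial>\<mu>)) < e" if n: "n \<ge> n0" for n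
        proof -
          have "\<bar>(\<Sum>j=1..n. log_tent r (Z j \<omega> - a)) - (\<Sum>j=1..n. log_tent r (Z j \<omega> - a'))\<bar>
            \<le> (\<Sum>j=1..n. \<bar>log_tent r (Z j \<omega> - a) - log_tent r (Z j \<omega> - a')\<bar>)"
            unfolding sum_subtractf[symmetric] by (rule sum_abs)
          also have "\<dots> \<le> (\<Sum>j=1..n. e / 3)" by (intro sum_mono close)
          finally have "\<bar>(\<Sum>j=1..n. log_tent r (Z j \<omega> - a)) - (\<Sum>j=1..n. log_tent r (Z j \<omega> - a'))\<bar> / n \<le> (n * (e / 3)) / n"
            by (intro divide_right_mono) auto
          also have "(n * (e / 3)) / n \<le> e / 3" using e by (cases "n = 0") auto
          finally have "\<bar>(\<Sum>j=1..n. log_tent r (Z j \<omega> - a)) / n - (\<Sum>j=1..n. log_tent r (Z j \<omega> - a')) / n\<bar> \<le> e / 3"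
            unfolding diff_divide_distrib[symmetric] abs_divide abs_of_nat .
          then show ?thesis using n0[OF n] int_close unfolding real_norm_def by linarith
        qed
        then show "\<exists>n0. \<forall>n\<ge>n0. norm ((\<Sum>j=1..n. log_tent r (Z j \<omega> - a)) / n - (\<integral>z. log_tent r (z - a) \<partial>\<mu>)) < e" by blast
      qed
    qed
  qed
qed

lemma AE_weakly_converges:
  assumes k: "k \<ge> 1"
  shows "AE \<omega> in M. weakly_converges (deriv_zeros_measure (\<lambda>j. Z j \<omega>) k) \<mu>"
proof -
  have "AE \<omega> in M. \<forall>r>0. \<forall>a. (\<lambda>n. ((\<Sum>x\<in>#deriv_roots (\<lambda>j. Z j \<omega>) k n. log_tent r (x - a))
    - (\<Sum>x\<in>#sample (\<lambda>j. Z j \<omega>) n. log_tent r (x - a))) / n) \<longlonglongrightarrow> 0"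
    using finite_support_or_separated_balls[OF prob_\<mu> sets_\<mu>]
  proof
    assume "\<exists>F. finite F \<and> (AE z in \<mu>. z \<in> F)"
    then show ?thesis using AE_tent_diff_finite by blast
  qed (rule AE_tent_diff_separated[OF _ k])
  then show ?thesis using AE_sample_mean_log_tent
  proof eventually_elim
    case (elim \<omega>)
    define z where "z = (\<lambda>j. Z j \<omega>)"
    show ?case
      unfolding z_def[symmetric]
    proof (rule weakly_converges_log_tent[where k = k])
      fix i and a :: complex
      define r where "r = 1 / real (Suc i)"
      have r: "r > 0" by (simp add: r_def)
      define X where "X = (\<lambda>n. \<Sum>x\<in>#deriv_roots z k n. log_tent r (x - a))"
      define Y where "Y = (\<lambda>n. \<Sum>j=1..n. log_tent r (z j - a))"
      define I where "I = (\<integral>x. log_tent r (x - a) \<partial>\<mu>)"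
      have "(\<lambda>n. (X n - Y n) / n) \<longlonglongrightarrow> 0" using elim(1) r by (simp add: X_def Y_def sum_sample z_def)
      moreover have "(\<lambda>n. Y n / n) \<longlonglongrightarrow> I" using elim(2) unfolding Y_def z_def I_def r_def by blast
      ultimately have "(\<lambda>n. (X n - Y n) / n + Y n / n) \<longlonglongrightarrow> 0 + I" by (rule tendsto_add)
      \<comment> \<open>Converts the normalisation by \<open>n\<close> into the one by
        \<open>n - k\<close> used in \<open>deriv_zeros_measure\<close>.\<close>
      moreover have "(\<lambda>n. 1 / (1 - real k / real n)) \<longlonglongrightarrow> 1 / (1 - 0)"
        by (intro tendsto_divide tendsto_diff tendsto_const lim_const_over_n) auto
      ultimately have "(\<lambda>n. ((X n - Y n) / n + Y n / n) * (1 / (1 - real k / real n))) \<longlonglongrightarrow> (0 + I) * (1 / (1 - 0))"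
        by (rule tendsto_mult)
      moreover have "\<forall>\<^sub>F n in sequentially. ((X n - Y n) / n + Y n / n) * (1 / (1 - real k / real n))
        = (\<integral>x. log_tent r (x - a) \<partial>deriv_zeros_measure z k n)"
        using eventually_gt_at_top[of k]
      proof eventually_elim
        case (elim n)
        have "((X n - Y n) / n + Y n / n) * (1 / (1 - real k / real n)) = X n / (real n - real k)"
          using elim by (simp add: field_simps)
        also have "\<dots> = (\<integral>x. log_tent r (x - a) \<partial>deriv_zeros_measure z k n)"
          using elim by (subst integral_deriv_zeros_measure) (auto simp: X_def deriv_roots_def of_nat_diff)
        finally show ?case .
      qed
      ultimately have "(\<lambda>n. \<integral>x. log_tent r (x - a) \<partial>deriv_zeros_measure z k n) \<longlonglongrightarrow> (0 + I) * (1 / (1 - 0))"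
        by (rule Lim_transform_eventually)
      then show "(\<lambda>n. \<integral>x. log_tent (1 / real (Suc i)) (x - a) \<partial>deriv_zeros_measure z k n)
        \<longlonglongrightarrow> (\<integral>x. log_tent (1 / real (Suc i)) (x - a) \<partial>\<mu>)"
        by (simp add: I_def r_def)
    qed (simp_all add: prob_space_deriv_zeros_measure prob_\<mu> sets_\<mu>)
  qed
qed

end

theorem theorem1p1:
  fixes M :: "'a measure" and \<mu> :: "complex measure" and Z :: "nat \<Rightarrow> 'a \<Rightarrow> complex"
  assumes "prob_space M"
    and "prob_space \<mu>" and "sets \<mu> = sets borel"
    and "prob_space.indep_vars M (\<lambda>_. borel) Z {1..}"
    and "\<And>j. j \<ge> 1 \<Longrightarrow> distr M borel (Z j) = \<mu>"
  shows "AE \<omega> in M. \<forall>k\<ge>1. weakly_converges (deriv_zeros_measure (\<lambda>j. Z j \<omega>) k) \<mu>"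
proof -
  interpret prob_space M by fact
  interpret iid_complex M \<mu> Z
    by (intro iid_complex.intro iid_complex_axioms.intro) (fact assms)+
  have "AE \<omega> in M. \<forall>k. k \<ge> 1 \<longrightarrow> weakly_converges (deriv_zeros_measure (\<lambda>j. Z j \<omega>) k) \<mu>"
    unfolding AE_all_countable using AE_weakly_converges by auto
  then show ?thesis by simp
qed

end
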